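(* Let $(\mathcal{M},\mathrm{we}\,\mathcal{M},\mathcal{F})$ be a fibration category. Then the simplicial space $N_\xi\mathcal{M}$ is Reedy fibrant.
   Context: A relative category is a category $\mathcal{M}$ together with a subcategory $\mathrm{we}\,\mathcal{M}$ containing all objects (the weak equivalences); a relative functor is a functor preserving weak equivalences; $\mathrm{RelCat}$ is the category of relative categories and relative functors (set-theoretic size issues are ignored). A fibration category is a relative category $(\mathcal{M},\mathrm{we}\,\mathcal{M})$ with a subcategory $\mathcal{F}$ of fibrations such that: (F1) $\mathcal{M}$ has a terminal object $\ast$, which is fibrant (an object $x$ is fibrant if $x\to\ast$ is a fibration); (F2) all isomorphisms are weak equivalences, and isomorphisms with fibrant codomain are fibrations; (F3) (2-out-of-6) if $f,g,h$ are composable and $gf$, $hg$ are weak equivalences, then so are $f,g,h$; (F4) for $f\colon A\to C$ between fibrant objects and a (trivial) fibration $p\colon B\to C$, the pullback $B\times_C A$ exists and $B\times_CA\to A$ is a (trivial) fibration, where trivial fibration means fibration and weak equivalence; (F5) every $f\colon A\to C$ with $C$ fibrant factors as $ps$ with $s$ a weak equivalence and $p$ a fibration. For $p\ge 0$ let $\underline{p}$ be the poset $0<1<\dots<p$; $\check{\underline p}$ has only identities as weak equivalences, $\hat{\underline q}$ has all morphisms as weak equivalences; products of relative categories have componentwise weak equivalences. For a poset $P$ with a relative structure, the relative poset $\xi P$ (double subdivision, $\xi=\xi_t\xi_i$) has as objects the strictly increasing sequences $A_0\subsetneq A_1\subsetneq\dots\subsetneq A_m$ ($m\ge0$) of non-empty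 finite totally ordered subsets of $P$; $B_\bullet\le A_\bullet$ iff every $B_j$ occurs among the $A_i$; and such a morphism is a weak equivalence iff the morphism $\min B_0\le \min A_0$ of $P$ is a weak equivalence in $P$. The simplicial space (bisimplicial set) $N_\xi\mathcal{M}$ has $(N_\xi\mathcal{M})_{pq}=\mathrm{RelCat}(\xi(\check{\underline p}\times\hat{\underline q}),\mathcal{M})$, functorial in $(p,q)$. A bisimplicial set $X$ is viewed as a simplicial object $m\mapsto X_{m\bullet}$ in simplicial sets; it is Reedy fibrant if for every $m$ the matching map $X_{m\bullet}\to M_mX$ is a Kan fibration. *)

theory Defs
  imports Main
begin

record ('o, 'm) cat =
  c_obj  :: "'o set"
  c_arr  :: "'m set"
  c_dom  :: "'m \<Rightarrow> 'o"
  c_cod  :: "'m \<Rightarrow> 'o"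
  c_id   :: "'o \<Rightarrow> 'm"
  c_comp :: "'m \<Rightarrow> 'm \<Rightarrow> 'm"  (* c_comp C g f = g o f, for cod f = dom g *)

definition hom :: "('o, 'm) cat \<Rightarrow> 'o \<Rightarrow> 'o \<Rightarrow> 'm set" where
  "hom C x y = {f \<in> c_arr C. c_dom C f = x \<and> c_cod C f = y}"

definition category :: "('o, 'm) cat \<Rightarrow> bool" where
  "category C \<longleftrightarrow>
     (\<forall>f \<in> c_arr C. c_dom C f \<in> c_obj C \<and> c_cod C f \<in> c_obj C) \<and>
     (\<forall>x \<in> c_obj C. c_id C x \<in> hom C x x) \<and>
     (\<forall>f \<in> c_arr C. \<forall>g \<in> c_arr C. c_cod C f = c_dom C g \<longrightarrow>
        c_comp C g f \<in> hom C (c_dom C f) (c_cod C g)) \<and>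
     (\<forall>f \<in> c_arr C. c_comp C f (c_id C (c_dom C f)) = f \<and> c_comp C (c_id C (c_cod C f)) f = f) \<and>
     (\<forall>f \<in> c_arr C. \<forall>g \<in> c_arr C. \<forall>h \<in> c_arr C.
        c_cod C f = c_dom C g \<and> c_cod C g = c_dom C h \<longrightarrow>
        c_comp C h (c_comp C g f) = c_comp C (c_comp C h g) f)"

definition iso :: "('o, 'm) cat \<Rightarrow> 'm \<Rightarrow> bool" where
  "iso C f \<longleftrightarrow> f \<in> c_arr C \<and>
     (\<exists>g \<in> hom C (c_cod C f) (c_dom C f).
        c_comp C g f = c_id C (c_dom C f) \<and> c_comp C f g = c_id C (c_cod C f))"

definition subcategory :: "('o, 'm) cat \<Rightarrow> 'm set \<Rightarrow> bool" where
  "subcategory C S \<longleftrightarrow> S \<subseteq> c_arr C \<and>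
     (\<forall>f \<in> S. c_id C (c_dom C f) \<in> S \<and> c_id C (c_cod C f) \<in> S) \<and>
     (\<forall>f \<in> S. \<forall>g \<in> S. c_cod C f = c_dom C g \<longrightarrow> c_comp C g f \<in> S)"

definition relative_category :: "('o, 'm) cat \<Rightarrow> 'm set \<Rightarrow> bool" where
  "relative_category C W \<longleftrightarrow> category C \<and> subcategory C W \<and>
     (\<forall>x \<in> c_obj C. c_id C x \<in> W)"

definition terminal :: "('o, 'm) cat \<Rightarrow> 'o \<Rightarrow> bool" where
  "terminal C t \<longleftrightarrow> t \<in> c_obj C \<and> (\<forall>x \<in> c_obj C. \<exists>!f. f \<in> hom C x t)"

definition fibrant :: "('o, 'm) cat \<Rightarrow> 'm set \<Rightarrow> 'o \<Rightarrow> 'o \<Rightarrow> bool" where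
  "fibrant C F t x \<longleftrightarrow> x \<in> c_obj C \<and> (\<forall>f \<in> hom C x t. f \<in> F)"

definition is_pullback ::
  "('o, 'm) cat \<Rightarrow> 'm \<Rightarrow> 'm \<Rightarrow> 'o \<Rightarrow> 'm \<Rightarrow> 'm \<Rightarrow> bool" where
  "is_pullback C f p P a b \<longleftrightarrow>
     P \<in> c_obj C \<and> a \<in> hom C P (c_dom C f) \<and> b \<in> hom C P (c_dom C p) \<and>
     c_comp C f a = c_comp C p b \<and>
     (\<forall>Q \<in> c_obj C. \<forall>a' \<in> hom C Q (c_dom C f). \<forall>b' \<in> hom C Q (c_dom C p).
        c_comp C f a' = c_comp C p b' \<longrightarrow>
        (\<exists>!u. u \<in> hom C Q P \<and> c_comp C a u = a' \<and> c_comp C b u = b'))"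

definition fibration_category :: "('o, 'm) cat \<Rightarrow> 'm set \<Rightarrow> 'm set \<Rightarrow> bool" where
  "fibration_category C W F \<longleftrightarrow>
     relative_category C W \<and> subcategory C F \<and>
     (\<exists>t. terminal C t \<and>
       \<comment> \<open>(F1)\<close>
       fibrant C F t t \<and>
       \<comment> \<open>(F2)\<close>
       (\<forall>f. iso C f \<longrightarrow> f \<in> W) \<and>
       (\<forall>f. iso C f \<and> fibrant C F t (c_cod C f) \<longrightarrow> f \<in> F) \<and>
       \<comment> \<open>(F3) 2-out-of-6\<close>
       (\<forall>f \<in> c_arr C. \<forall>g \<in> c_arr C. \<forall>h \<in> c_arr C.
          c_cod C f = c_dom C g \<and> c_cod C g = c_dom C h \<and>
          c_comp C g f \<in> W \<and> c_comp C h g \<in> W \<longrightarrow> f \<in> W \<and> g \<in> W \<and> h \<in> W) \<and>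
       \<comment> \<open>(F4) pullbacks of (trivial) fibrations along maps between fibrant objects\<close>
       (\<forall>f \<in> c_arr C. \<forall>p \<in> F.
          fibrant C F t (c_dom C f) \<and> fibrant C F t (c_cod C f) \<and> c_cod C p = c_cod C f \<longrightarrow>
          (\<exists>P a b. is_pullback C f p P a b) \<and>
          (\<forall>P a b. is_pullback C f p P a b \<longrightarrow> a \<in> F \<and> (p \<in> W \<longrightarrow> a \<in> W))) \<and>
       \<comment> \<open>(F5) factorization\<close>
       (\<forall>f \<in> c_arr C. fibrant C F t (c_cod C f) \<longrightarrow>
          (\<exists>s p. s \<in> W \<and> p \<in> F \<and> s \<in> c_arr C \<and> p \<in> c_arr C \<and>
                 c_cod C s = c_dom C p \<and> c_comp C p s = f)))"

text \<open>A relative poset is given by a carrier Ob, an order le, and a predicate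
  we on pairs x \<le> y telling which morphisms are weak equivalences.  A functor out of
  a poset is a pair (object map, morphism map on pairs x \<le> y); we take the
  extensional representative (undefined outside the poset).\<close>
definition rel_functors ::
  "'x set \<Rightarrow> ('x \<Rightarrow> 'x \<Rightarrow> bool) \<Rightarrow> ('x \<Rightarrow> 'x \<Rightarrow> bool) \<Rightarrow> ('o, 'm) cat \<Rightarrow> 'm set
   \<Rightarrow> (('x \<Rightarrow> 'o) \<times> ('x \<Rightarrow> 'x \<Rightarrow> 'm)) set" where
  "rel_functors Ob le we C W = {(F0, F1).
     (\<forall>x \<in> Ob. F0 x \<in> c_obj C) \<and>
     (\<forall>x \<in> Ob. \<forall>y \<in> Ob. le x y \<longrightarrow> F1 x y \<in> hom C (F0 x) (F0 y)) \<and>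
     (\<forall>x \<in> Ob. F1 x x = c_id C (F0 x)) \<and>
     (\<forall>x \<in> Ob. \<forall>y \<in> Ob. \<forall>z \<in> Ob. le x y \<and> le y z \<longrightarrow> c_comp C (F1 y z) (F1 x y) = F1 x z) \<and>
     (\<forall>x \<in> Ob. \<forall>y \<in> Ob. le x y \<and> we x y \<longrightarrow> F1 x y \<in> W) \<and>
     (\<forall>x. x \<notin> Ob \<longrightarrow> F0 x = undefined) \<and>
     (\<forall>x y. \<not> (x \<in> Ob \<and> y \<in> Ob \<and> le x y) \<longrightarrow> F1 x y = undefined)}"

definition xi_obj :: "'a set \<Rightarrow> ('a \<Rightarrow> 'a \<Rightarrow> bool) \<Rightarrow> 'a set list set" where
  "xi_obj P le = {As. As \<noteq> [] \<and>
     (\<forall>A \<in> set As. A \<noteq> {} \<and> finite A \<and> A \<subseteq> P \<and> (\<forall>x \<in> A. \<forall>y \<in> A. le x y \<or> le y x)) \<and>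
     sorted_wrt (\<subset>) As}"

definition xi_le :: "'a set list \<Rightarrow> 'a set list \<Rightarrow> bool" where
  "xi_le Bs As \<longleftrightarrow> set Bs \<subseteq> set As"

definition least :: "('a \<Rightarrow> 'a \<Rightarrow> bool) \<Rightarrow> 'a set \<Rightarrow> 'a" where
  "least le A = (THE x. x \<in> A \<and> (\<forall>y \<in> A. le x y))"

definition xi_we :: "('a \<Rightarrow> 'a \<Rightarrow> bool) \<Rightarrow> ('a \<Rightarrow> 'a \<Rightarrow> bool) \<Rightarrow> 'a set list \<Rightarrow> 'a set list \<Rightarrow> bool" where
  "xi_we le we Bs As \<longleftrightarrow> we (least le (hd Bs)) (least le (hd As))"

definition xi_map :: "('a \<Rightarrow> 'b) \<Rightarrow> 'a set list \<Rightarrow> 'b set list" where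
  "xi_map g As = remdups_adj (map (\<lambda>A. g ` A) As)"

definition grid :: "nat \<Rightarrow> nat \<Rightarrow> (nat \<times> nat) set" where
  "grid p q = {0..p} \<times> {0..q}"

definition grid_le :: "nat \<times> nat \<Rightarrow> nat \<times> nat \<Rightarrow> bool" where
  "grid_le x y \<longleftrightarrow> fst x \<le> fst y \<and> snd x \<le> snd y"

text \<open>Weak equivalences of [p]-check x [q]-hat: identity in the first factor,
  arbitrary in the second.\<close>
definition grid_we :: "nat \<times> nat \<Rightarrow> nat \<times> nat \<Rightarrow> bool" where
  "grid_we x y \<longleftrightarrow> fst x = fst y"

type_synonym ('o, 'm) nxi_elem =
  "((nat \<times> nat) set list \<Rightarrow> 'o) \<times> ((nat \<times> nat) set list \<Rightarrow> (nat \<times> nat) set list \<Rightarrow> 'm)"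

definition N_xi :: "('o, 'm) cat \<Rightarrow> 'm set \<Rightarrow> nat \<Rightarrow> nat \<Rightarrow> ('o, 'm) nxi_elem set" where
  "N_xi C W p q = rel_functors (xi_obj (grid p q) grid_le) xi_le (xi_we grid_le grid_we) C W"

text \<open>Simplicial operators: for theta : [p'] \<rightarrow> [p], psi : [q'] \<rightarrow> [q] (monotone),
  the map (N_xi M)_{pq} \<rightarrow> (N_xi M)_{p'q'} is precomposition with xi(theta x psi).\<close>
definition N_xi_act ::
  "(nat \<Rightarrow> nat) \<Rightarrow> (nat \<Rightarrow> nat) \<Rightarrow> nat \<Rightarrow> nat \<Rightarrow> ('o, 'm) nxi_elem \<Rightarrow> ('o, 'm) nxi_elem" where
  "N_xi_act \<theta> \<psi> p' q' X =
     (let Ob = xi_obj (grid p' q') grid_le; g = xi_map (\<lambda>(a, b). (\<theta> a, \<psi> b)) in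
      (\<lambda>Bs. if Bs \<in> Ob then fst X (g Bs) else undefined,
       \<lambda>Bs As. if Bs \<in> Ob \<and> As \<in> Ob \<and> xi_le Bs As then snd X (g Bs) (g As) else undefined))"

definition coface :: "nat \<Rightarrow> nat \<Rightarrow> nat" where
  "coface i j = (if j < i then j else Suc j)"

text \<open>Kan fibration f : E \<rightarrow> B of simplicial sets (carriers and face maps
  dE n i : E_n \<rightarrow> E_{n-1}), via horn filling: a map from the horn Lambda^k[n] is a
  compatible family of (n-1)-simplices (z_j)_{j \<noteq> k} with d_i z_j = d_{j-1} z_i for i<j.\<close>
definition kan_fibration ::
  "(nat \<Rightarrow> 'e set) \<Rightarrow> (nat \<Rightarrow> nat \<Rightarrow> 'e \<Rightarrow> 'e) \<Rightarrow> (nat \<Rightarrow> 'b set) \<Rightarrow> (nat \<Rightarrow> nat \<Rightarrow> 'b \<Rightarrow> 'b)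
   \<Rightarrow> (nat \<Rightarrow> 'e \<Rightarrow> 'b) \<Rightarrow> bool" where
  "kan_fibration E dE B dB f \<longleftrightarrow>
     (\<forall>n x. x \<in> E n \<longrightarrow> f n x \<in> B n) \<and>
     (\<forall>n k y z. 1 \<le> n \<and> k \<le> n \<and> y \<in> B n \<and>
        (\<forall>j \<le> n. j \<noteq> k \<longrightarrow> z j \<in> E (n - 1)) \<and>
        (\<forall>i j. i < j \<and> j \<le> n \<and> i \<noteq> k \<and> j \<noteq> k \<longrightarrow>
              dE (n - 1) i (z j) = dE (n - 1) (j - 1) (z i)) \<and>
        (\<forall>j \<le> n. j \<noteq> k \<longrightarrow> f (n - 1) (z j) = dB n j y)
      \<longrightarrow> (\<exists>x \<in> E n. f n x = y \<and> (\<forall>j \<le> n. j \<noteq> k \<longrightarrow> dE n j x = z j)))"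

text \<open>A bisimplicial set X with action act theta psi m' q' : X_{m q} \<rightarrow> X_{m' q'}.
  Horizontal faces (in the first, "m", direction) and vertical faces.\<close>
definition dh :: "((nat \<Rightarrow> nat) \<Rightarrow> (nat \<Rightarrow> nat) \<Rightarrow> nat \<Rightarrow> nat \<Rightarrow> 'a \<Rightarrow> 'a)
    \<Rightarrow> nat \<Rightarrow> nat \<Rightarrow> nat \<Rightarrow> 'a \<Rightarrow> 'a" where
  "dh act m q i x = act (coface i) (\<lambda>j. j) (m - 1) q x"

definition dv :: "((nat \<Rightarrow> nat) \<Rightarrow> (nat \<Rightarrow> nat) \<Rightarrow> nat \<Rightarrow> nat \<Rightarrow> 'a \<Rightarrow> 'a)
    \<Rightarrow> nat \<Rightarrow> nat \<Rightarrow> nat \<Rightarrow> 'a \<Rightarrow> 'a" where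
  "dv act m q i x = act (\<lambda>j. j) (coface i) m (q - 1) x"

definition bdry_idx :: "nat \<Rightarrow> nat set" where
  "bdry_idx m = (if m = 0 then {} else {0..m})"

text \<open>(M_m X)_q = maps \<partial>Delta[m] \<rightarrow> X_{\<bullet> q}: compatible families (y_i)_{i \<le> m} in X_{m-1,q}
  with d_i y_j = d_{j-1} y_i for i<j (a single point if m = 0).\<close>
definition matching_obj :: "(nat \<Rightarrow> nat \<Rightarrow> 'a set) \<Rightarrow> ((nat \<Rightarrow> nat) \<Rightarrow> (nat \<Rightarrow> nat) \<Rightarrow> nat \<Rightarrow> nat \<Rightarrow> 'a \<Rightarrow> 'a)
    \<Rightarrow> nat \<Rightarrow> nat \<Rightarrow> (nat \<Rightarrow> 'a) set" where
  "matching_obj X act m q = {y.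
     (\<forall>i. i \<notin> bdry_idx m \<longrightarrow> y i = undefined) \<and>
     (\<forall>i \<in> bdry_idx m. y i \<in> X (m - 1) q) \<and>
     (\<forall>i j. 2 \<le> m \<and> i < j \<and> j \<le> m \<longrightarrow> dh act (m - 1) q i (y j) = dh act (m - 1) q (j - 1) (y i))}"

definition matching_face :: "((nat \<Rightarrow> nat) \<Rightarrow> (nat \<Rightarrow> nat) \<Rightarrow> nat \<Rightarrow> nat \<Rightarrow> 'a \<Rightarrow> 'a)
    \<Rightarrow> nat \<Rightarrow> nat \<Rightarrow> nat \<Rightarrow> (nat \<Rightarrow> 'a) \<Rightarrow> (nat \<Rightarrow> 'a)" where
  "matching_face act m q i y = (\<lambda>l. if l \<in> bdry_idx m then dv act (m - 1) q i (y l) else undefined)"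

definition matching_map :: "((nat \<Rightarrow> nat) \<Rightarrow> (nat \<Rightarrow> nat) \<Rightarrow> nat \<Rightarrow> nat \<Rightarrow> 'a \<Rightarrow> 'a)
    \<Rightarrow> nat \<Rightarrow> nat \<Rightarrow> 'a \<Rightarrow> (nat \<Rightarrow> 'a)" where
  "matching_map act m q x = (\<lambda>l. if l \<in> bdry_idx m then dh act m q l x else undefined)"

definition reedy_fibrant :: "(nat \<Rightarrow> nat \<Rightarrow> 'a set) \<Rightarrow> ((nat \<Rightarrow> nat) \<Rightarrow> (nat \<Rightarrow> nat) \<Rightarrow> nat \<Rightarrow> nat \<Rightarrow> 'a \<Rightarrow> 'a) \<Rightarrow> bool" where
  "reedy_fibrant X act \<longleftrightarrow>
     (\<forall>m. kan_fibration (\<lambda>q. X m q) (\<lambda>q i. dv act m q i)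
            (\<lambda>q. matching_obj X act m q) (\<lambda>q i. matching_face act m q i)
            (\<lambda>q x. matching_map act m q x))"

end

theory Submission
  imports Defs
begin

text \<open>
  A lifting problem for the matching map is a relative functor on \<open>\<xi>\<close> of the subcomplex
  \<open>\<partial>\<Delta>[m] \<times> \<Delta>[n] \<union> \<Delta>[m] \<times> \<Lambda>\<^sup>k[n]\<close> of the grid, to be extended to the whole grid. The missing simplices
  are matched in pairs \<open>(\<sigma>, \<sigma> - v)\<close> and attached one pair at a time, each along the horn of \<open>\<sigma>\<close> opposite
  to \<open>v\<close>; here \<open>\<sigma>\<close> contains a second vertex \<open>w\<close> in the same row as \<open>v\<close>, so that \<open>v\<close> and \<open>w\<close> are weakly
  equivalent.

  To attach a pair, replace the functor on \<open>\<xi>\<close> of the horn by a Reedy fibrant one \<open>D'\<close>. Chains that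
  meet the old complex take the value of \<open>D'\<close> (or of the given functor, if they lie in the old complex)
  at their old part, and chains of new simplices only take the value \<open>lim D'\<close>. This is a relative
  functor as soon as \<open>lim D' \<rightarrow> D' A\<close> is a weak equivalence whenever the smallest simplex of \<open>A\<close> has its
  minimum in the same row as the minimum of \<open>\<sigma>\<close>. That follows by building up the horn simplex by simplex: the
  limit changes by the pullback of a fibration, which is trivial if the simplices comparable to the new
  one form a cone whose apex does not raise the row of the minimum. The order is: faces containing \<open>v\<close> but not \<open>w\<close> (apex
  \<open>\<sigma> - w\<close>), then faces \<open>x\<close> containing both, by decreasing size (apex \<open>x - w\<close>), then faces \<open>x\<close> avoiding \<open>v\<close>,
  by increasing size (apex \<open>x \<union> v\<close>).
\<close>

section \<open>Limits in fibration categories\<close>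

text \<open>An arrow of the subdivision goes from a chain to a longer one. Hence no arrow leads from
  a chain with a new simplex into the old complex, and the given functor can be kept there on the
  nose, as a strict lift demands; its replacement enters only through the weak equivalences
  \<open>D A\<close> to \<open>D' A\<close>. The replacement is needed because limits are available
  only along fibrations between fibrant objects, while the values of a relative functor need not be
  fibrant. A chain of new simplices only receives nothing from outside but maps to every chain
  enlarging it by simplices of the horn, so its value must carry a cone over \<open>D'\<close>, and
  the limit is the universal choice.

  Labels rise along arrows, so the projections of the limit can be weak equivalences only where the
  label of \<sigma> survives. The vertex w is what keeps the label: deleting w leaves v in the same
  row, so coning off with apex x - w does not raise the minimum. Adding v instead can only lower it.
  The pairing of missing simplices is an acyclic matching as in discrete Morse theory; a numerical
  rank guarantees that the horn is complete when a pair is attached.\<close>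

lemma finite_minimal_induct [consumes 1, case_names empty insert]:
  fixes Q :: "'x::order set"
  assumes "finite Q" and "P {}"
    and step: "\<And>x Q. finite Q \<Longrightarrow> x \<notin> Q \<Longrightarrow> (\<And>y. y \<in> Q \<Longrightarrow> \<not> y \<le> x) \<Longrightarrow> P Q \<Longrightarrow> P (insert x Q)"
  shows "P Q"
  using \<open>finite Q\<close>
proof (induction Q rule: finite_psubset_induct)
  case (psubset Q)
  show ?case
  proof (cases "Q = {}")
    case False
    \<comment> \<open>Taking off a minimal element means that sets are built from the top down: a
      new element finds everything above it already present, as constructions by limits over the
      strictly larger elements require.\<close>
    then obtain x where x: "x \<in> Q" "\<And>y. y \<in> Q \<Longrightarrow> y \<le> x \<Longrightarrow> x = y"
      using finite_has_minimal[OF psubset.hyps] by metis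
    have "P (Q - {x})" using x by (intro psubset.IH) auto
    then have "P (insert x (Q - {x}))"
      using x psubset.hyps by (intro step) auto
    then show ?thesis using x by (simp add: insert_absorb)
  qed (simp add: \<open>P {}\<close>)
qed

locale fibration_cat =
  fixes C :: "('o, 'm) cat" and W F :: "'m set" and t :: 'o
  assumes cat: "category C"
    and W_subcat: "subcategory C W" and W_id: "\<And>x. x \<in> c_obj C \<Longrightarrow> c_id C x \<in> W"
    and F_subcat: "subcategory C F"
    and term_t: "terminal C t" and fibrant_t: "fibrant C F t t"
    and iso_W: "\<And>f. iso C f \<Longrightarrow> f \<in> W"
    and iso_F: "\<And>f. iso C f \<Longrightarrow> fibrant C F t (c_cod C f) \<Longrightarrow> f \<in> F"
    and two_of_six: "\<And>f g h. f \<in> c_arr C \<Longrightarrow> g \<in> c_arr C \<Longrightarrow> h \<in> c_arr C \<Longrightarrow>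
          c_cod C f = c_dom C g \<Longrightarrow> c_cod C g = c_dom C h \<Longrightarrow>
          c_comp C g f \<in> W \<Longrightarrow> c_comp C h g \<in> W \<Longrightarrow> f \<in> W \<and> g \<in> W \<and> h \<in> W"
    and pullback_ex: "\<And>f p. f \<in> c_arr C \<Longrightarrow> p \<in> F \<Longrightarrow> fibrant C F t (c_dom C f) \<Longrightarrow>
          fibrant C F t (c_cod C f) \<Longrightarrow> c_cod C p = c_cod C f \<Longrightarrow> \<exists>P a b. is_pullback C f p P a b"
    and pullback_fib: "\<And>f p P a b. f \<in> c_arr C \<Longrightarrow> p \<in> F \<Longrightarrow> fibrant C F t (c_dom C f) \<Longrightarrow>
          fibrant C F t (c_cod C f) \<Longrightarrow> c_cod C p = c_cod C f \<Longrightarrow> is_pullback C f p P a b \<Longrightarrow>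
          a \<in> F \<and> (p \<in> W \<longrightarrow> a \<in> W)"
    and factorization: "\<And>f. f \<in> c_arr C \<Longrightarrow> fibrant C F t (c_cod C f) \<Longrightarrow>
          \<exists>s p. s \<in> W \<and> p \<in> F \<and> s \<in> c_arr C \<and> p \<in> c_arr C \<and> c_cod C s = c_dom C p \<and> c_comp C p s = f"
begin

abbreviation comp (infixl \<open>\<cdot>\<close> 70) where "g \<cdot> f \<equiv> c_comp C g f"
abbreviation fibr :: "'o \<Rightarrow> bool" where "fibr x \<equiv> fibrant C F t x"

section \<open>Arrows, two-out-of-three and fibrant objects\<close>

lemma hom_dest: "f \<in> hom C x y \<Longrightarrow> f \<in> c_arr C \<and> c_dom C f = x \<and> c_cod C f = y \<and> x \<in> c_obj C \<and> y \<in> c_obj C"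
  using cat by (auto simp: hom_def category_def)

lemma homI: "f \<in> c_arr C \<Longrightarrow> f \<in> hom C (c_dom C f) (c_cod C f)"
  by (simp add: hom_def)

lemma comp_hom: "f \<in> hom C x y \<Longrightarrow> g \<in> hom C y z \<Longrightarrow> g \<cdot> f \<in> hom C x z"
  using cat unfolding category_def hom_def by fastforce

lemma id_hom: "x \<in> c_obj C \<Longrightarrow> c_id C x \<in> hom C x x"
  using cat by (auto simp: category_def)

lemma dom_id [simp]: "x \<in> c_obj C \<Longrightarrow> c_dom C (c_id C x) = x"
  using id_hom hom_dest by blast

lemma id_left [simp]: "f \<in> hom C x y \<Longrightarrow> c_id C y \<cdot> f = f"
  using cat by (auto simp: category_def hom_def)

lemma id_right [simp]: "f \<in> hom C x y \<Longrightarrow> f \<cdot> c_id C x = f"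
  using cat by (auto simp: category_def hom_def)

lemma comp_assoc: "f \<in> hom C x y \<Longrightarrow> g \<in> hom C y z \<Longrightarrow> h \<in> hom C z u \<Longrightarrow> (h \<cdot> g) \<cdot> f = h \<cdot> (g \<cdot> f)"
  using cat unfolding category_def hom_def by fastforce

lemma comp_W: "f \<in> W \<Longrightarrow> g \<in> W \<Longrightarrow> f \<in> hom C x y \<Longrightarrow> g \<in> hom C y z \<Longrightarrow> g \<cdot> f \<in> W"
  using W_subcat by (auto simp: subcategory_def hom_def)

lemma comp_F: "f \<in> F \<Longrightarrow> g \<in> F \<Longrightarrow> f \<in> hom C x y \<Longrightarrow> g \<in> hom C y z \<Longrightarrow> g \<cdot> f \<in> F"
  using F_subcat by (auto simp: subcategory_def hom_def)

text \<open>Two-out-of-six for the triple f, g, identity, whose composites are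
  \<open>g \<cdot> f\<close> and g. The right-hand version uses the triple identity, f, g.\<close>

lemma W_cancel_left: "g \<cdot> f \<in> W \<Longrightarrow> g \<in> W \<Longrightarrow> f \<in> hom C x y \<Longrightarrow> g \<in> hom C y z \<Longrightarrow> f \<in> W"
  using two_of_six[of f g "c_id C z"] id_hom[of z] hom_dest[of f x y] hom_dest[of g y z]
    hom_dest[of "c_id C z" z z] id_left[of g y z]
  by auto

lemma W_cancel_right: "g \<cdot> f \<in> W \<Longrightarrow> f \<in> W \<Longrightarrow> f \<in> hom C x y \<Longrightarrow> g \<in> hom C y z \<Longrightarrow> g \<in> W"
  using two_of_six[of "c_id C x" f g] id_hom[of x] hom_dest[of f x y] hom_dest[of g y z]
    hom_dest[of "c_id C x" x x] id_right[of f x y]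
  by auto

lemma isoI: "f \<in> hom C x y \<Longrightarrow> g \<in> hom C y x \<Longrightarrow> g \<cdot> f = c_id C x \<Longrightarrow> f \<cdot> g = c_id C y \<Longrightarrow> iso C f"
  unfolding iso_def using hom_dest by metis

lemma isoE:
  assumes "iso C f" "f \<in> hom C x y"
  obtains g where "g \<in> hom C y x" "g \<cdot> f = c_id C x" "f \<cdot> g = c_id C y" "iso C g"
proof -
  obtain g where "g \<in> hom C y x" "g \<cdot> f = c_id C x" "f \<cdot> g = c_id C y"
    using assms(1) hom_dest[OF assms(2)] by (auto simp: iso_def)
  then show ?thesis using that isoI assms(2) by blast
qed

lemma fibr_obj: "fibr x \<Longrightarrow> x \<in> c_obj C"
  by (simp add: fibrant_def)

lemma iso_F_hom: "iso C f \<Longrightarrow> f \<in> hom C x y \<Longrightarrow> fibr y \<Longrightarrow> f \<in> F"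
  using iso_F[of f] hom_dest[of f x y] by simp

lemma fibr_id_F: "fibr x \<Longrightarrow> c_id C x \<in> F"
  using iso_F_hom[OF isoI[OF id_hom id_hom] id_hom] id_left[OF id_hom] fibr_obj by simp

lemma fibr_dom:
  assumes "f \<in> F" "f \<in> hom C x y" "fibr y"
  shows "fibr x"
  unfolding fibrant_def
proof (intro conjI ballI)
  show x: "x \<in> c_obj C" using assms hom_dest by blast
  fix g assume g: "g \<in> hom C x t"
  obtain h where h: "h \<in> hom C y t"
    using term_t fibr_obj[OF assms(3)] by (auto simp: terminal_def)
  have "h \<in> F" using assms(3) h by (simp add: fibrant_def)
  moreover have "h \<cdot> f = g"
    using term_t x g comp_hom[OF assms(2) h] unfolding terminal_def by blast
  ultimately show "g \<in> F" using comp_F[OF assms(1) _ assms(2) h] by simp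
qed

text \<open>A diagram on a poset is given by its arrows alone; \<open>ob D x\<close> recovers its value at \<open>x\<close> from the
  identity \<open>D x x\<close>.\<close>

definition ob :: "('x \<Rightarrow> 'x \<Rightarrow> 'm) \<Rightarrow> 'x \<Rightarrow> 'o" where
  "ob D x = c_dom C (D x x)"

definition diagram :: "('x::order \<Rightarrow> 'x \<Rightarrow> 'm) \<Rightarrow> 'x set \<Rightarrow> bool" where
  "diagram D Q \<longleftrightarrow>
     (\<forall>x\<in>Q. D x x = c_id C (ob D x)) \<and>
     (\<forall>x\<in>Q. \<forall>y\<in>Q. x \<le> y \<longrightarrow> D x y \<in> hom C (ob D x) (ob D y)) \<and>
     (\<forall>x\<in>Q. \<forall>y\<in>Q. \<forall>z\<in>Q. x \<le> y \<and> y \<le> z \<longrightarrow> D y z \<cdot> D x y = D x z)"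

definition cone :: "('x::order \<Rightarrow> 'x \<Rightarrow> 'm) \<Rightarrow> 'x set \<Rightarrow> 'o \<Rightarrow> ('x \<Rightarrow> 'm) \<Rightarrow> bool" where
  "cone D Q L \<pi> \<longleftrightarrow> L \<in> c_obj C \<and> (\<forall>x\<in>Q. \<pi> x \<in> hom C L (ob D x)) \<and>
     (\<forall>x\<in>Q. \<forall>y\<in>Q. x \<le> y \<longrightarrow> D x y \<cdot> \<pi> x = \<pi> y)"

definition is_limit :: "('x::order \<Rightarrow> 'x \<Rightarrow> 'm) \<Rightarrow> 'x set \<Rightarrow> 'o \<Rightarrow> ('x \<Rightarrow> 'm) \<Rightarrow> bool" where
  "is_limit D Q L \<pi> \<longleftrightarrow> cone D Q L \<pi> \<and>
     (\<forall>M \<rho>. cone D Q M \<rho> \<longrightarrow> (\<exists>!u. u \<in> hom C M L \<and> (\<forall>x\<in>Q. \<pi> x \<cdot> u = \<rho> x)))"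

definition has_lim :: "('x::order \<Rightarrow> 'x \<Rightarrow> 'm) \<Rightarrow> 'x set \<Rightarrow> bool" where
  "has_lim D Q \<longleftrightarrow> (\<exists>L \<pi>. is_limit D Q L \<pi>)"

definition lobj :: "('x::order \<Rightarrow> 'x \<Rightarrow> 'm) \<Rightarrow> 'x set \<Rightarrow> 'o" where
  "lobj D Q = fst (SOME p. is_limit D Q (fst p) (snd p))"

definition lproj :: "('x::order \<Rightarrow> 'x \<Rightarrow> 'm) \<Rightarrow> 'x set \<Rightarrow> 'x \<Rightarrow> 'm" where
  "lproj D Q = snd (SOME p. is_limit D Q (fst p) (snd p))"

definition lmap :: "('x::order \<Rightarrow> 'x \<Rightarrow> 'm) \<Rightarrow> 'x set \<Rightarrow> 'x set \<Rightarrow> 'm" where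
  "lmap D Q R = (THE u. u \<in> hom C (lobj D Q) (lobj D R) \<and> (\<forall>x\<in>R. lproj D R x \<cdot> u = lproj D Q x))"

definition flim :: "('x::order \<Rightarrow> 'x \<Rightarrow> 'm) \<Rightarrow> 'x set \<Rightarrow> bool" where
  "flim D Q \<longleftrightarrow> has_lim D Q \<and> fibr (lobj D Q)"

text \<open>Bundles what (F4) asks of one leg of a pullback square of limits: besides the fibration
  itself, the existence and fibrancy of both limits.\<close>

definition fib_res :: "('x::order \<Rightarrow> 'x \<Rightarrow> 'm) \<Rightarrow> 'x set \<Rightarrow> 'x set \<Rightarrow> bool" where
  "fib_res D Q R \<longleftrightarrow> R \<subseteq> Q \<and> flim D Q \<and> flim D R \<and> lmap D Q R \<in> F"

text \<open>The limit over the elements above x, x included, is isomorphic to \<open>ob D x\<close>,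
  since x is least there. So this is the usual Reedy condition, with the strictly larger elements as
  matching category; writing both ends as limits lets every map in question be an
  \<open>lmap\<close>.\<close>

definition reedy :: "('x::order \<Rightarrow> 'x \<Rightarrow> 'm) \<Rightarrow> 'x set \<Rightarrow> bool" where
  "reedy D Q \<longleftrightarrow> (\<forall>x\<in>Q. fib_res D {y\<in>Q. x \<le> y} {y\<in>Q. x < y})"

section \<open>Universal properties and comparison maps\<close>

lemma diagram_hom: "diagram D Q \<Longrightarrow> x \<in> Q \<Longrightarrow> y \<in> Q \<Longrightarrow> x \<le> y \<Longrightarrow> D x y \<in> hom C (ob D x) (ob D y)"
  by (simp add: diagram_def)

lemma diagram_comp:
  "diagram D Q \<Longrightarrow> x \<in> Q \<Longrightarrow> y \<in> Q \<Longrightarrow> z \<in> Q \<Longrightarrow> x \<le> y \<Longrightarrow> y \<le> z \<Longrightarrow> D y z \<cdot> D x y = D x z"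
  by (simp add: diagram_def)

lemma diagram_id: "diagram D Q \<Longrightarrow> x \<in> Q \<Longrightarrow> D x x = c_id C (ob D x)"
  by (simp add: diagram_def)

lemma diagram_ob: "diagram D Q \<Longrightarrow> x \<in> Q \<Longrightarrow> ob D x \<in> c_obj C"
  using diagram_hom[of D Q x x] hom_dest[of "D x x"] by simp

lemma diagram_subset: "diagram D Q \<Longrightarrow> R \<subseteq> Q \<Longrightarrow> diagram D R"
  by (auto simp: diagram_def subset_iff)

lemma cone_subset: "cone D Q L \<pi> \<Longrightarrow> R \<subseteq> Q \<Longrightarrow> cone D R L \<pi>"
  by (auto simp: cone_def subset_iff)

lemma cone_hom: "cone D Q L \<pi> \<Longrightarrow> x \<in> Q \<Longrightarrow> \<pi> x \<in> hom C L (ob D x)"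
  by (simp add: cone_def)

lemma cone_comp: "cone D Q L \<pi> \<Longrightarrow> x \<in> Q \<Longrightarrow> y \<in> Q \<Longrightarrow> x \<le> y \<Longrightarrow> D x y \<cdot> \<pi> x = \<pi> y"
  by (simp add: cone_def)

lemma cone_precomp:
  assumes D: "diagram D Q" and c: "cone D Q L \<pi>" and u: "u \<in> hom C M L"
  shows "cone D Q M (\<lambda>x. \<pi> x \<cdot> u)"
  unfolding cone_def
proof (intro conjI ballI impI)
  show "M \<in> c_obj C" using u hom_dest by blast
  fix x assume x: "x \<in> Q"
  show "\<pi> x \<cdot> u \<in> hom C M (ob D x)" by (rule comp_hom[OF u cone_hom[OF c x]])
  fix y assume y: "y \<in> Q" "x \<le> y"
  show "D x y \<cdot> (\<pi> x \<cdot> u) = \<pi> y \<cdot> u"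
    using comp_assoc[OF u cone_hom[OF c x] diagram_hom[OF D x y]] cone_comp[OF c x y] by simp
qed

lemma limit_is: "has_lim D Q \<Longrightarrow> is_limit D Q (lobj D Q) (lproj D Q)"
  unfolding has_lim_def lobj_def lproj_def
  by (rule someI_ex[of "\<lambda>p. is_limit D Q (fst p) (snd p)"]) simp

lemma lim_cone: "has_lim D Q \<Longrightarrow> cone D Q (lobj D Q) (lproj D Q)"
  using limit_is[of D Q] by (auto simp: is_limit_def)

lemma lim_obj: "has_lim D Q \<Longrightarrow> lobj D Q \<in> c_obj C"
  using lim_cone[of D Q] by (auto simp: cone_def)

lemma lproj_hom: "has_lim D Q \<Longrightarrow> x \<in> Q \<Longrightarrow> lproj D Q x \<in> hom C (lobj D Q) (ob D x)"
  by (rule cone_hom[OF lim_cone])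

lemma lproj_comp: "has_lim D Q \<Longrightarrow> x \<in> Q \<Longrightarrow> y \<in> Q \<Longrightarrow> x \<le> y \<Longrightarrow> D x y \<cdot> lproj D Q x = lproj D Q y"
  by (rule cone_comp[OF lim_cone])

lemma is_limit_ex1:
  assumes "is_limit D Q L \<pi>" "cone D Q M \<rho>"
  shows "\<exists>!u. u \<in> hom C M L \<and> (\<forall>x\<in>Q. \<pi> x \<cdot> u = \<rho> x)"
  using assms by (simp add: is_limit_def)

lemma is_limit_univ:
  assumes "is_limit D Q L \<pi>" "cone D Q M \<rho>"
  obtains u where "u \<in> hom C M L" "\<And>x. x \<in> Q \<Longrightarrow> \<pi> x \<cdot> u = \<rho> x"
  using ex1_implies_ex[OF is_limit_ex1[OF assms]] that by blast

lemmas lim_univ = is_limit_univ[OF limit_is]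

lemma lim_eqI:
  assumes D: "diagram D Q" and Q: "has_lim D Q" and u: "u \<in> hom C M (lobj D Q)" "u' \<in> hom C M (lobj D Q)"
    and eq: "\<And>x. x \<in> Q \<Longrightarrow> lproj D Q x \<cdot> u = lproj D Q x \<cdot> u'"
  shows "u = u'"
proof -
  note ex1 = is_limit_ex1[OF limit_is[OF Q] cone_precomp[OF D lim_cone[OF Q] u(1)]]
  show ?thesis
    by (rule trans[OF sym[OF the1_equality[OF ex1]] the1_equality[OF ex1]]) (simp_all add: u eq)
qed

lemma lmap_ex1:
  assumes D: "diagram D Q" and Q: "has_lim D Q" and R: "has_lim D R" and RQ: "R \<subseteq> Q"
  shows "\<exists>!u. u \<in> hom C (lobj D Q) (lobj D R) \<and> (\<forall>x\<in>R. lproj D R x \<cdot> u = lproj D Q x)"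
  by (rule is_limit_ex1[OF limit_is[OF R] cone_subset[OF lim_cone[OF Q] RQ]])

lemma
  assumes D: "diagram D Q" and Q: "has_lim D Q" and R: "has_lim D R" and RQ: "R \<subseteq> Q"
  shows lmap_hom: "lmap D Q R \<in> hom C (lobj D Q) (lobj D R)"
    and lproj_lmap: "x \<in> R \<Longrightarrow> lproj D R x \<cdot> lmap D Q R = lproj D Q x"
  using theI'[OF lmap_ex1[OF assms]] by (auto simp: lmap_def)

lemma lmap_eqI:
  assumes D: "diagram D Q" and Q: "has_lim D Q" and R: "has_lim D R" and RQ: "R \<subseteq> Q"
    and u: "u \<in> hom C (lobj D Q) (lobj D R)" and eq: "\<And>x. x \<in> R \<Longrightarrow> lproj D R x \<cdot> u = lproj D Q x"
  shows "lmap D Q R = u"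
  using lim_eqI[OF diagram_subset[OF D RQ] R lmap_hom[OF assms(1-4)] u] lproj_lmap[OF assms(1-4)] eq by simp

lemma lmap_self:
  assumes "diagram D Q" "has_lim D Q"
  shows "lmap D Q Q = c_id C (lobj D Q)"
  using lmap_eqI[OF assms assms(2) order_refl id_hom[OF lim_obj[OF assms(2)]]]
    id_right[OF lproj_hom[OF assms(2)]] by simp

lemma lmap_comp:
  assumes D: "diagram D Q" and Q: "has_lim D Q" and R: "has_lim D R" and S: "has_lim D S"
    and RQ: "R \<subseteq> Q" and SR: "S \<subseteq> R"
  shows "lmap D R S \<cdot> lmap D Q R = lmap D Q S"
proof -
  note h = lmap_hom[OF D Q R RQ] lmap_hom[OF diagram_subset[OF D RQ] R S SR]
  have "lproj D S x \<cdot> (lmap D R S \<cdot> lmap D Q R) = lproj D Q x" if "x \<in> S" for x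
    using comp_assoc[OF h lproj_hom[OF S that]] lproj_lmap[OF diagram_subset[OF D RQ] R S SR that]
      lproj_lmap[OF D Q R RQ subsetD[OF SR that]] by simp
  then show ?thesis using lmap_eqI[OF D Q S order_trans[OF SR RQ] comp_hom[OF h]] by simp
qed

lemma fib_res_refl: "diagram D Q \<Longrightarrow> flim D Q \<Longrightarrow> fib_res D Q Q"
  by (simp add: fib_res_def flim_def lmap_self fibr_id_F)

lemma fib_res_trans:
  assumes D: "diagram D Q" and QR: "fib_res D Q R" and RS: "fib_res D R S"
  shows "fib_res D Q S"
proof -
  have *: "has_lim D Q" "has_lim D R" "has_lim D S" "R \<subseteq> Q" "S \<subseteq> R"
    using QR RS by (auto simp: fib_res_def flim_def)
  have "lmap D R S \<cdot> lmap D Q R \<in> F"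
    using comp_F[OF _ _ lmap_hom[OF D *(1,2,4)] lmap_hom[OF diagram_subset[OF D *(4)] *(2,3,5)]] QR RS
    by (simp add: fib_res_def)
  then show ?thesis using lmap_comp[OF D *] QR RS * by (auto simp: fib_res_def)
qed

section \<open>Limits over special index posets\<close>

lemma flim_empty: "flim D {}"
proof -
  have "is_limit D {} t \<pi>" for \<pi>
    using term_t by (auto simp: is_limit_def cone_def terminal_def)
  then have h: "has_lim D {}" by (auto simp: has_lim_def)
  have D: "diagram D {}" by (simp add: diagram_def)
  obtain u where u: "u \<in> hom C (lobj D {}) t"
    using term_t lim_obj[OF h] by (auto simp: terminal_def)
  have "cone D {} t (\<lambda>_. u)" using term_t by (auto simp: cone_def terminal_def)
  then obtain v where v: "v \<in> hom C t (lobj D {})" using lim_univ[OF h] by metis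
  have "v \<cdot> u = c_id C (lobj D {})"
    using lim_eqI[OF D h comp_hom[OF u v] id_hom[OF lim_obj[OF h]]] by simp
  moreover have "u \<cdot> v = c_id C t"
    using term_t comp_hom[OF v u] id_hom unfolding terminal_def by blast
  \<comment> \<open>The chosen limit of the empty diagram is only isomorphic to \<open>t\<close>; by
    (F2) this isomorphism is a fibration because \<open>t\<close> is fibrant, and fibrancy then
    passes to its domain.\<close>
  ultimately have "u \<in> F"
    using iso_F_hom[OF isoI[OF u v] u fibrant_t] by simp
  then show ?thesis using h fibr_dom[OF _ u fibrant_t] by (simp add: flim_def)
qed

lemma lim_min:
  assumes D: "diagram D Q" and x: "x \<in> Q" and min: "\<And>y. y \<in> Q \<Longrightarrow> x \<le> y"
  shows "has_lim D Q" and "iso C (lproj D Q x)"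
proof -
  have c: "cone D Q (ob D x) (D x)"
    unfolding cone_def using D x min diagram_ob[OF D x] by (auto simp: diagram_def)
  have "is_limit D Q (ob D x) (D x)"
    unfolding is_limit_def
  proof (intro conjI allI impI)
    fix M \<rho> assume r: "cone D Q M \<rho>"
    show "\<exists>!u. u \<in> hom C M (ob D x) \<and> (\<forall>y\<in>Q. D x y \<cdot> u = \<rho> y)"
    proof (rule ex1I[of _ "\<rho> x"])
      show "\<rho> x \<in> hom C M (ob D x) \<and> (\<forall>y\<in>Q. D x y \<cdot> \<rho> x = \<rho> y)"
        using r x min by (auto simp: cone_def)
      fix u assume u: "u \<in> hom C M (ob D x) \<and> (\<forall>y\<in>Q. D x y \<cdot> u = \<rho> y)"
      then show "u = \<rho> x" using id_left[of u M "ob D x"] diagram_id[OF D x] x by metis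
    qed
  qed (rule c)
  then show h: "has_lim D Q" by (auto simp: has_lim_def)
  obtain u where u: "u \<in> hom C (ob D x) (lobj D Q)" "\<And>y. y \<in> Q \<Longrightarrow> lproj D Q y \<cdot> u = D x y"
    using lim_univ[OF h c] by metis
  note p = lproj_hom[OF h x]
  have "u \<cdot> lproj D Q x = c_id C (lobj D Q)"
  proof (rule lim_eqI[OF D h comp_hom[OF p u(1)] id_hom[OF lim_obj[OF h]]])
    fix y assume y: "y \<in> Q"
    show "lproj D Q y \<cdot> (u \<cdot> lproj D Q x) = lproj D Q y \<cdot> c_id C (lobj D Q)"
      using comp_assoc[OF p u(1) lproj_hom[OF h y]] u(2)[OF y] lproj_comp[OF h x y min[OF y]]
        id_right[OF lproj_hom[OF h y]] by simp
  qed
  then show "iso C (lproj D Q x)"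
    using isoI[OF p u(1)] u(2)[OF x] diagram_id[OF D x] by simp
qed

text \<open>The hypothesis provides a right adjoint p to the inclusion of R into Q, so this
  inclusion is initial. Explicitly, a cone on R extends uniquely to q by composing its leg at
  \<open>p q\<close> with the arrow from \<open>p q\<close> to q.\<close>

lemma lim_coreflective:
  assumes D: "diagram D Q" and RQ: "R \<subseteq> Q" and R: "has_lim D R"
    and corefl: "\<And>q. q \<in> Q \<Longrightarrow> \<exists>p\<in>R. p \<le> q \<and> (\<forall>r\<in>R. r \<le> q \<longrightarrow> r \<le> p)"
  shows "has_lim D Q" and "iso C (lmap D Q R)"
proof -
  obtain p where p: "\<And>q. q \<in> Q \<Longrightarrow> p q \<in> R \<and> p q \<le> q \<and> (\<forall>r\<in>R. r \<le> q \<longrightarrow> r \<le> p q)"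
    using corefl by metis
  have pQ: "p q \<in> Q" if "q \<in> Q" for q using p that RQ by blast
  have pR: "p r = r" if "r \<in> R" for r using p[of r] that RQ by (meson antisym order_refl subsetD)
  have mono: "p x \<le> p y" if "x \<in> Q" "y \<in> Q" "x \<le> y" for x y
    using p[OF that(1)] p[OF that(2)] that(3) by (meson order_trans)
  define \<pi> where "\<pi> q = D (p q) q \<cdot> lproj D R (p q)" for q
  have c: "cone D Q (lobj D R) \<pi>"
    unfolding cone_def
  proof (intro conjI ballI impI)
    show "lobj D R \<in> c_obj C" by (rule lim_obj[OF R])
    fix x assume x: "x \<in> Q"
    note hx = lproj_hom[OF R, of "p x"] diagram_hom[OF D pQ[OF x] x]
    show "\<pi> x \<in> hom C (lobj D R) (ob D x)" using comp_hom[OF hx] p[OF x] by (simp add: \<pi>_def)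
    fix y assume y: "y \<in> Q" "x \<le> y"
    note m = mono[OF x y]
    have "D x y \<cdot> \<pi> x = D (p x) y \<cdot> lproj D R (p x)"
      using comp_assoc[OF hx diagram_hom[OF D x y]] p[OF x] diagram_comp[OF D pQ[OF x] x y(1) _ y(2)]
      by (simp add: \<pi>_def)
    also have "\<dots> = D (p y) y \<cdot> D (p x) (p y) \<cdot> lproj D R (p x)"
      using diagram_comp[OF D pQ[OF x] pQ[OF y(1)] y(1) m] p[OF y(1)] by simp
    also have "\<dots> = \<pi> y"
      using comp_assoc[OF lproj_hom[OF R] diagram_hom[OF D pQ[OF x] pQ[OF y(1)] m] diagram_hom[OF D pQ[OF y(1)] y(1)]]
        p[OF x] p[OF y(1)] lproj_comp[OF R _ _ m] by (simp add: \<pi>_def)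
    finally show "D x y \<cdot> \<pi> x = \<pi> y" .
  qed
  have \<pi>R: "\<pi> r = lproj D R r" if "r \<in> R" for r
    using pR[OF that] diagram_id[OF D, of r] id_left[OF lproj_hom[OF R that]] that RQ by (auto simp: \<pi>_def)
  have "is_limit D Q (lobj D R) \<pi>"
    unfolding is_limit_def
  proof (intro conjI allI impI)
    fix M \<rho> assume r: "cone D Q M \<rho>"
    obtain u where u: "u \<in> hom C M (lobj D R)" "\<And>x. x \<in> R \<Longrightarrow> lproj D R x \<cdot> u = \<rho> x"
      using lim_univ[OF R cone_subset[OF r RQ]] by metis
    show "\<exists>!u. u \<in> hom C M (lobj D R) \<and> (\<forall>x\<in>Q. \<pi> x \<cdot> u = \<rho> x)"
    proof (rule ex1I[of _ u], intro conjI ballI)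
      show "u \<in> hom C M (lobj D R)" by (rule u)
      fix x assume x: "x \<in> Q"
      show "\<pi> x \<cdot> u = \<rho> x"
        using comp_assoc[OF u(1) lproj_hom[OF R] diagram_hom[OF D pQ[OF x] x]] p[OF x] u(2)
          cone_comp[OF r pQ[OF x] x] by (simp add: \<pi>_def)
    next
      fix u' assume u': "u' \<in> hom C M (lobj D R) \<and> (\<forall>x\<in>Q. \<pi> x \<cdot> u' = \<rho> x)"
      show "u' = u"
      proof (rule lim_eqI[OF diagram_subset[OF D RQ] R])
        fix x assume "x \<in> R"
        then show "lproj D R x \<cdot> u' = lproj D R x \<cdot> u" using u' u(2) \<pi>R RQ by (metis subsetD)
      qed (use u u' in auto)
    qed
  qed (rule c)
  then show Q: "has_lim D Q" by (auto simp: has_lim_def)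
  obtain u where u: "u \<in> hom C (lobj D R) (lobj D Q)" "\<And>x. x \<in> Q \<Longrightarrow> lproj D Q x \<cdot> u = \<pi> x"
    using lim_univ[OF Q c] by metis
  note l = lmap_hom[OF D Q R RQ]
  have "lmap D Q R \<cdot> u = c_id C (lobj D R)"
  proof (rule lim_eqI[OF diagram_subset[OF D RQ] R comp_hom[OF u(1) l] id_hom[OF lim_obj[OF R]]])
    fix x assume x: "x \<in> R"
    show "lproj D R x \<cdot> (lmap D Q R \<cdot> u) = lproj D R x \<cdot> c_id C (lobj D R)"
      using comp_assoc[OF u(1) l lproj_hom[OF R x]] lproj_lmap[OF D Q R RQ x] u(2) x RQ \<pi>R[OF x]
        id_right[OF lproj_hom[OF R x]] by auto
  qed
  moreover have "u \<cdot> lmap D Q R = c_id C (lobj D Q)"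
  proof (rule lim_eqI[OF D Q comp_hom[OF l u(1)] id_hom[OF lim_obj[OF Q]]])
    fix x assume x: "x \<in> Q"
    have px: "p x \<in> R" "p x \<le> x" using p[OF x] by auto
    have "lproj D Q x \<cdot> (u \<cdot> lmap D Q R) = D (p x) x \<cdot> lproj D R (p x) \<cdot> lmap D Q R"
      using comp_assoc[OF l u(1) lproj_hom[OF Q x]] u(2)[OF x] by (simp add: \<pi>_def)
    also have "\<dots> = D (p x) x \<cdot> lproj D Q (p x)"
      using comp_assoc[OF l lproj_hom[OF R px(1)] diagram_hom[OF D pQ[OF x] x px(2)]]
        lproj_lmap[OF D Q R RQ px(1)] by simp
    also have "\<dots> = lproj D Q x \<cdot> c_id C (lobj D Q)"
      using lproj_comp[OF Q pQ[OF x] x px(2)] id_right[OF lproj_hom[OF Q x]] by simp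
    finally show "lproj D Q x \<cdot> (u \<cdot> lmap D Q R) = lproj D Q x \<cdot> c_id C (lobj D Q)" .
  qed
  ultimately show "iso C (lmap D Q R)" using isoI[OF l u(1)] by simp
qed

lemma fib_resD:
  assumes "fib_res D Q R"
  shows "R \<subseteq> Q" "has_lim D Q" "has_lim D R" "fibr (lobj D Q)" "fibr (lobj D R)" "flim D Q" "flim D R"
    "lmap D Q R \<in> F"
  using assms by (auto simp: fib_res_def flim_def)

lemma flim_coreflective:
  assumes D: "diagram D Q" and RQ: "R \<subseteq> Q" and R: "flim D R"
    and corefl: "\<And>q. q \<in> Q \<Longrightarrow> \<exists>p\<in>R. p \<le> q \<and> (\<forall>r\<in>R. r \<le> q \<longrightarrow> r \<le> p)"
  shows "fib_res D Q R" and "lmap D Q R \<in> W"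
proof -
  have hR: "has_lim D R" and fR: "fibr (lobj D R)" using R by (auto simp: flim_def)
  note l = lim_coreflective[OF D RQ hR corefl]
  note h = lmap_hom[OF D l(1) hR RQ]
  have "lmap D Q R \<in> F" by (rule iso_F_hom[OF l(2) h fR])
  then show "fib_res D Q R" using l(1) R fibr_dom[OF _ h fR] RQ by (simp add: fib_res_def flim_def)
  show "lmap D Q R \<in> W" by (rule iso_W[OF l(2)])
qed

text \<open>The limit over \<open>Q \<union> R\<close> is the pullback of the limits over \<open>Q\<close> and \<open>R\<close> over that of \<open>Q \<inter> R\<close>.\<close>

lemma lim_excision:
  assumes D: "diagram D (Q \<union> R)" and Q: "flim D Q" and R: "fib_res D R (Q \<inter> R)"
    and cross: "\<And>x y. x \<in> Q - R \<Longrightarrow> y \<in> R - Q \<Longrightarrow> \<not> x \<le> y \<and> \<not> y \<le> x"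
  shows "fib_res D (Q \<union> R) Q" and "lmap D R (Q \<inter> R) \<in> W \<Longrightarrow> lmap D (Q \<union> R) Q \<in> W"
proof -
  have DQ: "diagram D Q" and DR: "diagram D R" and DI: "diagram D (Q \<inter> R)"
    using diagram_subset[OF D] by auto
  have hQ: "has_lim D Q" and fQ: "fibr (lobj D Q)" using Q by (auto simp: flim_def)
  note R = fib_resD[OF R]
  define f where "f = lmap D Q (Q \<inter> R)"
  define p where "p = lmap D R (Q \<inter> R)"
  have f: "f \<in> hom C (lobj D Q) (lobj D (Q \<inter> R))"
    and fx: "\<And>x. x \<in> Q \<inter> R \<Longrightarrow> lproj D (Q \<inter> R) x \<cdot> f = lproj D Q x"
    unfolding f_def using lmap_hom[OF DQ hQ R(3)] lproj_lmap[OF DQ hQ R(3)] by simp_all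
  have p: "p \<in> hom C (lobj D R) (lobj D (Q \<inter> R))"
    and px: "\<And>x. x \<in> Q \<inter> R \<Longrightarrow> lproj D (Q \<inter> R) x \<cdot> p = lproj D R x"
    unfolding p_def using lmap_hom[OF DR R(2,3)] lproj_lmap[OF DR R(2,3)] by simp_all
  have arr: "f \<in> c_arr C" "p \<in> F" "c_dom C f = lobj D Q" "c_cod C f = lobj D (Q \<inter> R)"
    "c_dom C p = lobj D R" "c_cod C p = lobj D (Q \<inter> R)"
    using hom_dest[OF f] hom_dest[OF p] R(8) by (auto simp: p_def)
  have agree: "lproj D Q x \<cdot> a = lproj D R x \<cdot> b"
    if ab: "a \<in> hom C M (lobj D Q)" "b \<in> hom C M (lobj D R)" "f \<cdot> a = p \<cdot> b" and x: "x \<in> Q \<inter> R" for a b M x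
    using comp_assoc[OF ab(1) f lproj_hom[OF R(3) x]] comp_assoc[OF ab(2) p lproj_hom[OF R(3) x]]
      fx[OF x] px[OF x] ab(3) by simp
  define glue where "glue a b x = (if x \<in> Q then lproj D Q x \<cdot> a else lproj D R x \<cdot> b)" for a b x
  have glue_cone: "cone D (Q \<union> R) M (glue a b)"
    if ab: "a \<in> hom C M (lobj D Q)" "b \<in> hom C M (lobj D R)" "f \<cdot> a = p \<cdot> b" for a b M
    unfolding cone_def
  proof (intro conjI ballI impI)
    note cQ = cone_precomp[OF DQ lim_cone[OF hQ] ab(1)] and cR = cone_precomp[OF DR lim_cone[OF R(2)] ab(2)]
    have gR: "glue a b x = lproj D R x \<cdot> b" if "x \<in> R" for x
      using agree[OF ab, of x] that by (simp add: glue_def)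
    show "M \<in> c_obj C" using hom_dest[OF ab(1)] by simp
    fix x assume x: "x \<in> Q \<union> R"
    show "glue a b x \<in> hom C M (ob D x)"
      using cone_hom[OF cQ] cone_hom[OF cR] x by (auto simp: glue_def)
    fix y assume y: "y \<in> Q \<union> R" "x \<le> y"
    \<comment> \<open>\<open>cross\<close> excludes arrows between the two set differences, so each
      arrow lies inside one piece and two cones agreeing on the intersection form one cone.\<close>
    have "x \<in> Q \<and> y \<in> Q \<or> x \<in> R \<and> y \<in> R" using cross[of x y] cross[of y x] x y by blast
    then show "D x y \<cdot> glue a b x = glue a b y"
    proof
      assume "x \<in> Q \<and> y \<in> Q"
      then show ?thesis using cone_comp[OF cQ, of x y] y(2) by (simp add: glue_def)
    next
      assume "x \<in> R \<and> y \<in> R"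
      then show ?thesis using cone_comp[OF cR, of x y] y(2) gR by simp
    qed
  qed
  obtain P a b where pb: "is_pullback C f p P a b"
    using pullback_ex[of f p] arr fQ R(5) by auto
  have ab: "a \<in> hom C P (lobj D Q)" "b \<in> hom C P (lobj D R)" "f \<cdot> a = p \<cdot> b"
    using pb arr by (auto simp: is_pullback_def)
  have lim: "is_limit D (Q \<union> R) P (glue a b)"
    unfolding is_limit_def
  proof (intro conjI allI impI)
    fix M \<rho> assume r: "cone D (Q \<union> R) M \<rho>"
    obtain a' where a': "a' \<in> hom C M (lobj D Q)" "\<And>x. x \<in> Q \<Longrightarrow> lproj D Q x \<cdot> a' = \<rho> x"
      using lim_univ[OF hQ cone_subset[OF r Un_upper1]] by metis
    obtain b' where b': "b' \<in> hom C M (lobj D R)" "\<And>x. x \<in> R \<Longrightarrow> lproj D R x \<cdot> b' = \<rho> x"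
      using lim_univ[OF R(2) cone_subset[OF r Un_upper2]] by metis
    have fp: "f \<cdot> a' = p \<cdot> b'"
    proof (rule lim_eqI[OF DI R(3) comp_hom[OF a'(1) f] comp_hom[OF b'(1) p]])
      fix x assume x: "x \<in> Q \<inter> R"
      show "lproj D (Q \<inter> R) x \<cdot> (f \<cdot> a') = lproj D (Q \<inter> R) x \<cdot> (p \<cdot> b')"
        using comp_assoc[OF a'(1) f lproj_hom[OF R(3) x]] comp_assoc[OF b'(1) p lproj_hom[OF R(3) x]]
          fx[OF x] px[OF x] a'(2) b'(2) x by simp
    qed
    have M: "M \<in> c_obj C" using hom_dest[OF a'(1)] by simp
    have ex1: "\<exists>!u. u \<in> hom C M P \<and> a \<cdot> u = a' \<and> b \<cdot> u = b'"
      using pb M a'(1) b'(1) fp arr by (simp add: is_pullback_def)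
    have "(u \<in> hom C M P \<and> a \<cdot> u = a' \<and> b \<cdot> u = b') \<longleftrightarrow>
          (u \<in> hom C M P \<and> (\<forall>x\<in>Q \<union> R. glue a b x \<cdot> u = \<rho> x))" for u
    proof (cases "u \<in> hom C M P")
      case u: True
      have gQ: "glue a b x \<cdot> u = lproj D Q x \<cdot> (a \<cdot> u)" if "x \<in> Q" for x
        using comp_assoc[OF u ab(1) lproj_hom[OF hQ that]] that by (simp add: glue_def)
      have gR: "glue a b x \<cdot> u = lproj D R x \<cdot> (b \<cdot> u)" if "x \<in> R" for x
        using comp_assoc[OF u ab(2) lproj_hom[OF R(2) that]] agree[OF ab, of x] that by (simp add: glue_def)
      have "a \<cdot> u = a'" if "\<forall>x\<in>Q \<union> R. glue a b x \<cdot> u = \<rho> x"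
        using lim_eqI[OF DQ hQ comp_hom[OF u ab(1)] a'(1)] a'(2) gQ that by simp
      moreover have "b \<cdot> u = b'" if "\<forall>x\<in>Q \<union> R. glue a b x \<cdot> u = \<rho> x"
        using lim_eqI[OF DR R(2) comp_hom[OF u ab(2)] b'(1)] b'(2) gR that by simp
      ultimately show ?thesis using u gQ gR a'(2) b'(2) by auto
    qed simp
    then show "\<exists>!u. u \<in> hom C M P \<and> (\<forall>x\<in>Q \<union> R. glue a b x \<cdot> u = \<rho> x)"
      using ex1 by simp
  qed (rule glue_cone[OF ab])
  then have h: "has_lim D (Q \<union> R)" by (auto simp: has_lim_def)
  note lQ = lmap_hom[OF D h hQ Un_upper1] lproj_lmap[OF D h hQ Un_upper1]
  note lR = lmap_hom[OF D h R(2) Un_upper2] lproj_lmap[OF D h R(2) Un_upper2]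
  \<comment> \<open>The pullback P only served to show that a limit exists; \<open>lobj\<close> is a
    limit chosen independently of P. (F4) speaks about every pullback square, so it applies to the
    comparison map itself once the chosen limit is seen to be a pullback too.\<close>
  have pb': "is_pullback C f p (lobj D (Q \<union> R)) (lmap D (Q \<union> R) Q) (lmap D (Q \<union> R) R)"
    unfolding is_pullback_def arr
  proof (intro conjI ballI impI)
    show "lobj D (Q \<union> R) \<in> c_obj C" by (rule lim_obj[OF h])
    show "f \<cdot> lmap D (Q \<union> R) Q = p \<cdot> lmap D (Q \<union> R) R"
      unfolding f_def p_def
      using lmap_comp[OF D h hQ R(3)] lmap_comp[OF D h R(2) R(3)] by simp
    fix M a' b' assume M: "M \<in> c_obj C" "a' \<in> hom C M (lobj D Q)" "b' \<in> hom C M (lobj D R)" "f \<cdot> a' = p \<cdot> b'"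
    have "(u \<in> hom C M (lobj D (Q \<union> R)) \<and> lmap D (Q \<union> R) Q \<cdot> u = a' \<and> lmap D (Q \<union> R) R \<cdot> u = b') \<longleftrightarrow>
          (u \<in> hom C M (lobj D (Q \<union> R)) \<and> (\<forall>x\<in>Q \<union> R. lproj D (Q \<union> R) x \<cdot> u = glue a' b' x))" for u
    proof (cases "u \<in> hom C M (lobj D (Q \<union> R))")
      case u: True
      have eQ: "lproj D (Q \<union> R) x \<cdot> u = lproj D Q x \<cdot> (lmap D (Q \<union> R) Q \<cdot> u)" if "x \<in> Q" for x
        using comp_assoc[OF u lQ(1) lproj_hom[OF hQ that]] lQ(2)[OF that] by simp
      have eR: "lproj D (Q \<union> R) x \<cdot> u = lproj D R x \<cdot> (lmap D (Q \<union> R) R \<cdot> u)" if "x \<in> R" for x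
        using comp_assoc[OF u lR(1) lproj_hom[OF R(2) that]] lR(2)[OF that] by simp
      have gR: "glue a' b' x = lproj D R x \<cdot> b'" if "x \<in> R" for x
        using agree[OF M(2-4), of x] that by (simp add: glue_def)
      have gQ: "glue a' b' x = lproj D Q x \<cdot> a'" if "x \<in> Q" for x
        using that by (simp add: glue_def)
      have "lmap D (Q \<union> R) Q \<cdot> u = a'" if "\<forall>x\<in>Q \<union> R. lproj D (Q \<union> R) x \<cdot> u = glue a' b' x"
        by (rule lim_eqI[OF DQ hQ comp_hom[OF u lQ(1)] M(2)]) (metis gQ eQ that UnCI)
      moreover have "lmap D (Q \<union> R) R \<cdot> u = b'" if "\<forall>x\<in>Q \<union> R. lproj D (Q \<union> R) x \<cdot> u = glue a' b' x"
        by (rule lim_eqI[OF DR R(2) comp_hom[OF u lR(1)] M(3)]) (metis gR eR that UnCI)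
      moreover have "lproj D (Q \<union> R) x \<cdot> u = glue a' b' x"
        if "lmap D (Q \<union> R) Q \<cdot> u = a'" "lmap D (Q \<union> R) R \<cdot> u = b'" "x \<in> Q \<union> R" for x
        using that gQ[of x] gR[of x] eQ[of x] eR[of x] by auto
      ultimately show ?thesis using u by blast
    qed simp
    then show "\<exists>!u. u \<in> hom C M (lobj D (Q \<union> R)) \<and> lmap D (Q \<union> R) Q \<cdot> u = a' \<and> lmap D (Q \<union> R) R \<cdot> u = b'"
      using is_limit_ex1[OF limit_is[OF h] glue_cone[OF M(2-4)]] by (simp only:)
  qed (rule lQ(1) lR(1))+
  have "lmap D (Q \<union> R) Q \<in> F \<and> (p \<in> W \<longrightarrow> lmap D (Q \<union> R) Q \<in> W)"
    using pullback_fib[OF arr(1,2) _ _ _ pb'] arr fQ R(5) by simp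
  then show "fib_res D (Q \<union> R) Q" and "lmap D R (Q \<inter> R) \<in> W \<Longrightarrow> lmap D (Q \<union> R) Q \<in> W"
    using h Q fibr_dom[OF _ lQ(1) fQ] by (auto simp: fib_res_def flim_def p_def)
qed

section \<open>Reedy fibrant diagrams and replacement\<close>

lemma fib_res_cong:
  assumes eq: "\<And>x y. x \<in> Q \<Longrightarrow> y \<in> Q \<Longrightarrow> x \<le> y \<Longrightarrow> D x y = E x y"
  shows "fib_res D Q R = fib_res E Q R"
proof -
  have cone: "cone D T = cone E T" if "T \<subseteq> Q" for T
  proof -
    have "ob D x = ob E x" if "x \<in> T" for x using eq that \<open>T \<subseteq> Q\<close> by (auto simp: ob_def)
    moreover have "D x y = E x y" if "x \<in> T" "y \<in> T" "x \<le> y" for x y using eq that \<open>T \<subseteq> Q\<close> by auto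
    ultimately show ?thesis by (simp add: cone_def fun_eq_iff cong: ball_cong)
  qed
  have lim: "is_limit D T = is_limit E T" if "T \<subseteq> Q" for T
    by (intro ext) (simp only: is_limit_def cone[OF that])
  \<comment> \<open>\<open>lobj\<close> and \<open>lproj\<close> are choices made from the predicate
    \<open>is_limit\<close> alone, so equal predicates give equal, not merely isomorphic,
    limits.\<close>
  have l: "lobj D T = lobj E T" "lproj D T = lproj E T" "has_lim D T = has_lim E T" if "T \<subseteq> Q" for T
    by (simp_all only: lobj_def lproj_def has_lim_def lim[OF that])
  show ?thesis
  proof (cases "R \<subseteq> Q")
    case True
    show ?thesis by (simp only: fib_res_def flim_def lmap_def l[OF True] l[OF order_refl])
  qed (simp add: fib_res_def)
qed

text \<open>Adjoining a minimal x attaches its up-set along the elements strictly above x; the Reedy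
  condition at x is exactly the fibration that excision pulls back.\<close>

lemma reedy_flim:
  assumes "finite Q" "diagram D Q" "reedy D Q"
  shows "flim D Q"
  using assms
proof (induction Q rule: finite_minimal_induct)
  case empty
  show ?case by (rule flim_empty)
next
  case (insert x Q)
  let ?R = "{y \<in> insert x Q. x \<le> y}"
  have up: "{z \<in> insert x Q. y \<le> z} = {z \<in> Q. y \<le> z}" "{z \<in> insert x Q. y < z} = {z \<in> Q. y < z}"
    if "y \<in> Q" for y using insert.hyps(3)[OF that] by auto
  have DQ: "diagram D Q" using diagram_subset[OF insert.prems(1)] by blast
  have "reedy D Q" using insert.prems(2) up by (simp add: reedy_def)
  then have fQ: "flim D Q" using insert.IH DQ by simp
  have "Q \<inter> ?R = {y \<in> insert x Q. x < y}" using insert.hyps by (auto simp: less_le)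
  then have fr: "fib_res D ?R (Q \<inter> ?R)" using insert.prems(2) by (simp add: reedy_def)
  have un: "Q \<union> ?R = insert x Q" by auto
  have "fib_res D (Q \<union> ?R) Q"
  proof (rule lim_excision(1)[OF _ fQ fr])
    show "diagram D (Q \<union> ?R)" using insert.prems(1) un by simp
    show "\<not> u \<le> y \<and> \<not> y \<le> u" if "u \<in> Q - ?R" "y \<in> ?R - Q" for u y
      using that insert.hyps by auto
  qed
  then show ?case unfolding un by (rule fib_resD(6))
qed

lemma reedy_upclosed:
  assumes "reedy D Q" "R \<subseteq> Q" "\<And>x y. x \<in> R \<Longrightarrow> y \<in> Q \<Longrightarrow> x \<le> y \<Longrightarrow> y \<in> R"
  shows "reedy D R"
proof -
  have "{y\<in>R. x \<le> y} = {y\<in>Q. x \<le> y} \<and> {y\<in>R. x < y} = {y\<in>Q. x < y}" if "x \<in> R" for x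
    using assms(2,3) that by (auto simp: less_le)
  then show ?thesis using assms(1,2) by (auto simp: reedy_def)
qed

text \<open>Going downwards, the map from \<open>ob D x\<close> to the limit of the part of E above
  x is factored by (F5) as a weak equivalence followed by a fibration. (F5) applies because that
  limit is fibrant, whether or not \<open>ob D x\<close> is.\<close>

lemma reedy_replacement:
  assumes "finite Q" "diagram D Q"
  shows "\<exists>E \<eta>. diagram E Q \<and> reedy E Q \<and> (\<forall>x\<in>Q. \<eta> x \<in> W \<and> \<eta> x \<in> hom C (ob D x) (ob E x)) \<and>
    (\<forall>x\<in>Q. \<forall>y\<in>Q. x \<le> y \<longrightarrow> E x y \<cdot> \<eta> x = \<eta> y \<cdot> D x y)"
  using assms
proof (induction Q rule: finite_minimal_induct)
  case empty
  show ?case by (simp add: diagram_def reedy_def)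
next
  case (insert x Q)
  have DQ: "diagram D Q" using diagram_subset[OF insert.prems] by blast
  obtain E \<eta> where IH: "diagram E Q \<and> reedy E Q \<and> (\<forall>x\<in>Q. \<eta> x \<in> W \<and> \<eta> x \<in> hom C (ob D x) (ob E x)) \<and>
    (\<forall>x\<in>Q. \<forall>y\<in>Q. x \<le> y \<longrightarrow> E x y \<cdot> \<eta> x = \<eta> y \<cdot> D x y)"
    using insert.IH[OF DQ] by (elim exE) (rule that)
  then have E: "diagram E Q" "reedy E Q"
    and \<eta>: "\<And>x. x \<in> Q \<Longrightarrow> \<eta> x \<in> W" "\<And>x. x \<in> Q \<Longrightarrow> \<eta> x \<in> hom C (ob D x) (ob E x)"
      "\<And>x y. x \<in> Q \<Longrightarrow> y \<in> Q \<Longrightarrow> x \<le> y \<Longrightarrow> E x y \<cdot> \<eta> x = \<eta> y \<cdot> D x y"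
    by simp_all
  define R where "R = {y\<in>Q. x < y}"
  have RQ: "R \<subseteq> Q" by (auto simp: R_def)
  have "reedy E R" by (rule reedy_upclosed[OF E(2) RQ]) (auto simp: R_def)
  then have fR: "flim E R"
    using reedy_flim[OF _ diagram_subset[OF E(1) RQ]] finite_subset[OF RQ] insert.hyps(1) by simp
  then have hR: "has_lim E R" and fibR: "fibr (lobj E R)" by (auto simp: flim_def)
  have Dh: "D x y \<in> hom C (ob D x) (ob D y)" if "y \<in> R" for y
    using diagram_hom[OF insert.prems, of x y] that by (auto simp: R_def)
  have cn: "cone E R (ob D x) (\<lambda>y. \<eta> y \<cdot> D x y)"
    unfolding cone_def
  proof (intro conjI ballI impI)
    show "ob D x \<in> c_obj C" using diagram_ob[OF insert.prems] by simp
    fix y assume y: "y \<in> R"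
    then have yQ: "y \<in> Q" using RQ by auto
    show "\<eta> y \<cdot> D x y \<in> hom C (ob D x) (ob E y)" by (rule comp_hom[OF Dh[OF y] \<eta>(2)[OF yQ]])
    fix z assume z: "z \<in> R" "y \<le> z"
    then have zQ: "z \<in> Q" using RQ by auto
    have "E y z \<cdot> (\<eta> y \<cdot> D x y) = \<eta> z \<cdot> D y z \<cdot> D x y"
      using comp_assoc[OF Dh[OF y] \<eta>(2)[OF yQ] diagram_hom[OF E(1) yQ zQ z(2)]] \<eta>(3)[OF yQ zQ z(2)] by simp
    also have "\<dots> = \<eta> z \<cdot> D x z"
      using comp_assoc[OF Dh[OF y] diagram_hom[OF DQ yQ zQ z(2)] \<eta>(2)[OF zQ]]
        diagram_comp[OF insert.prems, of x y z] y z by (auto simp: R_def)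
    finally show "E y z \<cdot> (\<eta> y \<cdot> D x y) = \<eta> z \<cdot> D x z" .
  qed
  obtain u where u: "u \<in> hom C (ob D x) (lobj E R)" "\<And>y. y \<in> R \<Longrightarrow> lproj E R y \<cdot> u = \<eta> y \<cdot> D x y"
    by (rule lim_univ[OF hR cn]) (rule that)
  obtain s p where sp: "s \<in> W" "p \<in> F" "s \<in> c_arr C" "p \<in> c_arr C" "c_cod C s = c_dom C p" "p \<cdot> s = u"
    using factorization[of u] hom_dest[OF u(1)] fibR by auto
  define X where "X = c_dom C p"
  have s0: "s \<in> hom C (c_dom C s) X" and p0: "p \<in> hom C X (c_cod C p)"
    using homI[OF sp(3)] homI[OF sp(4)] sp(5) by (simp_all add: X_def)
  have s: "s \<in> hom C (ob D x) X" and p: "p \<in> hom C X (lobj E R)"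
    using s0 p0 hom_dest[OF comp_hom[OF s0 p0]] hom_dest[OF u(1)] sp(6) by auto
  have X: "X \<in> c_obj C" "fibr X" using hom_dest[OF p] fibr_dom[OF sp(2) p fibR] by auto
  \<comment> \<open>The value at \<open>a\<close> in Q and \<open>b = x\<close> is junk that no one
    reads: x is minimal, so no such pair is an arrow.\<close>
  define E' where "E' a b = (if a = x then if b = x then c_id C X else lproj E R b \<cdot> p else E a b)" for a b
  define \<eta>' where "\<eta>' a = (if a = x then s else \<eta> a)" for a
  have E'Q: "E' a b = E a b" if "a \<in> Q" for a b using that insert.hyps by (auto simp: E'_def)
  have obx: "ob E' x = X" using X by (simp add: ob_def E'_def)
  have obQ: "ob E' y = ob E y" if "y \<in> Q" for y using E'Q[OF that] by (simp add: ob_def)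
  have E'x: "E' x y = lproj E R y \<cdot> p" if "y \<in> R" for y using that by (auto simp: E'_def R_def)
  have xR: "y \<in> R \<and> y \<noteq> x" if "y \<in> Q" "x \<le> y" for y using that insert.hyps by (auto simp: R_def less_le)
  have not: "\<not> y \<le> x" if "y \<in> Q" for y using insert.hyps(3)[OF that] .
  have DE: "diagram E' (insert x Q)"
    unfolding diagram_def
  proof (intro conjI ballI impI)
    fix a assume a: "a \<in> insert x Q"
    show "E' a a = c_id C (ob E' a)"
      using a obx obQ diagram_id[OF E(1)] by (cases "a = x") (auto simp: E'_def)
    fix b assume b: "b \<in> insert x Q" "a \<le> b"
    show "E' a b \<in> hom C (ob E' a) (ob E' b)"
    proof (cases "a = x")
      case True
      then show ?thesis
        using b id_hom[OF X(1)] xR[of b] comp_hom[OF p lproj_hom[OF hR, of b]] obx obQ[of b]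
        by (cases "b = x") (auto simp: E'_def)
    next
      case False
      then have "a \<in> Q" "b \<in> Q" using a b not by auto
      then show ?thesis using diagram_hom[OF E(1)] obQ E'Q b by simp
    qed
  next
    fix a b c assume abc: "a \<in> insert x Q" "b \<in> insert x Q" "c \<in> insert x Q" "a \<le> b \<and> b \<le> c"
    show "E' b c \<cdot> E' a b = E' a c"
    proof (cases "a = x")
      case ax: True
      show ?thesis
      proof (cases "b = x")
        case bx: True
        have "E' x c \<in> hom C X (ob E' c)"
          using abc id_hom[OF X(1)] xR[of c] comp_hom[OF p lproj_hom[OF hR, of c]] obx obQ[of c] ax
          by (cases "c = x") (auto simp: E'_def)
        then show ?thesis using id_right ax bx by (simp add: E'_def)
      next
        case False
        then have bc: "b \<in> Q" "c \<in> Q" "b \<in> R" "c \<in> R"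
          using abc not xR[of b] xR[of c] ax by auto
        show ?thesis
          using comp_assoc[OF p lproj_hom[OF hR bc(3)] diagram_hom[OF E(1) bc(1,2)]]
            lproj_comp[OF hR bc(3,4)] abc E'Q[OF bc(1)] E'x[OF bc(3)] E'x[OF bc(4)] ax by simp
      qed
    next
      case False
      then have q: "a \<in> Q" "b \<in> Q" "c \<in> Q" using abc not by auto
      then show ?thesis using diagram_comp[OF E(1)] E'Q abc by simp
    qed
  qed
  have up: "{z \<in> insert x Q. y \<le> z} = {z \<in> Q. y \<le> z}" "{z \<in> insert x Q. y < z} = {z \<in> Q. y < z}"
    if "y \<in> Q" for y using not[OF that] by auto
  have Rx: "{z \<in> insert x Q. x < z} = R" by (auto simp: R_def)
  have "fib_res E' {z \<in> insert x Q. y \<le> z} {z \<in> insert x Q. y < z}" if y: "y \<in> insert x Q" for y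
  proof (cases "y = x")
    case False
    then have "y \<in> Q" using y by simp
    then have "fib_res E {z \<in> Q. y \<le> z} {z \<in> Q. y < z}" using E(2) by (simp add: reedy_def)
    then show ?thesis
      using fib_res_cong[of "{z \<in> Q. y \<le> z}" E' E "{z \<in> Q. y < z}"] E'Q up \<open>y \<in> Q\<close> by simp
  next
    case True
    let ?S = "{z \<in> insert x Q. x \<le> z}"
    have DS: "diagram E' ?S" by (rule diagram_subset[OF DE]) blast
    have xS: "x \<in> ?S" by simp
    have "fib_res E R R" by (rule fib_res_refl[OF diagram_subset[OF E(1) RQ] fR])
    then have "fib_res E' R R"
      using fib_res_cong[of R E' E R] E'Q[OF subsetD[OF RQ]] by simp
    then have R': "has_lim E' R" "flim E' R" by (rule fib_resD)+
    have same: "is_limit E' R = is_limit E R"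
    proof -
      have "cone E' R = cone E R"
        using E'Q obQ RQ by (simp add: cone_def fun_eq_iff subset_iff cong: ball_cong)
      then show ?thesis by (intro ext) (simp only: is_limit_def)
    qed
    then have l: "lobj E' R = lobj E R" "lproj E' R = lproj E R" by (simp_all add: lobj_def lproj_def)
    note m = lim_min[OF DS xS]
    have hS: "has_lim E' ?S" and iS: "iso C (lproj E' ?S x)" using m by auto
    have px: "lproj E' ?S x \<in> hom C (lobj E' ?S) X" using lproj_hom[OF hS xS] obx by simp
    have RS: "R \<subseteq> ?S" by (auto simp: R_def)
    \<comment> \<open>As x is least in \<open>?S\<close>, the Reedy map at x is the chosen fibration
      p up to the isomorphism from the limit to X.\<close>
    have "lmap E' ?S R = p \<cdot> lproj E' ?S x"
    proof (rule lmap_eqI[OF DS hS R'(1) RS])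
      show "p \<cdot> lproj E' ?S x \<in> hom C (lobj E' ?S) (lobj E' R)" using comp_hom[OF px p] l by simp
      fix z assume z: "z \<in> R"
      then have "z \<in> ?S" "x \<le> z" using RS by auto
      then show "lproj E' R z \<cdot> (p \<cdot> lproj E' ?S x) = lproj E' ?S z"
        using comp_assoc[OF px p lproj_hom[OF hR z]] lproj_comp[OF hS xS, of z] E'x[OF z] l by simp
    qed
    moreover have "p \<cdot> lproj E' ?S x \<in> F"
      by (rule comp_F[OF iso_F_hom[OF iS px X(2)] sp(2) px p])
    moreover have "fibr (lobj E' ?S)" by (rule fibr_dom[OF iso_F_hom[OF iS px X(2)] px X(2)])
    ultimately show ?thesis using True Rx hS R' RS by (simp add: fib_res_def flim_def)
  qed
  then have "reedy E' (insert x Q)" by (simp add: reedy_def)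
  moreover have "\<eta>' a \<in> W \<and> \<eta>' a \<in> hom C (ob D a) (ob E' a)" if "a \<in> insert x Q" for a
    using that s sp(1) obx obQ \<eta>(1,2) by (cases "a = x") (auto simp: \<eta>'_def)
  moreover have "E' a b \<cdot> \<eta>' a = \<eta>' b \<cdot> D a b" if ab: "a \<in> insert x Q" "b \<in> insert x Q" "a \<le> b" for a b
  proof (cases "a = x")
    case ax: True
    show ?thesis
    proof (cases "b = x")
      case True
      then show ?thesis using ax id_left[OF s] id_right[OF s] diagram_id[OF insert.prems, of x]
        by (simp add: E'_def \<eta>'_def)
    next
      case False
      then have b: "b \<in> R" "b \<noteq> x" using ab ax xR[of b] by auto
      then show ?thesis
        using comp_assoc[OF s p lproj_hom[OF hR b(1)]] sp(6) u(2)[OF b(1)] E'x[OF b(1)] ax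
        by (simp add: \<eta>'_def)
    qed
  next
    case False
    then have "a \<in> Q" "b \<in> Q" "b \<noteq> x" using ab not insert.hyps by auto
    then show ?thesis using \<eta>(3)[of a b] ab E'Q False by (simp add: \<eta>'_def)
  qed
  ultimately show ?case using DE by (intro exI[of _ E'] exI[of _ \<eta>']) simp
qed

end

section \<open>Chains in a finite poset\<close>

definition fchain :: "'b::order set \<Rightarrow> bool" where
  "fchain Y \<longleftrightarrow> finite Y \<and> (\<forall>x\<in>Y. \<forall>y\<in>Y. x \<le> y \<or> y \<le> x)"

text \<open>The link of the simplex X in the order complex on \<open>X \<union> T\<close>, except
  that each simplex keeps X as a part. All links and stars thereby become subsets of the single
  poset \<open>link {} P\<close> of non-empty chains, and one diagram restricts to all of
  them.\<close>

definition link :: "'b::order set \<Rightarrow> 'b set \<Rightarrow> 'b set set" where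
  "link X T = {Y. fchain Y \<and> X \<subset> Y \<and> Y \<subseteq> X \<union> T}"

definition star :: "'b::order set \<Rightarrow> 'b set \<Rightarrow> 'b set set" where
  "star X T = {Y. fchain Y \<and> X \<subseteq> Y \<and> Y \<subseteq> X \<union> T}"

lemma fchain_subset: "fchain Y \<Longrightarrow> X \<subseteq> Y \<Longrightarrow> fchain X"
  by (auto simp: fchain_def subset_iff intro: finite_subset)

lemma fchain_insert: "fchain (insert c Y) \<longleftrightarrow> fchain Y \<and> (\<forall>y\<in>Y. c \<le> y \<or> y \<le> c)"
  by (auto simp: fchain_def)

lemma finite_link: "finite X \<Longrightarrow> finite T \<Longrightarrow> finite (link X T)"
  by (rule finite_subset[of _ "Pow (X \<union> T)"]) (auto simp: link_def)

lemma link_mono: "T \<subseteq> U \<Longrightarrow> link X T \<subseteq> link X U"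
  by (auto simp: link_def)

lemma link_subset_link_empty: "X \<subseteq> P \<Longrightarrow> T \<subseteq> P \<Longrightarrow> link X T \<subseteq> link {} P"
  by (auto simp: link_def)

lemma star_subset_link_empty: "X \<subseteq> P \<Longrightarrow> X \<noteq> {} \<Longrightarrow> T \<subseteq> P \<Longrightarrow> star X T \<subseteq> link {} P"
  by (auto simp: link_def star_def)

lemma link_empty_right: "link X {} = {}"
  by (auto simp: link_def)

lemma link_insert_trivial: "C \<in> X \<or> \<not> fchain (insert C X) \<Longrightarrow> link X (insert C T) = link X T"
proof -
  assume *: "C \<in> X \<or> \<not> fchain (insert C X)"
  have "C \<in> X" if "Y \<in> link X (insert C T)" "C \<in> Y" for Y
    using * that fchain_subset[of Y "insert C X"] by (auto simp: link_def)
  then show ?thesis by (fastforce simp: link_def)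
qed

text \<open>Of the chains containing C, only \<open>insert C X\<close> itself fails to lie in
  \<open>link (insert C X) T\<close>. It is the least element of the star, so a link grows by
  attaching a star along the same star without its least element.\<close>

lemma link_insert:
  assumes "C \<notin> X" "C \<notin> T" "fchain (insert C X)"
  shows "link X (insert C T) = (link X T \<union> link (insert C X) T) \<union> star (insert C X) T"
    and "(link X T \<union> link (insert C X) T) \<inter> star (insert C X) T = link (insert C X) T"
  using assms by (auto simp: link_def star_def)

locale reedy_chains = fibration_cat C W F t
  for C :: "('o, 'm) cat" and W F :: "'m set" and t :: 'o +
  fixes D :: "'b::order set \<Rightarrow> 'b set \<Rightarrow> 'm" and P :: "'b set"
  assumes fin_P: "finite P" and diag: "diagram D (link {} P)" and reedy: "reedy D (link {} P)"
begin

lemma diag_link: "X \<subseteq> P \<Longrightarrow> T \<subseteq> P \<Longrightarrow> diagram D (link X T)"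
  using diagram_subset[OF diag link_subset_link_empty] .

lemma diag_star: "X \<subseteq> P \<Longrightarrow> X \<noteq> {} \<Longrightarrow> T \<subseteq> P \<Longrightarrow> diagram D (star X T)"
  using diagram_subset[OF diag star_subset_link_empty] .

text \<open>The chains in \<open>link (insert c X) T\<close> change nothing, because
  \<open>q - {c}\<close> is a coreflection onto \<open>link X T\<close>; it stays strictly above X,
  which would fail for \<open>insert c X\<close>. That one remaining chain is attached by excision,
  so the restriction map is a pullback of star to link followed by an isomorphism.\<close>

lemma link_add:
  assumes X: "X \<subseteq> P" and T: "T \<subseteq> P" and c: "c \<in> P" "c \<notin> X" "c \<notin> T" "fchain (insert c X)"
    and flim: "flim D (link X T)" and fr: "fib_res D (star (insert c X) T) (link (insert c X) T)"
  shows "fib_res D (link X (insert c T)) (link X T)"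
    and "lmap D (star (insert c X) T) (link (insert c X) T) \<in> W \<Longrightarrow> lmap D (link X (insert c T)) (link X T) \<in> W"
proof -
  let ?Q = "link X T \<union> link (insert c X) T" and ?R = "star (insert c X) T"
  note un = link_insert(1)[OF c(2-4)] and int = link_insert(2)[OF c(2-4)]
  have cT: "insert c T \<subseteq> P" using c T by simp
  have D1: "diagram D (?Q \<union> ?R)" using diag_link[OF X cT] un by simp
  then have DQ: "diagram D ?Q" by (rule diagram_subset) blast
  have corefl: "\<exists>p\<in>link X T. p \<subseteq> q \<and> (\<forall>r\<in>link X T. r \<subseteq> q \<longrightarrow> r \<subseteq> p)" if q: "q \<in> ?Q" for q
  proof (rule bexI[of _ "q - {c}"])
    have "q - {c} \<subseteq> q" by blast
    then show "q - {c} \<in> link X T"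
      using q c fchain_subset[of q "q - {c}"] by (auto simp: link_def)
    show "q - {c} \<subseteq> q \<and> (\<forall>r\<in>link X T. r \<subseteq> q \<longrightarrow> r \<subseteq> q - {c})"
      using c by (auto simp: link_def)
  qed
  note r = flim_coreflective[OF DQ Un_upper1 flim corefl]
  have cross: "\<not> x \<subseteq> y \<and> \<not> y \<subseteq> x" if "x \<in> ?Q - ?R" "y \<in> ?R - ?Q" for x y
    using that c by (auto simp: link_def star_def)
  have fr': "fib_res D ?R (?Q \<inter> ?R)" using fr int by simp
  note e = lim_excision[OF D1 fib_resD(6)[OF r(1)] fr' cross]
  show "fib_res D (link X (insert c T)) (link X T)"
    unfolding un by (rule fib_res_trans[OF D1 e(1) r(1)])
  assume w: "lmap D (star (insert c X) T) (link (insert c X) T) \<in> W"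
  note h = fib_resD(2,3)[OF e(1)] fib_resD(3)[OF r(1)]
  have "lmap D ?Q (link X T) \<cdot> lmap D (?Q \<union> ?R) ?Q \<in> W"
    using comp_W[OF e(2) r(2) lmap_hom[OF D1 h(1,2)] lmap_hom[OF DQ h(2,3)]] w int by simp
  then show "lmap D (link X (insert c T)) (link X T) \<in> W"
    unfolding un using lmap_comp[OF D1 h Un_upper1 Un_upper1] by simp
qed

text \<open>The star statement for chains longer by one element is a hypothesis here, so that this
  lemma can be used inside the induction that proves it.\<close>

lemma fib_res_link_mono_step:
  assumes X: "X \<subseteq> P" and TU: "T \<subseteq> U" "U \<subseteq> P"
    and IH: "\<And>c T. c \<in> P - X \<Longrightarrow> fchain (insert c X) \<Longrightarrow> T \<subseteq> P \<Longrightarrow>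
      fib_res D (star (insert c X) T) (link (insert c X) T)"
  shows "fib_res D (link X U) (link X T)"
proof -
  have *: "fib_res D (link X (T \<union> V)) (link X T)" if "flim D (link X T)" "T \<subseteq> P" "finite V" "V \<subseteq> P" for T V
    using that(3,4)
  proof (induction V)
    case empty
    show ?case using fib_res_refl[OF diag_link[OF X that(2)] that(1)] by simp
  next
    case (insert c V)
    then have IHV: "fib_res D (link X (T \<union> V)) (link X T)" by simp
    have TV: "T \<union> V \<subseteq> P" and c: "c \<in> P" using insert.prems that(2) by auto
    show ?case
    proof (cases "c \<in> X \<or> c \<in> T \<or> \<not> fchain (insert c X)")
      case True
      then have "link X (T \<union> insert c V) = link X (T \<union> V)"
        using link_insert_trivial[of c X "T \<union> V"] by (auto simp: insert_absorb)
      then show ?thesis using IHV by simp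
    next
      case False
      have "fib_res D (link X (insert c (T \<union> V))) (link X (T \<union> V))"
        using False insert.hyps c TV IH[of c "T \<union> V"] fib_resD(6)[OF IHV] by (intro link_add(1)[OF X TV]) auto
      then have "fib_res D (link X (insert c (T \<union> V))) (link X T)"
        using fib_res_trans[OF diag_link[OF X] _ IHV] c TV by simp
      then show ?thesis by simp
    qed
  qed
  have fin: "finite U" by (rule finite_subset[OF TU(2) fin_P])
  \<comment> \<open>Growing from the empty set: \<open>link X {}\<close> is empty, and its limit is
    terminal and fibrant.\<close>
  have "flim D (link X T)"
    using fib_resD(6)[OF *[of "{}" T]] order_trans[OF TU] finite_subset[OF TU(1) fin] by (simp add: link_empty_right flim_empty)
  then show ?thesis using *[of T U] TU fin by (simp add: Un_absorb1)
qed

text \<open>The Reedy condition is the case \<open>T = P\<close>. For smaller T, the fibration from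
  the star in P to \<open>link X P\<close> is followed by the restriction to
  \<open>link X T\<close>, a fibration by induction on longer chains; and the stars over T and over
  P have isomorphic limits.\<close>

lemma fib_res_star:
  assumes "X \<in> link {} P" "T \<subseteq> P"
  shows "fib_res D (star X T) (link X T)"
  using assms
proof (induction "card P - card X" arbitrary: X T rule: less_induct)
  case less
  have X: "X \<subseteq> P" "X \<noteq> {}" "fchain X" using less.prems by (auto simp: link_def)
  have IH: "fib_res D (star (insert c X) T) (link (insert c X) T)"
    if "c \<in> P - X" "fchain (insert c X)" "T \<subseteq> P" for c T
  proof (rule less.hyps)
    have "finite X" using finite_subset[OF X(1) fin_P] .
    moreover have "card (insert c X) \<le> card P" using that X by (intro card_mono fin_P) auto
    ultimately show "card P - card (insert c X) < card P - card X" using that by simp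
  qed (use that X in \<open>auto simp: link_def\<close>)
  have "{Y \<in> link {} P. X \<le> Y} = star X P" "{Y \<in> link {} P. X < Y} = link X P"
    using X by (auto simp: link_def star_def)
  then have "fib_res D (star X P) (link X P)" using bspec[OF reedy[unfolded reedy_def] less.prems(1)] by simp
  then have fr: "fib_res D (star X P) (link X T)"
    using fib_res_trans[OF diag_star[OF X(1,2) order_refl] _ fib_res_link_mono_step[OF X(1) less.prems(2) order_refl IH]]
    by simp
  have TP: "T \<subseteq> P" by fact
  note DP = diag_star[OF X(1,2) order_refl] and DT = diag_star[OF X(1,2) TP]
  have st: "star X T \<subseteq> star X P" using TP by (auto simp: star_def)
  have XT: "X \<in> star X T" using X by (simp add: star_def)
  have hT: "has_lim D (star X T)" using lim_min(1)[OF DT XT] by (auto simp: star_def)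
  have lt: "link X T \<subseteq> star X T" by (auto simp: link_def star_def)
  note fr' = fib_resD[OF fr]
  have corefl: "\<exists>p\<in>star X T. p \<subseteq> q \<and> (\<forall>r\<in>star X T. r \<subseteq> q \<longrightarrow> r \<subseteq> p)" if q: "q \<in> star X P" for q
    by (rule bexI[of _ "q \<inter> (X \<union> T)"])
      (use q fchain_subset[of q "q \<inter> (X \<union> T)"] in \<open>auto simp: star_def\<close>)
  have iso: "iso C (lmap D (star X P) (star X T))" by (rule lim_coreflective(2)[OF DP st hT corefl])
  note hm = lmap_hom[OF DP fr'(2) hT st]
  note hl = lmap_hom[OF DT hT fr'(3) lt]
  obtain g where g: "g \<in> hom C (lobj D (star X T)) (lobj D (star X P))" "iso C g"
      "lmap D (star X P) (star X T) \<cdot> g = c_id C (lobj D (star X T))"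
    using isoE[OF iso hm] by metis
  \<comment> \<open>The inverse g of the isomorphism between the two star limits exhibits the wanted
    map as a composite of fibrations.\<close>
  have "lmap D (star X P) (link X T) \<cdot> g = lmap D (star X T) (link X T)"
    using comp_assoc[OF g(1) hm hl] lmap_comp[OF DP fr'(2) hT fr'(3) st lt] g(3) id_right[OF hl] by simp
  then have "lmap D (star X T) (link X T) \<in> F"
    using comp_F[OF iso_F_hom[OF g(2,1) fr'(4)] fr'(8) g(1) lmap_hom[OF DP fr'(2,3,1)]] by simp
  moreover have "fibr (lobj D (star X T))" by (rule fibr_dom[OF iso_F_hom[OF g(2,1) fr'(4)] g(1) fr'(4)])
  ultimately show ?case using hT fr'(7) lt by (simp add: fib_res_def flim_def)
qed

lemma fib_res_link_mono:
  assumes "X \<subseteq> P" "T \<subseteq> U" "U \<subseteq> P"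
  shows "fib_res D (link X U) (link X T)"
  by (rule fib_res_link_mono_step[OF assms fib_res_star]) (use assms in \<open>auto simp: link_def\<close>)

lemma has_lim_link: "X \<subseteq> P \<Longrightarrow> T \<subseteq> P \<Longrightarrow> has_lim D (link X T)"
  using fib_resD(2)[OF fib_res_link_mono] by blast

lemma flim_link: "X \<subseteq> P \<Longrightarrow> T \<subseteq> P \<Longrightarrow> flim D (link X T)"
  using fib_resD(6)[OF fib_res_link_mono] by blast

text \<open>The limit over the star is D at X. Mapping on to the limit of the link and projecting to
  \<open>insert c X\<close> gives the arrow from X to \<open>insert c X\<close>, so two-out-of-three
  leaves the remaining map in W.\<close>

lemma star_link_W:
  assumes X: "X \<in> link {} P" and T: "T \<subseteq> P" and c: "c \<in> T" "c \<notin> X" "fchain (insert c X)"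
    and W1: "lproj D (link X T) (insert c X) \<in> W" and W2: "D X (insert c X) \<in> W"
  shows "lmap D (star X T) (link X T) \<in> W"
proof -
  have XP: "X \<subseteq> P" "X \<noteq> {}" "fchain X" using X by (auto simp: link_def)
  note fr = fib_resD[OF fib_res_star[OF X T]]
  note DS = diag_star[OF XP(1,2) T]
  have XS: "X \<in> star X T" using XP by (simp add: star_def)
  have cl: "insert c X \<in> link X T" and cs: "insert c X \<in> star X T" using c by (auto simp: link_def star_def)
  have iso: "iso C (lproj D (star X T) X)" using lim_min(2)[OF DS XS] by (auto simp: star_def)
  have "D X (insert c X) \<cdot> lproj D (star X T) X \<in> W"
    by (rule comp_W[OF iso_W[OF iso] W2 lproj_hom[OF fr(2) XS] diagram_hom[OF DS XS cs]]) auto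
  then have "lproj D (star X T) (insert c X) \<in> W" using lproj_comp[OF fr(2) XS cs subset_insertI] by simp
  then have "lproj D (link X T) (insert c X) \<cdot> lmap D (star X T) (link X T) \<in> W"
    using lproj_lmap[OF DS fr(2,3,1) cl] by simp
  then show ?thesis by (rule W_cancel_left[OF _ W1 lmap_hom[OF DS fr(2,3,1)] lproj_hom[OF fr(3) cl]])
qed

lemma lproj_lmap_W:
  assumes "X \<subseteq> P" "T \<subseteq> U" "U \<subseteq> P" "Y \<in> link X T"
    "lproj D (link X T) Y \<in> W" "lmap D (link X U) (link X T) \<in> W"
  shows "lproj D (link X U) Y \<in> W"
proof -
  note fr = fib_resD[OF fib_res_link_mono[OF assms(1-3)]]
  note DU = diag_link[OF assms(1,3)]
  have "lproj D (link X T) Y \<cdot> lmap D (link X U) (link X T) \<in> W"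
    by (rule comp_W[OF assms(6,5) lmap_hom[OF DU fr(2,3,1)] lproj_hom[OF fr(3) assms(4)]])
  then show ?thesis using lproj_lmap[OF DU fr(2,3,1) assms(4)] by simp
qed

text \<open>With \<open>T = {c}\<close> the link has just one element and the projection is
  invertible. Each further b attaches the star of \<open>insert b X\<close> along its link, and this
  link is again a cone with apex c over a smaller set. By induction its limit is D at its own apex
  up to weak equivalence, so the attachment is a trivial fibration. The induction therefore lets X
  vary.\<close>

lemma cone_lproj_W:
  assumes X: "X \<subseteq> P" and T: "T \<subseteq> P" and c: "c \<in> T" "c \<notin> X" "fchain (insert c X)"
    and cone: "\<And>Y. Y \<in> link X T \<Longrightarrow> fchain (insert c Y) \<and> D Y (insert c Y) \<in> W"
  shows "lproj D (link X T) (insert c X) \<in> W"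
proof -
  have "lproj D (link X (insert c U)) (insert c X) \<in> W"
    if "finite U" "X \<subseteq> P" "U \<subseteq> P" "c \<in> P" "c \<notin> U" "c \<notin> X" "fchain (insert c X)"
      and "\<And>Y. Y \<in> link X (insert c U) \<Longrightarrow> fchain (insert c Y) \<and> D Y (insert c Y) \<in> W" for U X
    using that
  proof (induction U arbitrary: X)
    case empty
    have "diagram D (link X {c})" using diag_link[of X "{c}"] empty.prems by simp
    moreover have "insert c X \<in> link X {c}" using empty.prems by (auto simp: link_def)
    ultimately show ?case
      by (rule iso_W[OF lim_min(2)]) (auto simp: link_def)
  next
    case (insert b U)
    let ?T = "insert c U"
    have TP: "?T \<subseteq> P" "insert b ?T \<subseteq> P" using insert.prems by auto
    have sub: "link X ?T \<subseteq> link X (insert c (insert b U))" by (rule link_mono) auto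
    have IH1: "lproj D (link X ?T) (insert c X) \<in> W"
      using insert.prems sub by (intro insert.IH) auto
    have comm: "insert c (insert b U) = insert b ?T" by auto
    show ?case
    proof (cases "b \<in> X \<or> \<not> fchain (insert b X)")
      case True
      then show ?thesis using IH1 link_insert_trivial[OF True, of ?T] comm by simp
    next
      case False
      let ?X = "insert b X"
      have XP: "?X \<in> link {} P" "?X \<subseteq> P" using False insert.prems by (auto simp: link_def)
      have "?X \<in> link X (insert c (insert b U))" using False by (auto simp: link_def)
      then have cX: "fchain (insert c ?X)" "D ?X (insert c ?X) \<in> W" using insert.prems(7) by auto
      have cn: "c \<notin> ?X" using insert.prems by auto
      have sub2: "link ?X ?T \<subseteq> link X (insert c (insert b U))" by (auto simp: link_def)
      have IH2: "lproj D (link ?X ?T) (insert c ?X) \<in> W"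
        by (rule insert.IH) (use insert.prems XP cX cn sub2 in auto)
      have st: "lmap D (star ?X ?T) (link ?X ?T) \<in> W"
        by (rule star_link_W[OF XP(1) TP(1) _ cn cX(1) IH2 cX(2)]) simp
      have "lmap D (link X (insert b ?T)) (link X ?T) \<in> W"
        by (rule link_add(2)[OF insert.prems(1) TP(1) _ _ _ _ flim_link[OF insert.prems(1) TP(1)]
              fib_res_star[OF XP(1) TP(1)] st])
          (use False insert.prems insert.hyps in auto)
      then show ?thesis unfolding comm
        by (intro lproj_lmap_W[OF insert.prems(1) _ TP(2) _ IH1])
          (use insert.prems in \<open>auto simp: link_def\<close>)
    qed
  qed
  from this[of "T - {c}" X] show ?thesis
    using assms finite_subset[OF T fin_P] by (auto simp: insert_absorb)
qed

text \<open>The new vertex b attaches the star of \<open>{b}\<close> along its link. Since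
  \<open>{b}\<close> is not a member of that link, the arrow from \<open>{b}\<close> to
  \<open>{c, b}\<close> needs a hypothesis of its own.\<close>

lemma add_cone_W:
  assumes T: "T \<subseteq> P" and b: "b \<in> P" "b \<notin> T" and c: "c \<in> T" "b \<le> c \<or> c \<le> b"
    and W: "D {b} {c, b} \<in> W"
    and cone: "\<And>Y. Y \<in> link {b} T \<Longrightarrow> fchain (insert c Y) \<and> D Y (insert c Y) \<in> W"
  shows "lmap D (link {} (insert b T)) (link {} T) \<in> W"
proof -
  have Cl: "{b} \<in> link {} P" using b by (auto simp: link_def fchain_def)
  have ch: "fchain {c, b}" "c \<notin> {b}" using c b by (auto simp: fchain_def)
  have "lproj D (link {b} T) {c, b} \<in> W"
    by (rule cone_lproj_W[OF _ T c(1) ch(2,1) cone]) (use b in auto)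
  then have "lmap D (star {b} T) (link {b} T) \<in> W"
    by (rule star_link_W[OF Cl T c(1) ch(2,1) _ W])
  then show ?thesis
    using b by (intro link_add(2)[OF empty_subsetI T b(1) _ b(2) _ flim_link[OF empty_subsetI T]
            fib_res_star[OF Cl T]]) (auto simp: fchain_def)
qed

end

section \<open>Limits over horns\<close>

text \<open>With \<open>l = fst\<close>, a chain \<open>A\<close> of simplices of the grid has \<open>clab l A\<close> equal to the first coordinate of
  \<open>min A\<^sub>0\<close>, so that the weak equivalences of \<open>\<xi>\<close> are the inclusions preserving \<open>clab\<close>.\<close>

definition lab :: "('a \<Rightarrow> nat) \<Rightarrow> 'a set \<Rightarrow> nat" where
  "lab l X = Min (l ` X)"

definition clab :: "('a \<Rightarrow> nat) \<Rightarrow> 'a set set \<Rightarrow> nat" where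
  "clab l A = Max (lab l ` A)"

definition horn :: "'a set \<Rightarrow> 'a \<Rightarrow> 'a set set" where
  "horn \<sigma> v = {X. X \<noteq> {} \<and> X \<subseteq> \<sigma> \<and> X \<noteq> \<sigma> \<and> X \<noteq> \<sigma> - {v}}"

lemma lab_antimono: "X \<subseteq> Y \<Longrightarrow> X \<noteq> {} \<Longrightarrow> finite Y \<Longrightarrow> lab l Y \<le> lab l X"
  by (auto simp: lab_def intro: Min_antimono)

lemma lab_remove: "v \<in> X \<Longrightarrow> v \<noteq> w \<Longrightarrow> l v = l w \<Longrightarrow> lab l (X - {w}) = lab l X"
proof -
  assume "v \<in> X" "v \<noteq> w" "l v = l w"
  then have "l x \<in> l ` (X - {w})" if "x \<in> X" for x
    using that by (cases "x = w") (auto intro: rev_image_eqI)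
  then have "l ` (X - {w}) = l ` X" by blast
  then show ?thesis by (simp add: lab_def)
qed

lemma clab_singleton [simp]: "clab l {X} = lab l X"
  by (simp add: clab_def)

lemma clab_insert: "finite A \<Longrightarrow> A \<noteq> {} \<Longrightarrow> clab l (insert c A) = max (lab l c) (clab l A)"
  by (simp add: clab_def)

lemma lab_le_clab: "finite A \<Longrightarrow> X \<in> A \<Longrightarrow> lab l X \<le> clab l A"
  by (simp add: clab_def)

context fibration_cat begin

definition rel_diagram :: "('a \<Rightarrow> nat) \<Rightarrow> ('a set set \<Rightarrow> 'a set set \<Rightarrow> 'm) \<Rightarrow> 'a set set set \<Rightarrow> bool" where
  "rel_diagram l D Q \<longleftrightarrow> diagram D Q \<and>
     (\<forall>A\<in>Q. \<forall>B\<in>Q. A \<subseteq> B \<and> clab l A = clab l B \<longrightarrow> D A B \<in> W)"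

text \<open>A single projection, to the chain \<open>{c}\<close> with
  \<open>c = \<sigma> - {w}\<close>, is followed while the horn grows, each new simplex contributing
  a trivial fibration. The other chains of the same label are reached from \<open>{c}\<close>
  afterwards by zigzags of weak equivalences.\<close>

lemma horn_lproj_W:
  assumes fin: "finite \<sigma>" and v: "v \<in> \<sigma>" and w: "w \<in> \<sigma>" "v \<noteq> w" "l v = l w"
    and rel: "rel_diagram l D (link {} (horn \<sigma> v))" and reedy: "reedy D (link {} (horn \<sigma> v))"
  shows "has_lim D (link {} (horn \<sigma> v))"
    and "\<And>A. A \<in> link {} (horn \<sigma> v) \<Longrightarrow> clab l A = lab l \<sigma> \<Longrightarrow> lproj D (link {} (horn \<sigma> v)) A \<in> W"
proof -
  define P where "P = horn \<sigma> v"
  have P: "X \<noteq> {}" "X \<subseteq> \<sigma>" "finite X" if "X \<in> P" for X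
    using that finite_subset[OF _ fin] by (auto simp: P_def horn_def)
  have fP: "finite P" by (rule finite_subset[of _ "Pow \<sigma>"]) (use fin P in auto)
  interpret reedy_chains C W F t D P
    by unfold_locales (use fP rel reedy in \<open>auto simp: P_def rel_diagram_def\<close>)
  show "has_lim D (link {} (horn \<sigma> v))"
    using has_lim_link[of "{}" P] by (simp add: P_def)
  have relW: "D A B \<in> W" if "A \<in> link {} P" "B \<in> link {} P" "A \<subseteq> B" "clab l A = clab l B" for A B
    using rel that by (simp add: rel_diagram_def P_def)
  \<comment> \<open>\<open>clab\<close> is a maximum, so a simplex whose label does not exceed that
    of some member can be added for free. Each apex below is admissible for this reason.\<close>
  have ins: "D Y (insert c Y) \<in> W"
    if "Y \<in> link {} P" "c \<in> P" "fchain (insert c Y)" "X \<in> Y" "lab l c \<le> lab l X" for Y c X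
  proof (rule relW)
    have Y: "finite Y" "Y \<noteq> {}" using that by (auto simp: link_def fchain_def)
    show "clab l Y = clab l (insert c Y)"
      using clab_insert[OF Y] lab_le_clab[OF Y(1) that(4), of l] that(5) by simp
  qed (use that in \<open>auto simp: link_def\<close>)
  have sing: "{X} \<in> link {} P" if "X \<in> P" for X using that by (auto simp: link_def fchain_def)
  have anti: "lab l Y \<le> lab l X" if "X \<in> P" "X \<subseteq> Y" "Y \<subseteq> \<sigma>" for X Y
    using lab_antimono[OF that(2) P(1)[OF that(1)] finite_subset[OF that(3) fin]] .
  define c where "c = \<sigma> - {w}"
  define T0 where "T0 = {X\<in>P. v \<in> X \<and> w \<notin> X}"
  have c: "c \<in> T0" "c \<subseteq> \<sigma>" using v w by (auto simp: c_def T0_def P_def horn_def)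
  have T0: "T0 \<subseteq> P" by (auto simp: T0_def)
  have le_c: "X \<subseteq> c" if "X \<in> T0" for X using that P(2)[of X] by (auto simp: T0_def c_def)
  have stage1: "lproj D (link {} T0) {c} \<in> W"
  proof (rule cone_lproj_W[OF empty_subsetI T0 c(1)])
    fix Y assume Y: "Y \<in> link {} T0"
    then have YP: "Y \<in> link {} P" using link_mono[OF T0] by blast
    have ch: "fchain (insert c Y)" using Y le_c by (auto simp: fchain_insert link_def)
    obtain X where "X \<in> Y" "X \<in> T0" using Y by (auto simp: link_def)
    then show "fchain (insert c Y) \<and> D Y (insert c Y) \<in> W"
      using ch ins[OF YP _ ch] anti[of X c] c T0 le_c by blast
  qed (auto simp: fchain_def)
  have stage2: "lproj D (link {} (T0 \<union> S)) {c} \<in> W" if "S \<subseteq> {X\<in>P. v \<in> X \<and> w \<in> X}" for S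
  proof -
    have "finite S" using finite_subset[OF that] fP by simp
    then show ?thesis using that
    proof (induction S rule: finite_minimal_induct)
      case empty
      then show ?case using stage1 by simp
    next
      case (insert x S)
      let ?T = "T0 \<union> S" and ?c = "x - {w}"
      have x: "x \<in> P" "v \<in> x" "w \<in> x" "x \<subseteq> \<sigma>" using insert.prems P by auto
      have TP: "?T \<subseteq> P" using insert.prems T0 by auto
      have cT: "?c \<in> T0" using x w v by (auto simp: T0_def P_def horn_def)
      have lc: "lab l ?c \<le> lab l x" using lab_remove[OF x(2) w(2,3)] by simp
      have "fchain (insert ?c Y) \<and> D Y (insert ?c Y) \<in> W" if Y: "Y \<in> link {x} ?T" for Y
      proof -
        have YP: "Y \<in> link {} P" using Y link_subset_link_empty[of "{x}" P ?T] x TP by blast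
        have xY: "x \<in> Y" using Y by (auto simp: link_def)
        \<comment> \<open>A comparable y from \<open>T0\<close> lacks w, so it lies inside x and
          even inside \<open>x - {w}\<close>. One from S cannot lie below x by the order of
          insertion, so it contains x and the apex.\<close>
        have "?c \<subseteq> y \<or> y \<subseteq> ?c" if y: "y \<in> Y" for y
        proof -
          have xy: "x \<subseteq> y \<or> y \<subseteq> x" "y = x \<or> y \<in> T0 \<or> y \<in> S"
            using Y y xY by (auto simp: link_def fchain_def)
          then show ?thesis using x insert.hyps(3)[of y] by (auto simp: T0_def)
        qed
        then have ch: "fchain (insert ?c Y)" using Y by (auto simp: fchain_insert link_def)
        then show ?thesis using ins[OF YP _ ch xY lc] cT T0 by blast
      qed
      moreover have "D {x} {?c, x} \<in> W"
        using ins[OF sing[OF x(1)] _ _ _ lc] cT T0 by (auto simp: fchain_def)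
      ultimately have lm: "lmap D (link {} (insert x ?T)) (link {} ?T) \<in> W"
        using x insert.hyps(2) cT by (intro add_cone_W[OF TP x(1), of ?c]) (auto simp: T0_def)
      have cl: "{c} \<in> link {} ?T" using c by (auto simp: link_def fchain_def)
      have xT: "insert x ?T \<subseteq> P" using x TP by simp
      have IH: "lproj D (link {} ?T) {c} \<in> W" using insert.IH insert.prems by simp
      show ?case using lproj_lmap_W[OF empty_subsetI subset_insertI xT cl IH lm] by simp
    qed
  qed
  define T1 where "T1 = {X\<in>P. v \<in> X}"
  have T1: "T1 \<subseteq> P" "T1 = T0 \<union> {X\<in>P. v \<in> X \<and> w \<in> X}" by (auto simp: T1_def T0_def)
  have stage3: "lproj D (link {} (T1 \<union> S)) {c} \<in> W" if "S \<subseteq> {X\<in>P. v \<notin> X}" for S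
  proof -
    have "finite S" using finite_subset[OF that] fP by simp
    then show ?thesis using that
    proof (induction S rule: finite_ranking_induct[where f = card])
      case empty
      then show ?case using stage2[OF order_refl] T1(2) by simp
    next
      case (insert x S)
      let ?T = "T1 \<union> S" and ?c = "insert v x"
      have x: "x \<in> P" "v \<notin> x" "x \<subseteq> \<sigma>" using insert.prems P by auto
      have TP: "?T \<subseteq> P" using insert.prems T1 by auto
      have IH: "lproj D (link {} ?T) {c} \<in> W" using insert by simp
      show ?case
      proof (cases "x \<in> S")
        case True
        then show ?thesis using IH by (simp add: insert_absorb)
      next
        case xS: False
        \<comment> \<open>The shape of the horn enters here: \<open>insert v x\<close> would be
          \<sigma> only for \<open>x = \<sigma> - {v}\<close>, the face that the horn omits.\<close>
        have cT: "?c \<in> T1" using x v by (auto simp: T1_def P_def horn_def)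
        have lc: "lab l ?c \<le> lab l x" using anti[OF x(1), of ?c] x v by auto
        have "fchain (insert ?c Y) \<and> D Y (insert ?c Y) \<in> W" if Y: "Y \<in> link {x} ?T" for Y
        proof -
          have YP: "Y \<in> link {} P" using Y link_subset_link_empty[of "{x}" P ?T] x TP by blast
          have xY: "x \<in> Y" using Y by (auto simp: link_def)
          \<comment> \<open>A comparable y from \<open>T1\<close> contains v, hence contains x and
            the apex. One from S is not larger than x in size, so it lies inside x.\<close>
          have "?c \<subseteq> y \<or> y \<subseteq> ?c" if y: "y \<in> Y" for y
          proof -
            have xy: "x \<subseteq> y \<or> y \<subseteq> x" "y = x \<or> y \<in> T1 \<or> y \<in> S"
              using Y y xY by (auto simp: link_def fchain_def)
            have "\<not> x \<subset> y" if "y \<in> S"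
              using insert.hyps(2)[OF that] psubset_card_mono[of y x] P(3)[of y] that insert.prems by auto
            then show ?thesis using xy x by (auto simp: T1_def)
          qed
          then have ch: "fchain (insert ?c Y)" using Y by (auto simp: fchain_insert link_def)
          then show ?thesis using ins[OF YP _ ch xY lc] cT T1 by blast
        qed
        moreover have "D {x} {?c, x} \<in> W"
          using ins[OF sing[OF x(1)] _ _ _ lc] cT T1 by (auto simp: fchain_def)
        ultimately have lm: "lmap D (link {} (insert x ?T)) (link {} ?T) \<in> W"
          using x xS cT by (intro add_cone_W[OF TP x(1), of ?c]) (auto simp: T1_def)
        have cl: "{c} \<in> link {} ?T" using c T1(2) by (auto simp: link_def fchain_def)
        have xT: "insert x ?T \<subseteq> P" using x TP by simp
        show ?thesis using lproj_lmap_W[OF empty_subsetI subset_insertI xT cl IH lm] by simp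
      qed
    qed
  qed
  have "T1 \<union> {X\<in>P. v \<notin> X} = P" by (auto simp: T1_def)
  then have base: "lproj D (link {} P) {c} \<in> W" using stage3[OF order_refl] by simp
  have h: "has_lim D (link {} P)" using has_lim_link by simp
  have zig: "lproj D (link {} P) A \<in> W \<longleftrightarrow> lproj D (link {} P) B \<in> W"
    if "A \<in> link {} P" "B \<in> link {} P" "A \<subseteq> B" "clab l A = clab l B" for A B
    using lproj_comp[OF h that(1-3)] relW[OF that]
      comp_W[OF _ relW[OF that] lproj_hom[OF h that(1)] diagram_hom[OF diag that(1-3)]]
      W_cancel_left[OF _ relW[OF that] lproj_hom[OF h that(1)] diagram_hom[OF diag that(1-3)]]
    by auto
  \<comment> \<open>Two nested simplices of equal label are compared as one-element chains through
    the two-element chain they form.\<close>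
  have zig1: "lproj D (link {} P) {X} \<in> W \<longleftrightarrow> lproj D (link {} P) {Y} \<in> W"
    if XY: "X \<in> P" "Y \<in> P" "X \<subseteq> Y" "lab l X = lab l Y" for X Y
  proof -
    have "{X, Y} \<in> link {} P" using XY by (auto simp: link_def fchain_def)
    moreover have "clab l {X, Y} = lab l X" "clab l {X, Y} = lab l Y" using XY by (simp_all add: clab_def)
    ultimately show ?thesis using zig[of "{X}" "{X, Y}"] zig[of "{Y}" "{X, Y}"] sing XY by auto
  qed
  have cP: "c \<in> P" and labc: "lab l c = lab l \<sigma>" using c T0 lab_remove[OF v w(2,3)] by (auto simp: c_def)
  \<comment> \<open>The zigzag from X to c: add v, delete w, then include into c. The label stays
    that of \<sigma> throughout.\<close>
  have s1: "lproj D (link {} P) {X} \<in> W" if "X \<in> T0" "lab l X = lab l \<sigma>" for X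
    using zig1[of X c] that T0 cP le_c labc base by auto
  have s2: "lproj D (link {} P) {X} \<in> W" if X: "X \<in> T1" "lab l X = lab l \<sigma>" for X
  proof (cases "w \<in> X")
    case True
    have "X - {w} \<in> T0" using X v w True by (auto simp: T0_def T1_def P_def horn_def)
    moreover have "lab l (X - {w}) = lab l X" using X lab_remove[of v X w l] w by (simp add: T1_def)
    ultimately show ?thesis 
      using s1[of "X - {w}"] zig1[of "X - {w}" X] X subsetD[OF T0] subsetD[OF T1(1)] by auto
  qed (use X s1 in \<open>auto simp: T0_def T1_def\<close>)
  have s3: "lproj D (link {} P) {X} \<in> W" if X: "X \<in> P" "lab l X = lab l \<sigma>" for X
  proof (cases "v \<in> X")
    case False
    have i: "insert v X \<in> T1" using False X v by (auto simp: T1_def P_def horn_def)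
    \<comment> \<open>Squeezed: adding v cannot raise the label, and no face of \<sigma> has a label
      below that of \<sigma>.\<close>
    moreover have "lab l (insert v X) = lab l X"

      using anti[of X "insert v X"] anti[of "insert v X" \<sigma>] subsetD[OF T1(1) i] X P(2)[OF X(1)] v by auto
    ultimately show ?thesis
      using s2[of "insert v X"] zig1[of X "insert v X"] X subsetD[OF T1(1) i] by auto
  qed (use X s2 in \<open>auto simp: T1_def\<close>)
  fix A assume "A \<in> link {} (horn \<sigma> v)" and lA: "clab l A = lab l \<sigma>"
  then have A: "A \<in> link {} P" by (simp add: P_def)
  then obtain X where X: "X \<in> A" "X \<in> P" by (auto simp: link_def)
  \<comment> \<open>Any member X will do: its label lies between that of \<sigma> and the maximum
    \<open>clab l A\<close>, which are equal.\<close>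
  have "lab l X \<le> clab l A" using A X by (intro lab_le_clab) (auto simp: link_def fchain_def)
  moreover have "lab l \<sigma> \<le> lab l X" using anti[OF X(2) P(2)[OF X(2)] order_refl] .
  ultimately have "lab l X = lab l \<sigma>" using lA by simp
  then show "lproj D (link {} (horn \<sigma> v)) A \<in> W"
    using zig[OF sing[OF X(2)] A] s3[OF X(2)] X lA by (simp add: P_def)
qed

end

section \<open>Extension along matched simplices\<close>

definition down_closed :: "'a set set \<Rightarrow> bool" where
  "down_closed K \<longleftrightarrow> {} \<notin> K \<and> (\<forall>X\<in>K. \<forall>Y. Y \<subseteq> X \<longrightarrow> Y \<noteq> {} \<longrightarrow> Y \<in> K)"

lemma down_closedD: "down_closed K \<Longrightarrow> X \<in> K \<Longrightarrow> Y \<subseteq> X \<Longrightarrow> Y \<noteq> {} \<Longrightarrow> Y \<in> K"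
  unfolding down_closed_def by blast

context fibration_cat begin

lemma rel_diagram_extend_horn:
  assumes K: "down_closed K" and fin: "finite \<sigma>" and v: "v \<in> \<sigma>" and w: "w \<in> \<sigma>" "v \<noteq> w" "l v = l w"
    and hornK: "horn \<sigma> v \<subseteq> K" and nK: "\<sigma> \<notin> K" "\<sigma> - {v} \<notin> K"
    and rel: "rel_diagram l D (link {} K)"
  shows "\<exists>E. rel_diagram l E (link {} (K \<union> {\<sigma>, \<sigma> - {v}})) \<and>
    (\<forall>A\<in>link {} K. \<forall>B\<in>link {} K. A \<subseteq> B \<longrightarrow> E A B = D A B)"
proof -
  define P where "P = horn \<sigma> v"
  define \<tau> where "\<tau> = \<sigma> - {v}"
  let ?K = "K \<union> {\<sigma>, \<tau>}"
  have DK: "diagram D (link {} K)" using rel by (simp add: rel_diagram_def)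
  have PK: "link {} P \<subseteq> link {} K" using hornK by (intro link_mono) (simp add: P_def)
  have "finite P" by (rule finite_subset[of _ "Pow \<sigma>"]) (use fin in \<open>auto simp: P_def horn_def\<close>)
  then have finl: "finite (link {} P)" by (simp add: finite_link)
  obtain D' \<eta> where *: "diagram D' (link {} P) \<and> reedy D' (link {} P) \<and>
      (\<forall>x\<in>link {} P. \<eta> x \<in> W \<and> \<eta> x \<in> hom C (ob D x) (ob D' x)) \<and>
      (\<forall>x\<in>link {} P. \<forall>y\<in>link {} P. x \<le> y \<longrightarrow> D' x y \<cdot> \<eta> x = \<eta> y \<cdot> D x y)"
    using reedy_replacement[OF finl diagram_subset[OF DK PK]] by (elim exE) (rule that)
  then have D': "diagram D' (link {} P)" and reedy: "reedy D' (link {} P)"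
    and \<eta>: "\<And>x. x \<in> link {} P \<Longrightarrow> \<eta> x \<in> W" "\<And>x. x \<in> link {} P \<Longrightarrow> \<eta> x \<in> hom C (ob D x) (ob D' x)"
      "\<And>x y. x \<in> link {} P \<Longrightarrow> y \<in> link {} P \<Longrightarrow> x \<subseteq> y \<Longrightarrow> D' x y \<cdot> \<eta> x = \<eta> y \<cdot> D x y"
    by simp_all
  have relD: "D A B \<in> W" if "A \<in> link {} K" "B \<in> link {} K" "A \<subseteq> B" "clab l A = clab l B" for A B
    using rel that by (simp add: rel_diagram_def)
  \<comment> \<open>Relativity passes from D to D' along the naturality square of \<eta>, by
    two-out-of-three.\<close>
  have relD': "D' A B \<in> W" if AB: "A \<in> link {} P" "B \<in> link {} P" "A \<subseteq> B" "clab l A = clab l B" for A B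
  proof -
    note K2 = subsetD[OF PK AB(1)] subsetD[OF PK AB(2)]
    have "D' A B \<cdot> \<eta> A \<in> W"
      using comp_W[OF relD[OF K2 AB(3,4)] \<eta>(1)[OF AB(2)] diagram_hom[OF DK K2 AB(3)] \<eta>(2)[OF AB(2)]] \<eta>(3)[OF AB(1-3)]
      by simp
    then show ?thesis by (rule W_cancel_right[OF _ \<eta>(1)[OF AB(1)] \<eta>(2)[OF AB(1)] diagram_hom[OF D' AB(1-3)]])
  qed
  have rel': "rel_diagram l D' (link {} (horn \<sigma> v))"
    using D' relD' by (simp add: rel_diagram_def P_def)
  note H = horn_lproj_W[OF fin v w rel' reedy[unfolded P_def], folded P_def]
  define L where "L = lobj D' (link {} P)"
  define \<pi> where "\<pi> = lproj D' (link {} P)"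
  have L: "L \<in> c_obj C" using lim_obj[OF H(1)] by (simp add: L_def)
  have \<pi>: "\<pi> A \<in> hom C L (ob D' A)" if "A \<in> link {} P" for A
    using lproj_hom[OF H(1) that] by (simp add: \<pi>_def L_def)
  have \<pi>c: "D' A B \<cdot> \<pi> A = \<pi> B" if "A \<in> link {} P" "B \<in> link {} P" "A \<subseteq> B" for A B
    using lproj_comp[OF H(1) that] by (simp add: \<pi>_def)

  have \<tau>: "\<tau> \<noteq> {}" "\<sigma> \<noteq> {}" using w by (auto simp: \<tau>_def)
  have lab\<tau>: "lab l \<tau> = lab l \<sigma>" using lab_remove[of w \<sigma> v l] w by (auto simp: \<tau>_def)
  \<comment> \<open>An old simplex cannot contain a new one, as K is closed under faces. In a common
    chain it therefore lies below the new one, so in the horn; this is why D' is required there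
    only.\<close>
  have face: "X \<in> P" if A: "A \<in> link {} ?K" "\<not> A \<subseteq> K" and X: "X \<in> A" "X \<in> K" for A X
  proof -
    obtain S where S: "S \<in> A" "S = \<sigma> \<or> S = \<tau>" using A by (auto simp: link_def)
    have "X \<subseteq> S \<or> S \<subseteq> X" using A S X by (auto simp: link_def fchain_def)
    moreover have "\<not> S \<subseteq> X" using K X S nK \<tau> unfolding down_closed_def \<tau>_def by metis
    ultimately have "X \<subseteq> \<sigma>" using S by (auto simp: \<tau>_def)
    moreover have "X \<noteq> {}" "X \<noteq> \<sigma>" "X \<noteq> \<sigma> - {v}" using X nK K by (auto simp: down_closed_def)
    ultimately show ?thesis by (simp add: P_def horn_def)
  qed
  have tr: "A \<inter> K \<in> link {} P" if "A \<in> link {} ?K" "\<not> A \<subseteq> K" "A \<inter> K \<noteq> {}" for A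
    using that face[OF that(1,2)] fchain_subset[of A "A \<inter> K"] by (auto simp: link_def)
  have inK: "A \<in> link {} K" if "A \<in> link {} ?K" "A \<subseteq> K" for A
    using that by (auto simp: link_def)
  \<comment> \<open>Both new simplices carry the label of \<sigma>, which is minimal among its
    faces, so the maximum is attained on the old part.\<close>
  have clab2: "clab l (A \<inter> K) = clab l A" if A: "A \<in> link {} ?K" "\<not> A \<subseteq> K" "A \<inter> K \<noteq> {}" for A
  proof -
    have finA: "finite A" using A by (auto simp: link_def fchain_def)
    obtain X where X: "X \<in> A" "X \<in> K" using A(3) by blast
    have "X \<in> P" by (rule face[OF A(1,2) X])
    then have lX: "lab l \<sigma> \<le> lab l X" using lab_antimono[of X \<sigma> l] fin by (auto simp: P_def horn_def)
    have "lab l Y \<le> clab l (A \<inter> K)" if Y: "Y \<in> A" for Y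
    proof (cases "Y \<in> K")
      case True
      then show ?thesis using Y finA by (intro lab_le_clab) auto
    next
      case False
      then have "lab l Y = lab l \<sigma>" using A Y lab\<tau> by (auto simp: link_def)
      also have "\<dots> \<le> clab l (A \<inter> K)" using lX lab_le_clab[of "A \<inter> K" X l] finA X by simp
      finally show ?thesis .
    qed
    then have "clab l A \<le> clab l (A \<inter> K)" using finA X unfolding clab_def[of l A] by (subst Max_le_iff) auto
    moreover have "clab l (A \<inter> K) \<le> clab l A"
      unfolding clab_def using finA A(3) by (intro Max_mono) auto
    ultimately show ?thesis by simp
  qed
  have clab3: "clab l A = lab l \<sigma>" if A: "A \<in> link {} ?K" "A \<inter> K = {}" for A
  proof -
    have "A \<subseteq> {\<sigma>, \<tau>}" "A \<noteq> {}" using A by (auto simp: link_def)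
    moreover from this have "lab l ` A = (\<lambda>_. lab l \<sigma>) ` A" using lab\<tau> by (intro image_cong) auto
    ultimately have "lab l ` A = {lab l \<sigma>}" by (simp add: image_constant_conv)
    then show ?thesis by (simp add: clab_def)
  qed

  \<comment> \<open>For \<open>A \<subseteq> B\<close> the kind of chain can change only from old to
    mixed, through \<eta>, or from entirely new to mixed, through \<pi>. A chain meeting K stays so
    when enlarged, which is why the last branch need not inspect B.\<close>
  define E where "E A B =
    (if A \<subseteq> K then (if B \<subseteq> K then D A B else \<eta> (B \<inter> K) \<cdot> D A (B \<inter> K))
     else if A \<inter> K = {} then (if B \<inter> K = {} then c_id C L else \<pi> (B \<inter> K))
     else D' (A \<inter> K) (B \<inter> K))" for A B
  have E11: "E A B = D A B" if "A \<subseteq> K" "B \<subseteq> K" for A B using that by (simp add: E_def)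
  have E12: "E A B = \<eta> (B \<inter> K) \<cdot> D A (B \<inter> K)" if "A \<subseteq> K" "\<not> B \<subseteq> K" for A B using that by (simp add: E_def)
  have E22: "E A B = D' (A \<inter> K) (B \<inter> K)" if "\<not> A \<subseteq> K" "A \<inter> K \<noteq> {}" for A B using that by (simp add: E_def)
  have E32: "E A B = \<pi> (B \<inter> K)" if "\<not> A \<subseteq> K" "A \<inter> K = {}" "B \<inter> K \<noteq> {}" for A B using that by (simp add: E_def)
  have E33: "E A B = c_id C L" if "\<not> A \<subseteq> K" "A \<inter> K = {}" "B \<inter> K = {}" for A B using that by (simp add: E_def)
  have ob1: "ob E A = ob D A" if "A \<subseteq> K" for A using E11[OF that that] by (simp add: ob_def)
  have ob2: "ob E A = ob D' (A \<inter> K)" if "\<not> A \<subseteq> K" "A \<inter> K \<noteq> {}" for A using E22[OF that] by (simp add: ob_def)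
  have ob3: "ob E A = L" if "\<not> A \<subseteq> K" "A \<inter> K = {}" for A using E33[OF that that(2)] L by (simp add: ob_def)
  have ne: "A \<inter> K \<noteq> {}" if "A \<in> link {} ?K" "A \<subseteq> K" for A using that by (auto simp: link_def)
  have hom12: "D A (B \<inter> K) \<in> hom C (ob D A) (ob D (B \<inter> K))" "\<eta> (B \<inter> K) \<in> hom C (ob D (B \<inter> K)) (ob D' (B \<inter> K))"
    "B \<inter> K \<in> link {} P" "B \<inter> K \<noteq> {}"
    if "A \<in> link {} ?K" "B \<in> link {} ?K" "A \<subseteq> B" "A \<subseteq> K" "\<not> B \<subseteq> K" for A B
  proof -
    show n: "B \<inter> K \<noteq> {}" using ne[OF that(1,4)] that(3) by blast
    show BP: "B \<inter> K \<in> link {} P" by (rule tr[OF that(2,5) n])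
    show "\<eta> (B \<inter> K) \<in> hom C (ob D (B \<inter> K)) (ob D' (B \<inter> K))" by (rule \<eta>(2)[OF BP])
    show "D A (B \<inter> K) \<in> hom C (ob D A) (ob D (B \<inter> K))"
      by (rule diagram_hom[OF DK inK[OF that(1,4)] subsetD[OF PK BP]]) (use that in auto)
  qed
  have "diagram E (link {} ?K)"
    unfolding diagram_def
  proof (intro conjI ballI impI)
    fix A assume A: "A \<in> link {} ?K"
    consider "A \<subseteq> K" | "\<not> A \<subseteq> K" "A \<inter> K \<noteq> {}" | "\<not> A \<subseteq> K" "A \<inter> K = {}" by blast
    then show "E A A = c_id C (ob E A)"
    proof cases
      case 1
      then show ?thesis using E11[OF 1 1] ob1[OF 1] diagram_id[OF DK inK[OF A 1]] by simp
    next
      case 2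
      then show ?thesis using E22[OF 2] ob2[OF 2] diagram_id[OF D' tr[OF A 2]] by simp
    next
      case 3
      then show ?thesis using E33[OF 3 3(2)] ob3[OF 3] by simp
    qed
  next
    fix A B assume AB: "A \<in> link {} ?K" "B \<in> link {} ?K" "A \<subseteq> B"
    consider "A \<subseteq> K" "B \<subseteq> K" | "A \<subseteq> K" "\<not> B \<subseteq> K"
      | "\<not> A \<subseteq> K" "A \<inter> K \<noteq> {}" "\<not> B \<subseteq> K" "B \<inter> K \<noteq> {}"
      | "\<not> A \<subseteq> K" "A \<inter> K = {}" "\<not> B \<subseteq> K" "B \<inter> K \<noteq> {}"
      | "\<not> A \<subseteq> K" "A \<inter> K = {}" "\<not> B \<subseteq> K" "B \<inter> K = {}" using AB(3) by blast
    then show "E A B \<in> hom C (ob E A) (ob E B)"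
    proof cases
      case 1
      then show ?thesis
        using E11[OF 1] ob1[OF 1(1)] ob1[OF 1(2)] diagram_hom[OF DK inK[OF AB(1) 1(1)] inK[OF AB(2) 1(2)] AB(3)]
        by simp
    next
      case 2
      note h = hom12[OF AB 2]
      show ?thesis using comp_hom[OF h(1,2)] E12[OF 2] ob1[OF 2(1)] ob2[OF 2(2) h(4)] by simp
    next
      case 3
      have "A \<inter> K \<subseteq> B \<inter> K" using AB(3) by blast
      then show ?thesis
        using diagram_hom[OF D' tr[OF AB(1) 3(1,2)] tr[OF AB(2) 3(3,4)]] E22[OF 3(1,2)]
          ob2[OF 3(1,2)] ob2[OF 3(3,4)] by simp
    next
      case 4
      show ?thesis
        using \<pi>[OF tr[OF AB(2) 4(3,4)]] E32[OF 4(1,2,4)] ob3[OF 4(1,2)] ob2[OF 4(3,4)] by simp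
    next
      case 5
      show ?thesis using id_hom[OF L] E33[OF 5(1,2,4)] ob3[OF 5(1,2)] ob3[OF 5(3,4)] by simp
    qed
  next
    fix A B B' assume AB: "A \<in> link {} ?K" "B \<in> link {} ?K" "B' \<in> link {} ?K" "A \<subseteq> B \<and> B \<subseteq> B'"
    have int: "A \<inter> K \<subseteq> B \<inter> K" "B \<inter> K \<subseteq> B' \<inter> K" using AB(4) by auto
    have m: "B \<subseteq> K \<longrightarrow> A \<subseteq> K" "B' \<subseteq> K \<longrightarrow> B \<subseteq> K"
        "B \<inter> K = {} \<longrightarrow> A \<inter> K = {}" "B' \<inter> K = {} \<longrightarrow> B \<inter> K = {}" using AB(4) by auto
    consider "A \<subseteq> K" "B \<subseteq> K" "B' \<subseteq> K" | "A \<subseteq> K" "B \<subseteq> K" "\<not> B' \<subseteq> K"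
      | "A \<subseteq> K" "\<not> B \<subseteq> K" "\<not> B' \<subseteq> K"
      | "\<not> A \<subseteq> K" "\<not> B \<subseteq> K" "\<not> B' \<subseteq> K" "A \<inter> K \<noteq> {}" "B \<inter> K \<noteq> {}" "B' \<inter> K \<noteq> {}"
      | "\<not> A \<subseteq> K" "\<not> B \<subseteq> K" "\<not> B' \<subseteq> K" "A \<inter> K = {}" "B \<inter> K \<noteq> {}" "B' \<inter> K \<noteq> {}"
      | "\<not> A \<subseteq> K" "\<not> B \<subseteq> K" "\<not> B' \<subseteq> K" "A \<inter> K = {}" "B \<inter> K = {}" "B' \<inter> K \<noteq> {}"
      | "\<not> A \<subseteq> K" "\<not> B \<subseteq> K" "\<not> B' \<subseteq> K" "A \<inter> K = {}" "B \<inter> K = {}" "B' \<inter> K = {}"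
      using m by argo
    then show "E B B' \<cdot> E A B = E A B'"
    proof cases
      case 1
      show ?thesis
        using E11[OF 1(1,2)] E11[OF 1(2,3)] E11[OF 1(1,3)]
          diagram_comp[OF DK inK[OF AB(1) 1(1)] inK[OF AB(2) 1(2)] inK[OF AB(3) 1(3)]] AB(4) by simp
    next
      case 2
      have BB: "B \<subseteq> B' \<inter> K" "A \<subseteq> B" using 2 AB by auto
      note h = hom12[OF AB(2,3) _ 2(2,3)]
      show ?thesis
        using comp_assoc[OF diagram_hom[OF DK inK[OF AB(1) 2(1)] inK[OF AB(2) 2(2)]] h(1,2)] BB AB(4)
          diagram_comp[OF DK inK[OF AB(1) 2(1)] inK[OF AB(2) 2(2)] subsetD[OF PK h(3)]]
          E11[OF 2(1,2)] E12[OF 2(2,3)] E12[OF 2(1,3)] by simp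
    next
      case 3
      have ABs: "A \<subseteq> B" "A \<subseteq> B'" "A \<subseteq> B \<inter> K" using 3 AB by auto
      note h = hom12[OF AB(1,2) ABs(1) 3(1,2)] and h' = hom12[OF AB(1,3) ABs(2) 3(1,3)]
      note hK = subsetD[OF PK h(3)] subsetD[OF PK h'(3)]
      have "E B B' \<cdot> E A B = D' (B \<inter> K) (B' \<inter> K) \<cdot> \<eta> (B \<inter> K) \<cdot> D A (B \<inter> K)"
        using comp_assoc[OF h(1,2) diagram_hom[OF D' h(3) h'(3) int(2)]] E22[OF 3(2) h(4)] E12[OF 3(1,2)] by simp
      also have "\<dots> = \<eta> (B' \<inter> K) \<cdot> D (B \<inter> K) (B' \<inter> K) \<cdot> D A (B \<inter> K)"
        using \<eta>(3)[OF h(3) h'(3) int(2)] by simp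
      also have "\<dots> = \<eta> (B' \<inter> K) \<cdot> D A (B' \<inter> K)"
        using comp_assoc[OF h(1) diagram_hom[OF DK hK int(2)] h'(2)]
          diagram_comp[OF DK inK[OF AB(1) 3(1)] hK ABs(3) int(2)] by simp
      finally show ?thesis using E12[OF 3(1,3)] by simp
    next
      case 4
      show ?thesis
        using diagram_comp[OF D' tr[OF AB(1) 4(1,4)] tr[OF AB(2) 4(2,5)] tr[OF AB(3) 4(3,6)] int]
          E22[OF 4(1,4)] E22[OF 4(2,5)] by simp
    next
      case 5
      show ?thesis
        using \<pi>c[OF tr[OF AB(2) 5(2,5)] tr[OF AB(3) 5(3,6)] int(2)]
          E22[OF 5(2,5)] E32[OF 5(1,4,5)] E32[OF 5(1,4,6)] by simp
    next
      case 6
      show ?thesis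
        using id_right[OF \<pi>[OF tr[OF AB(3) 6(3,6)]]] E33[OF 6(1,4,5)] E32[OF 6(2,5,6)] E32[OF 6(1,4,6)] by simp
    next
      case 7
      show ?thesis
        using id_right[OF id_hom[OF L]] E33[OF 7(1,4,5)] E33[OF 7(2,5,6)] E33[OF 7(1,4,6)] by simp
    qed
  qed
  moreover have "E A B \<in> W"
    if AB: "A \<in> link {} ?K" "B \<in> link {} ?K" "A \<subseteq> B" "clab l A = clab l B" for A B
  proof -
    consider "A \<subseteq> K" "B \<subseteq> K" | "A \<subseteq> K" "\<not> B \<subseteq> K"
      | "\<not> A \<subseteq> K" "A \<inter> K \<noteq> {}" "\<not> B \<subseteq> K" "B \<inter> K \<noteq> {}"
      | "\<not> A \<subseteq> K" "A \<inter> K = {}" "\<not> B \<subseteq> K" "B \<inter> K \<noteq> {}"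
      | "\<not> A \<subseteq> K" "A \<inter> K = {}" "\<not> B \<subseteq> K" "B \<inter> K = {}" using AB(3) by blast
    then show ?thesis
    proof cases
      case 1
      show ?thesis using E11[OF 1] relD[OF inK[OF AB(1) 1(1)] inK[OF AB(2) 1(2)] AB(3,4)] by simp
    next
      case 2
      note h = hom12[OF AB(1-3) 2]
      have "D A (B \<inter> K) \<in> W"
        by (rule relD[OF inK[OF AB(1) 2(1)] subsetD[OF PK h(3)]])
          (use 2 AB clab2[OF AB(2) 2(2) h(4)] in auto)
      then show ?thesis using comp_W[OF _ \<eta>(1)[OF h(3)] h(1,2)] E12[OF 2] by simp
    next
      case 3
      have "A \<inter> K \<subseteq> B \<inter> K" using AB(3) by blast
      then show ?thesis
        using relD'[OF tr[OF AB(1) 3(1,2)] tr[OF AB(2) 3(3,4)]] E22[OF 3(1,2)]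
          clab2[OF AB(1) 3(1,2)] clab2[OF AB(2) 3(3,4)] AB(4) by simp
    next
      case 4
      \<comment> \<open>The decisive case: an entirely new chain has the label of \<sigma>, so B and
        its old part have it as well, and the projection of the limit at that part is a weak
        equivalence.\<close>
      show ?thesis
        using H(2)[OF tr[OF AB(2) 4(3,4)]] clab3[OF AB(1) 4(2)] clab2[OF AB(2) 4(3,4)] AB(4) E32[OF 4(1,2,4)]
        by (simp add: \<pi>_def)
    next
      case 5
      show ?thesis using W_id[OF L] E33[OF 5(1,2,4)] by simp
    qed
  qed
  ultimately have "rel_diagram l E (link {} ?K)" by (simp add: rel_diagram_def)
  moreover have "E A B = D A B" if "A \<in> link {} K" "B \<in> link {} K" for A B
    using that E11 by (auto simp: link_def)
  ultimately show ?thesis unfolding \<tau>_def by blast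
qed

text \<open>An acyclic matching: \<open>v c\<close> is the vertex toggled at c, and r is constant on
  pairs but drops when passing from the upper simplex to another missing facet. A pair of minimal
  rank therefore has its whole horn present and can be attached.\<close>

lemma rel_diagram_extend_matching:
  assumes K1: "down_closed K1" and fin: "finite K1" and fin': "\<And>X. X \<in> K1 \<Longrightarrow> finite X"
    and K: "down_closed K" "K \<subseteq> K1"
    and closed: "\<And>c. c \<in> K1 - K \<Longrightarrow> insert (v c) c \<in> K1 - K \<and> c - {v c} \<in> K1 - K"
    and v_toggle: "\<And>c. c \<in> K1 - K \<Longrightarrow> v (insert (v c) c) = v c \<and> v (c - {v c}) = v c"
    and r_toggle: "\<And>c. c \<in> K1 - K \<Longrightarrow> r (insert (v c) c) = (r c :: nat)"
    and w: "\<And>c. c \<in> K1 - K \<Longrightarrow> w c \<in> c \<and> w c \<noteq> v c \<and> l (w c) = l (v c)"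
    and rank: "\<And>c y. c \<in> K1 - K \<Longrightarrow> v c \<in> c \<Longrightarrow> y \<in> c \<Longrightarrow> y \<noteq> v c \<Longrightarrow> c - {y} \<in> K1 - K \<Longrightarrow> r (c - {y}) < r c"
    and rel: "rel_diagram l D (link {} K)"
  shows "\<exists>E. rel_diagram l E (link {} K1) \<and>
    (\<forall>A\<in>link {} K. \<forall>B\<in>link {} K. A \<subseteq> B \<longrightarrow> E A B = D A B)"
  using K closed v_toggle r_toggle w rank rel
proof (induction "card (K1 - K)" arbitrary: K D rule: less_induct)
  case less
  show ?case
  proof (cases "K1 - K = {}")
    case True
    then have "K = K1" using less.prems by auto
    then show ?thesis using less.prems by blast
  next
    case False
    then obtain c where c: "c \<in> K1 - K" "\<And>d. d \<in> K1 - K \<Longrightarrow> r c \<le> r d"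
      using ex_has_least_nat[of "\<lambda>c. c \<in> K1 - K" _ r] by blast
    define \<sigma> where "\<sigma> = insert (v c) c"
    define \<tau> where "\<tau> = \<sigma> - {v \<sigma>}"
    have \<sigma>: "\<sigma> \<in> K1 - K" "v \<sigma> \<in> \<sigma>" "v \<sigma> = v c" "r \<sigma> = r c"
      using less.prems(3)[OF c(1)] less.prems(4)[OF c(1)] less.prems(5)[OF c(1)] by (auto simp: \<sigma>_def)
    have \<tau>: "\<tau> \<in> K1 - K" "v \<tau> = v \<sigma>" using less.prems(3)[OF \<sigma>(1)] less.prems(4)[OF \<sigma>(1)] by (auto simp: \<tau>_def)
    note w\<sigma> = less.prems(6)[OF \<sigma>(1)]
    have fin\<sigma>: "finite \<sigma>" using fin' \<sigma> by auto
    \<comment> \<open>A facet still missing would have smaller rank than c, against its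
      minimality.\<close>
    have face: "\<sigma> - {y} \<in> K" if "y \<in> \<sigma>" "y \<noteq> v \<sigma>" for y
    proof (rule ccontr)
      assume n: "\<sigma> - {y} \<notin> K"
      have "\<sigma> - {y} \<noteq> {}" using \<sigma>(2) that by auto
      then have "\<sigma> - {y} \<in> K1 - K" using down_closedD[OF K1, of \<sigma> "\<sigma> - {y}"] \<sigma>(1) n by blast
      then show False using less.prems(7)[OF \<sigma>(1,2) that] c(2) \<sigma>(4) by force
    qed
    have horn: "horn \<sigma> (v \<sigma>) \<subseteq> K"
    proof
      fix X assume X: "X \<in> horn \<sigma> (v \<sigma>)"
      then obtain y where "y \<in> \<sigma>" "y \<noteq> v \<sigma>" "X \<subseteq> \<sigma> - {y}" by (auto simp: horn_def)
      then show "X \<in> K" using face[of y] less.prems(1) X by (auto simp: down_closed_def horn_def)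
    qed
    obtain E where E: "rel_diagram l E (link {} (K \<union> {\<sigma>, \<tau>}))"
      "\<forall>A\<in>link {} K. \<forall>B\<in>link {} K. A \<subseteq> B \<longrightarrow> E A B = D A B"
      using rel_diagram_extend_horn[OF less.prems(1) fin\<sigma> \<sigma>(2) _ _ _ horn _ _ less.prems(8), of "w \<sigma>"]
        w\<sigma> \<sigma>(1) \<tau>(1) by (auto simp: \<tau>_def)
    let ?K = "K \<union> {\<sigma>, \<tau>}"
    have sub: "K1 - ?K \<subseteq> K1 - K" by auto
    have "\<exists>E'. rel_diagram l E' (link {} K1) \<and> (\<forall>A\<in>link {} ?K. \<forall>B\<in>link {} ?K. A \<subseteq> B \<longrightarrow> E' A B = E A B)"
    proof (rule less.hyps[OF _ _ _ _ _ _ _ _ E(1)])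
      have "K1 - ?K \<subset> K1 - K" using \<sigma>(1) by auto
      then show "card (K1 - ?K) < card (K1 - K)" using fin by (intro psubset_card_mono) auto
      show "down_closed ?K"
      proof -
        have "Y \<in> ?K" if "X \<in> {\<sigma>, \<tau>}" "Y \<subseteq> X" "Y \<noteq> {}" for X Y
          using that horn by (auto simp: horn_def \<tau>_def subset_iff)
        moreover have "{} \<notin> ?K" using less.prems(1) K1 \<sigma>(1) \<tau>(1) by (auto simp: down_closed_def)
        ultimately show ?thesis using less.prems(1) unfolding down_closed_def by blast
      qed
      show "?K \<subseteq> K1" using less.prems(2) \<sigma>(1) \<tau>(1) by auto
      fix d assume d: "d \<in> K1 - ?K"
      then have dK: "d \<in> K1 - K" by auto
      note td = less.prems(3)[OF dK] and vd = less.prems(4)[OF dK]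
      \<comment> \<open>What remains must still be matched within itself. Since v is constant on
        pairs, a d whose partner is \<sigma> or \<tau> would itself be one of the two.\<close>
      have "insert (v d) d \<noteq> \<sigma>" "d - {v d} \<noteq> \<tau>" "insert (v d) d \<noteq> \<tau>" "d - {v d} \<noteq> \<sigma>"
      proof -
        show "insert (v d) d \<noteq> \<sigma>"
        proof
          assume e: "insert (v d) d = \<sigma>"
          then have "v d = v \<sigma>" using vd by simp
          then have "d = \<sigma> \<or> d = \<tau>" using e by (cases "v d \<in> d") (auto simp: \<tau>_def insert_absorb)
          then show False using d by auto
        qed
        show "d - {v d} \<noteq> \<tau>"
        proof
          assume e: "d - {v d} = \<tau>"
          then have "v d = v \<sigma>" using vd \<tau>(2) by simp
          then show False using d e \<sigma>(2) by (auto simp: \<tau>_def)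
        qed
        show "insert (v d) d \<noteq> \<tau>"
        proof
          assume e: "insert (v d) d = \<tau>"
          then have "v d = v \<sigma>" using vd \<tau>(2) by simp
          then show False using e by (auto simp: \<tau>_def)
        qed
        show "d - {v d} \<noteq> \<sigma>"
        proof
          assume e: "d - {v d} = \<sigma>"
          then have "v d = v \<sigma>" using vd by simp
          then show False using e \<sigma>(2) by auto
        qed
      qed
      then show "insert (v d) d \<in> K1 - ?K \<and> d - {v d} \<in> K1 - ?K" using td by auto
    next
      fix d assume "d \<in> K1 - ?K"
      then have d: "d \<in> K1 - K" by auto
      show "v (insert (v d) d) = v d \<and> v (d - {v d}) = v d" by (rule less.prems(4)[OF d])
      show "r (insert (v d) d) = r d" by (rule less.prems(5)[OF d])
      show "w d \<in> d \<and> w d \<noteq> v d \<and> l (w d) = l (v d)" by (rule less.prems(6)[OF d])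
      fix y assume "v d \<in> d" "y \<in> d" "y \<noteq> v d" "d - {y} \<in> K1 - ?K"
      then show "r (d - {y}) < r d" using less.prems(7)[OF d] by auto
    qed
    then obtain E' where E': "rel_diagram l E' (link {} K1)"
      "\<forall>A\<in>link {} ?K. \<forall>B\<in>link {} ?K. A \<subseteq> B \<longrightarrow> E' A B = E A B" by blast
    have "link {} K \<subseteq> link {} ?K" by (rule link_mono) auto
    then have "\<forall>A\<in>link {} K. \<forall>B\<in>link {} K. A \<subseteq> B \<longrightarrow> E' A B = D A B"
      using E(2) E'(2) by (simp add: subset_iff)
    then show ?thesis using E'(1) by blast
  qed
qed

end

section \<open>Transport to grids\<close>

lemma sorted_wrt_psubset_unique:
  "sorted_wrt (\<subset>) xs \<Longrightarrow> sorted_wrt (\<subset>) ys \<Longrightarrow> set xs = set ys \<Longrightarrow> xs = ys"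
proof (induction xs arbitrary: ys)
  case (Cons x xs)
  obtain y ys' where ys: "ys = y # ys'" using Cons.prems(3) by (cases ys) auto
  have x: "\<And>z. z \<in> set xs \<Longrightarrow> x \<subset> z" "sorted_wrt (\<subset>) xs" using Cons.prems(1) by simp_all
  have y: "\<And>z. z \<in> set ys' \<Longrightarrow> y \<subset> z" "sorted_wrt (\<subset>) ys'" using Cons.prems(2) ys by simp_all
  have eq: "insert x (set xs) = insert y (set ys')" using Cons.prems(3) ys by simp
  have "x = y \<or> y \<subset> x" "x = y \<or> x \<subset> y" using eq x(1)[of y] y(1)[of x] by blast+
  then have xy: "x = y" by (auto dest: psubset_trans)
  moreover have "x \<notin> set xs" "x \<notin> set ys'" using x(1)[of x] y(1)[of x] xy by auto
  ultimately have "set xs = set ys'" using eq by (simp add: insert_ident)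
  then show ?case using Cons.IH[OF x(2) y(2)] ys xy by simp
qed simp

lemma sorted_wrt_psubset_distinct: "sorted_wrt (\<subset>) xs \<Longrightarrow> distinct xs"
  by (induction xs) auto

lemma fchain_greatest:
  assumes "fchain A" "A \<noteq> {}"
  obtains M where "M \<in> A" "\<And>X. X \<in> A \<Longrightarrow> X \<le> M"
proof -
  obtain M where M: "M \<in> A" "\<And>X. X \<in> A \<Longrightarrow> M \<le> X \<Longrightarrow> M = X"
    using finite_has_maximal[of A] assms by (auto simp: fchain_def)
  then have "X \<le> M" if "X \<in> A" for X using assms that by (auto simp: fchain_def)
  then show ?thesis using that M by blast
qed

text \<open>A strictly increasing list is determined by its set of members, so objects of the
  subdivision may be handled as sets; \<open>xi_le\<close> then becomes inclusion.\<close>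

definition lst :: "'a set set \<Rightarrow> 'a set list" where
  "lst A = (THE As. sorted_wrt (\<subset>) As \<and> set As = A)"

lemma lst_eqI: "sorted_wrt (\<subset>) As \<Longrightarrow> set As = A \<Longrightarrow> lst A = As"
  unfolding lst_def using sorted_wrt_psubset_unique by (intro the_equality) auto

lemma fchain_sorted: "fchain (A :: 'a set set) \<Longrightarrow> \<exists>As. sorted_wrt (\<subset>) As \<and> set As = A"
proof (induction "card A" arbitrary: A)
  case 0
  then show ?case by (intro exI[of _ "[]"]) (auto simp: fchain_def)
next
  case (Suc n)
  then have "A \<noteq> {}" by auto
  then obtain M where M: "M \<in> A" "\<And>X. X \<in> A \<Longrightarrow> X \<le> M" using fchain_greatest Suc.prems by metis
  have "fchain (A - {M})" using Suc.prems fchain_subset by blast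
  moreover have "n = card (A - {M})" using Suc M by (auto simp: fchain_def)
  ultimately obtain As where As: "sorted_wrt (\<subset>) As" "set As = A - {M}" using Suc.hyps(1) by blast
  have "sorted_wrt (\<subset>) (As @ [M])" using As M by (auto simp: sorted_wrt_append)
  then show ?case using As M by (intro exI[of _ "As @ [M]"]) auto
qed

lemma
  assumes "fchain A"
  shows sorted_lst: "sorted_wrt (\<subset>) (lst A)" and set_lst: "set (lst A) = A"
  using fchain_sorted[OF assms] lst_eqI by metis+

lemma fchain_set: "sorted_wrt (\<subset>) As \<Longrightarrow> fchain (set As)"
  by (induction As) (auto simp: fchain_def)

text \<open>The non-degenerate simplices of \<Delta>[m] \<times> \<Delta>[n], given by their sets of
  vertices.\<close>

definition gch :: "nat \<Rightarrow> nat \<Rightarrow> (nat \<times> nat) set set" where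
  "gch m n = {X. X \<noteq> {} \<and> finite X \<and> X \<subseteq> grid m n \<and> (\<forall>x\<in>X. \<forall>y\<in>X. grid_le x y \<or> grid_le y x)}"

abbreviation gchains :: "nat \<Rightarrow> nat \<Rightarrow> (nat \<times> nat) set set set" where
  "gchains m n \<equiv> link {} (gch m n)"

abbreviation xob :: "nat \<Rightarrow> nat \<Rightarrow> (nat \<times> nat) set list set" where
  "xob m n \<equiv> xi_obj (grid m n) grid_le"

lemma xob_iff: "As \<in> xob m n \<longleftrightarrow> As \<noteq> [] \<and> set As \<subseteq> gch m n \<and> sorted_wrt (\<subset>) As"
  by (auto simp: xi_obj_def gch_def)

lemma set_xob: "As \<in> xob m n \<Longrightarrow> set As \<in> gchains m n"
  using fchain_set by (auto simp: xob_iff link_def)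

lemma lst_xob: "A \<in> gchains m n \<Longrightarrow> lst A \<in> xob m n"
proof -
  assume A: "A \<in> gchains m n"
  then have "fchain A" by (simp add: link_def)
  then show ?thesis using sorted_lst[of A] set_lst[of A] A by (auto simp: xob_iff link_def)
qed

lemma lst_set: "As \<in> xob m n \<Longrightarrow> lst (set As) = As"
  by (rule lst_eqI) (auto simp: xob_iff)

lemma gchains_fchain: "A \<in> gchains m n \<Longrightarrow> fchain A"
  by (simp add: link_def)

lemma least_gch:
  assumes "X \<in> gch m n"
  shows "least grid_le X \<in> X \<and> (\<forall>y\<in>X. grid_le (least grid_le X) y)"
proof -
  \<comment> \<open>In a chain of the product order, the least element is the one with the smallest
    coordinate sum.\<close>
  obtain x where x: "x \<in> X" "\<And>y. y \<in> X \<Longrightarrow> fst x + snd x \<le> fst y + snd y"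
  proof -
    have "X \<noteq> {}" using assms by (simp add: gch_def)
    then show ?thesis using that ex_has_least_nat[of "\<lambda>x. x \<in> X" _ "\<lambda>x. fst x + snd x"] by blast
  qed
  have le: "grid_le x y" if "y \<in> X" for y
  proof -
    have "grid_le x y \<or> grid_le y x" using assms x that by (auto simp: gch_def)
    then show ?thesis using x(2)[OF that] by (auto simp: grid_le_def)
  qed
  have "z = x" if "z \<in> X \<and> (\<forall>y\<in>X. grid_le z y)" for z
  proof -
    have "grid_le z x" "grid_le x z" using that x le by auto
    then show ?thesis by (auto simp: grid_le_def intro: prod_eqI)
  qed
  then have "least grid_le X = x" unfolding least_def using x le by (intro the_equality) auto
  then show ?thesis using x le by simp
qed

lemma fst_least: "X \<in> gch m n \<Longrightarrow> fst (least grid_le X) = lab fst X"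
proof -
  assume X: "X \<in> gch m n"
  have "Min (fst ` X) = fst (least grid_le X)"
    using least_gch[OF X] X by (intro Min_eqI) (auto simp: gch_def grid_le_def)
  then show ?thesis by (simp add: lab_def)
qed

text \<open>The head of the list is the smallest simplex, and smaller simplices have larger labels,
  so the maximum is attained there. This turns \<open>xi_we\<close> into equality of
  \<open>clab\<close>.\<close>

lemma clab_xob:
  assumes "As \<in> xob m n"
  shows "fst (least grid_le (hd As)) = clab fst (set As)"
proof -
  obtain X Xs where As: "As = X # Xs" using assms by (cases As) (auto simp: xob_iff)
  have X: "X \<in> gch m n" "set Xs \<subseteq> gch m n" using assms As by (auto simp: xob_iff)
  have "lab fst Y \<le> lab fst X" if "Y \<in> set Xs" for Y
    using that assms As X by (intro lab_antimono) (auto simp: xob_iff gch_def)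
  then have "clab fst (set As) = lab fst X" unfolding As clab_def by (intro Max_eqI) auto
  then show ?thesis using fst_least[OF X(1)] As by simp
qed

section \<open>Operators on the grid acting on chains of simplices\<close>

abbreviation gm :: "(nat \<Rightarrow> nat) \<Rightarrow> (nat \<Rightarrow> nat) \<Rightarrow> nat \<times> nat \<Rightarrow> nat \<times> nat" where
  "gm \<theta> \<psi> \<equiv> \<lambda>(a, b). (\<theta> a, \<psi> b)"

abbreviation img :: "('a \<Rightarrow> 'b) \<Rightarrow> 'a set set \<Rightarrow> 'b set set" where
  "img g A \<equiv> (image g) ` A"

text \<open>The Kan and matching conditions involve face operators only. Their injectivity keeps
  chains strictly increasing, so that \<open>remdups_adj\<close> in \<open>xi_map\<close> removes
  nothing.\<close>

definition gemb :: "(nat \<Rightarrow> nat) \<Rightarrow> (nat \<Rightarrow> nat) \<Rightarrow> nat \<Rightarrow> nat \<Rightarrow> nat \<Rightarrow> nat \<Rightarrow> bool" where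
  "gemb \<theta> \<psi> p q m n \<longleftrightarrow> strict_mono \<theta> \<and> strict_mono \<psi> \<and> (\<forall>a\<le>p. \<theta> a \<le> m) \<and> (\<forall>b\<le>q. \<psi> b \<le> n)"

lemma inj_gm: "strict_mono \<theta> \<Longrightarrow> strict_mono \<psi> \<Longrightarrow> inj (gm \<theta> \<psi>)"
  by (auto simp: inj_on_def strict_mono_eq)

lemma gm_gch:
  assumes X: "X \<in> gch p q" and mono: "mono \<theta>" "mono \<psi>" and le: "\<And>x. x \<in> X \<Longrightarrow> \<theta> (fst x) \<le> m \<and> \<psi> (snd x) \<le> n"
  shows "gm \<theta> \<psi> ` X \<in> gch m n"
proof -
  have g: "grid_le (gm \<theta> \<psi> x) (gm \<theta> \<psi> y)" if "grid_le x y" for x y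
    using that mono by (auto simp: grid_le_def split_beta monoD)
  have "grid_le x y \<or> grid_le y x" if "x \<in> X" "y \<in> X" for x y using X that by (simp add: gch_def)
  then have ch: "\<forall>x\<in>gm \<theta> \<psi> ` X. \<forall>y\<in>gm \<theta> \<psi> ` X. grid_le x y \<or> grid_le y x"
    using g unfolding ball_simps by blast
  have "gm \<theta> \<psi> x \<in> grid m n" if "x \<in> X" for x using le[OF that] by (simp add: grid_def split_beta)
  then have "gm \<theta> \<psi> ` X \<subseteq> grid m n" by blast
  then show ?thesis using X ch unfolding gch_def by simp
qed

lemma gemb_gch: "gemb \<theta> \<psi> p q m n \<Longrightarrow> X \<in> gch p q \<Longrightarrow> gm \<theta> \<psi> ` X \<in> gch m n"
  by (rule gm_gch) (auto simp: gemb_def gch_def grid_def strict_mono_mono)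

lemma fchain_img: "fchain A \<Longrightarrow> fchain (img g A)"
  by (fastforce simp: fchain_def)

lemma img_link: "A \<in> link {} K \<Longrightarrow> (\<And>X. X \<in> A \<Longrightarrow> g ` X \<in> K') \<Longrightarrow> img g A \<in> link {} K'"
  using fchain_img[of A g] by (auto simp: link_def)

lemma xi_map_lst:
  assumes g: "inj g" and A: "fchain A"
  shows "xi_map g (lst A) = lst (img g A)"
proof -
  have s: "sorted_wrt (\<subset>) (map ((`) g) (lst A))"
    unfolding sorted_wrt_map
    by (rule sorted_wrt_mono_rel[OF _ sorted_lst[OF A]])
      (simp add: psubset_eq inj_image_subset_iff[OF g] inj_image_eq_iff[OF g])
  have "distinct (map ((`) g) (lst A))" by (rule sorted_wrt_psubset_distinct[OF s])
  then have "xi_map g (lst A) = map ((`) g) (lst A)" by (simp add: xi_map_def remdups_adj_distinct)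
  also have "\<dots> = lst (img g A)" by (rule sym, rule lst_eqI[OF s]) (simp add: set_lst[OF A])
  finally show ?thesis .
qed

lemma lab_gm: "mono \<theta> \<Longrightarrow> finite X \<Longrightarrow> X \<noteq> {} \<Longrightarrow> lab fst (gm \<theta> \<psi> ` X) = \<theta> (lab fst X)"
  by (simp add: lab_def mono_Min_commute image_image split_beta)

lemma clab_gm:
  assumes "mono \<theta>" "finite A" "A \<noteq> {}" "\<And>X. X \<in> A \<Longrightarrow> finite X \<and> X \<noteq> {}"
  shows "clab fst (img (gm \<theta> \<psi>) A) = \<theta> (clab fst A)"
proof -
  have "lab fst ` img (gm \<theta> \<psi>) A = \<theta> ` lab fst ` A"
    unfolding image_image using assms lab_gm by (intro image_cong) auto
  then show ?thesis using assms by (simp add: clab_def mono_Max_commute image_image)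
qed

section \<open>Elements of \<open>N_xi\<close> as relative diagrams on sets of simplices\<close>

definition dg :: "('o, 'm) nxi_elem \<Rightarrow> (nat \<times> nat) set set \<Rightarrow> (nat \<times> nat) set set \<Rightarrow> 'm" where
  "dg X A B = snd X (lst A) (lst B)"

context fibration_cat begin

text \<open>Inverse to \<open>dg\<close> on relative diagrams up to their values off arrows; it
  restores the object map and the \<open>undefined\<close> padding that make functors
  extensional.\<close>

definition to_N :: "nat \<Rightarrow> nat \<Rightarrow> ((nat \<times> nat) set set \<Rightarrow> (nat \<times> nat) set set \<Rightarrow> 'm) \<Rightarrow> ('o, 'm) nxi_elem" where
  "to_N m n D = (\<lambda>As. if As \<in> xob m n then ob D (set As) else undefined,
     \<lambda>Bs As. if Bs \<in> xob m n \<and> As \<in> xob m n \<and> xi_le Bs As then D (set Bs) (set As) else undefined)"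

lemma rel_diagram_dg:
  assumes X: "X \<in> N_xi C W m n"
  shows "rel_diagram fst (dg X) (gchains m n)"
    and "A \<in> gchains m n \<Longrightarrow> ob (dg X) A = fst X (lst A)"
proof -
  obtain F0 F1 where X2: "X = (F0, F1)" by (cases X)
  have N: "\<And>x. x \<in> xob m n \<Longrightarrow> F0 x \<in> c_obj C"
    "\<And>x y. x \<in> xob m n \<Longrightarrow> y \<in> xob m n \<Longrightarrow> xi_le x y \<Longrightarrow> F1 x y \<in> hom C (F0 x) (F0 y)"
    "\<And>x. x \<in> xob m n \<Longrightarrow> F1 x x = c_id C (F0 x)"
    "\<And>x y z. x \<in> xob m n \<Longrightarrow> y \<in> xob m n \<Longrightarrow> z \<in> xob m n \<Longrightarrow> xi_le x y \<Longrightarrow> xi_le y z \<Longrightarrow> F1 y z \<cdot> F1 x y = F1 x z"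
    "\<And>x y. x \<in> xob m n \<Longrightarrow> y \<in> xob m n \<Longrightarrow> xi_le x y \<Longrightarrow> xi_we grid_le grid_we x y \<Longrightarrow> F1 x y \<in> W"
    using X unfolding X2 N_xi_def rel_functors_def by simp_all
  show ob: "ob (dg X) A = fst X (lst A)" if "A \<in> gchains m n" for A
    using N(1,3)[OF lst_xob[OF that]] by (simp add: ob_def dg_def X2)
  have le: "xi_le (lst A) (lst B)" if "A \<in> gchains m n" "B \<in> gchains m n" "A \<subseteq> B" for A B
    using that set_lst[OF gchains_fchain] by (simp add: xi_le_def)
  have "diagram (dg X) (gchains m n)"
    unfolding diagram_def
  proof (intro conjI ballI impI)
    fix A B D assume "A \<in> gchains m n" "B \<in> gchains m n" "D \<in> gchains m n" "A \<subseteq> B \<and> B \<subseteq> D"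
    then show "dg X B D \<cdot> dg X A B = dg X A D"
      using N(4)[OF lst_xob[of A] lst_xob[of B] lst_xob[of D] le le] by (simp add: dg_def X2)
  next
    fix A B assume "A \<in> gchains m n" "B \<in> gchains m n" "A \<subseteq> B"
    then show "dg X A B \<in> hom C (ob (dg X) A) (ob (dg X) B)"
      using N(2)[OF lst_xob[of A] lst_xob[of B] le] ob by (simp add: dg_def X2)
  next
    fix A assume "A \<in> gchains m n"
    then show "dg X A A = c_id C (ob (dg X) A)" using N(3)[OF lst_xob[of A]] ob by (simp add: dg_def X2)
  qed
  moreover have "dg X A B \<in> W"
    if AB: "A \<in> gchains m n" "B \<in> gchains m n" "A \<subseteq> B" "clab fst A = clab fst B" for A B
  proof -
    note l = lst_xob[OF AB(1)] lst_xob[OF AB(2)]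
    have "xi_we grid_le grid_we (lst A) (lst B)"
      using clab_xob[OF l(1)] clab_xob[OF l(2)] AB set_lst[OF gchains_fchain]
      by (simp add: xi_we_def grid_we_def)
    then show ?thesis using N(5)[OF l le[OF AB(1-3)]] by (simp add: dg_def X2)
  qed
  ultimately show "rel_diagram fst (dg X) (gchains m n)" by (simp add: rel_diagram_def)
qed

lemma to_N_N_xi:
  assumes "rel_diagram fst D (gchains m n)"
  shows "to_N m n D \<in> N_xi C W m n"
proof -
  have D: "diagram D (gchains m n)" using assms by (simp add: rel_diagram_def)
  have le: "set As \<subseteq> set Bs" if "xi_le As Bs" for As Bs :: "(nat \<times> nat) set list" using that by (simp add: xi_le_def)
  have we: "D (set As) (set Bs) \<in> W"
    if AB: "As \<in> xob m n" "Bs \<in> xob m n" "xi_le As Bs" "xi_we grid_le grid_we As Bs" for As Bs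
  proof -
    have "clab fst (set As) = clab fst (set Bs)"
      using clab_xob[OF AB(1)] clab_xob[OF AB(2)] AB(4) by (simp add: xi_we_def grid_we_def)
    then show ?thesis using assms set_xob[OF AB(1)] set_xob[OF AB(2)] le[OF AB(3)] by (simp add: rel_diagram_def)
  qed
  have refl: "xi_le As As" for As :: "(nat \<times> nat) set list" by (simp add: xi_le_def)
  have trans: "xi_le As Cs" if "xi_le As Bs" "xi_le Bs Cs" for As Bs Cs :: "(nat \<times> nat) set list"
    using that by (auto simp: xi_le_def)
  show ?thesis
    unfolding N_xi_def rel_functors_def to_N_def mem_Collect_eq prod.case
    using diagram_ob[OF D set_xob] diagram_hom[OF D set_xob set_xob le] diagram_id[OF D set_xob]
      diagram_comp[OF D set_xob set_xob set_xob le le] we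
    by (auto simp: refl dest: trans)
qed

lemma to_N_cong:
  assumes "\<And>A B. A \<in> gchains m n \<Longrightarrow> B \<in> gchains m n \<Longrightarrow> A \<subseteq> B \<Longrightarrow> D A B = E A B"
  shows "to_N m n D = to_N m n E"
  using assms set_xob by (simp add: to_N_def ob_def xi_le_def fun_eq_iff)

lemma to_N_dg:
  assumes X: "X \<in> N_xi C W m n"
  shows "to_N m n (dg X) = X"
proof -
  obtain F0 F1 where X2: "X = (F0, F1)" by (cases X)
  have N: "\<And>x. x \<notin> xob m n \<Longrightarrow> F0 x = undefined"
    "\<And>x y. \<not> (x \<in> xob m n \<and> y \<in> xob m n \<and> xi_le x y) \<Longrightarrow> F1 x y = undefined"
    using X unfolding X2 N_xi_def rel_functors_def by simp_all
  have "fst (to_N m n (dg X)) As = F0 As" for As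
    using rel_diagram_dg(2)[OF X set_xob] lst_set N(1)[of As] by (simp add: to_N_def X2)
  moreover have "snd (to_N m n (dg X)) Bs As = F1 Bs As" for Bs As
    using lst_set[of Bs m n] lst_set[of As m n] N(2)[of Bs As] by (simp add: to_N_def dg_def X2)
  ultimately show ?thesis unfolding X2 by (simp add: prod_eq_iff fun_eq_iff)
qed

lemma dg_to_N:
  assumes "A \<in> gchains m n" "B \<in> gchains m n" "A \<subseteq> B"
  shows "dg (to_N m n D) A B = D A B"
  using assms lst_xob set_lst[OF gchains_fchain] by (simp add: dg_def to_N_def xi_le_def)

lemma act_to_N:
  assumes X: "X \<in> N_xi C W m n" and g: "gemb \<theta> \<psi> p q m n"
  shows "N_xi_act \<theta> \<psi> p q X = to_N p q (\<lambda>A B. dg X (img (gm \<theta> \<psi>) A) (img (gm \<theta> \<psi>) B))"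
proof -
  have inj: "inj (gm \<theta> \<psi>)" using g inj_gm by (auto simp: gemb_def)
  have xm: "xi_map (gm \<theta> \<psi>) As = lst (img (gm \<theta> \<psi>) (set As))" if "As \<in> xob p q" for As
    using xi_map_lst[OF inj gchains_fchain[OF set_xob[OF that]]] lst_set[OF that] by simp
  have "img (gm \<theta> \<psi>) (set As) \<in> gchains m n" if "As \<in> xob p q" for As
    using gemb_gch[OF g] that by (intro img_link[OF set_xob[OF that]]) (auto simp: xob_iff)
  then have "fst X (xi_map (gm \<theta> \<psi>) As) = ob (\<lambda>A B. dg X (img (gm \<theta> \<psi>) A) (img (gm \<theta> \<psi>) B)) (set As)"
    if "As \<in> xob p q" for As
    using rel_diagram_dg(2)[OF X, of "img (gm \<theta> \<psi>) (set As)"] that xm[OF that] by (simp add: ob_def)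
  then show ?thesis using xm by (simp add: N_xi_act_def to_N_def dg_def Let_def fun_eq_iff)
qed

text \<open>Weak equivalences are detected by equality of labels, which survives any transformation
  of labels by a function. This serves faces as well as the codegeneracies that collapse rows or
  columns.\<close>

lemma rel_diagram_img:
  assumes rel: "rel_diagram l' D (link {} K')" and gK: "\<And>X. X \<in> K \<Longrightarrow> g ` X \<in> K'"
    and lab: "\<And>A. A \<in> link {} K \<Longrightarrow> clab l' (img g A) = \<theta> (clab l A)"
  shows "rel_diagram l (\<lambda>A B. D (img g A) (img g B)) (link {} K)"
proof -
  have g: "img g A \<in> link {} K'" if "A \<in> link {} K" for A
    using that by (intro img_link[OF that] gK) (auto simp: link_def)
  have ob: "ob (\<lambda>A B. D (img g A) (img g B)) A = ob D (img g A)" for A by (simp add: ob_def)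
  have D: "diagram D (link {} K')" using rel by (simp add: rel_diagram_def)
  have "diagram (\<lambda>A B. D (img g A) (img g B)) (link {} K)"
    unfolding diagram_def ob
    using diagram_id[OF D g] diagram_hom[OF D g g] diagram_comp[OF D g g g] by (simp add: image_mono)
  moreover have "D (img g A) (img g B) \<in> W"
    if "A \<in> link {} K" "B \<in> link {} K" "A \<subseteq> B" "clab l A = clab l B" for A B
    using rel g[OF that(1)] g[OF that(2)] image_mono[OF that(3), of "image g"] lab[OF that(1)] lab[OF that(2)] that(4)
    by (simp add: rel_diagram_def)
  ultimately show ?thesis by (simp add: rel_diagram_def)
qed

lemma act_N_xi:
  assumes X: "X \<in> N_xi C W m n" and g: "gemb \<theta> \<psi> p q m n"
  shows "N_xi_act \<theta> \<psi> p q X \<in> N_xi C W p q"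
  unfolding act_to_N[OF assms]
proof (intro to_N_N_xi rel_diagram_img[OF rel_diagram_dg(1)[OF X] gemb_gch[OF g]])
  fix A assume "A \<in> gchains p q"
  then show "clab fst (img (gm \<theta> \<psi>) A) = \<theta> (clab fst A)"
    using g by (intro clab_gm) (auto simp: gemb_def strict_mono_mono link_def fchain_def gch_def)
qed

lemma act_act:
  assumes X: "X \<in> N_xi C W m n" and g: "gemb \<theta> \<psi> p q m n" and h: "gemb \<theta>' \<psi>' p' q' p q"
  shows "N_xi_act \<theta>' \<psi>' p' q' (N_xi_act \<theta> \<psi> p q X) =
    to_N p' q' (\<lambda>A B. dg X (img (gm (\<theta> \<circ> \<theta>') (\<psi> \<circ> \<psi>')) A) (img (gm (\<theta> \<circ> \<theta>') (\<psi> \<circ> \<psi>')) B))"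
  unfolding act_to_N[OF act_N_xi[OF X g] h]
proof (rule to_N_cong)
  fix A B assume AB: "A \<in> gchains p' q'" "B \<in> gchains p' q'" "A \<subseteq> B"
  have i: "img (gm \<theta>' \<psi>') A \<in> gchains p q" if "A \<in> gchains p' q'" for A
    using gemb_gch[OF h] that by (intro img_link[OF that]) (auto simp: link_def)
  have "img (gm \<theta> \<psi>) (img (gm \<theta>' \<psi>') A) = img (gm (\<theta> \<circ> \<theta>') (\<psi> \<circ> \<psi>')) A" for A
    by (simp add: image_image split_beta)
  then show "dg (N_xi_act \<theta> \<psi> p q X) (img (gm \<theta>' \<psi>') A) (img (gm \<theta>' \<psi>') B) =
      dg X (img (gm (\<theta> \<circ> \<theta>') (\<psi> \<circ> \<psi>')) A) (img (gm (\<theta> \<circ> \<theta>') (\<psi> \<circ> \<psi>')) B)"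
    using dg_to_N[OF i[OF AB(1)] i[OF AB(2)] image_mono[OF AB(3)]] act_to_N[OF X g] by simp
qed

text \<open>For overlaps of two faces of the grid: the chains avoid two rows or columns, e
  compresses them into the common face of both, and f and f' factor through e. There Y and Z
  coincide by the equation of their restrictions.\<close>

lemma dg_agree:
  assumes Y: "Y \<in> N_xi C W m n" "gemb \<theta> \<psi> p q m n" and Z: "Z \<in> N_xi C W m' n'" "gemb \<theta>' \<psi>' p q m' n'"
    and eq: "N_xi_act \<theta> \<psi> p q Y = N_xi_act \<theta>' \<psi>' p q Z"
    and AB: "A \<in> link {} K" "B \<in> link {} K" "A \<subseteq> B"
    and e: "\<And>X. X \<in> B \<Longrightarrow> e ` X \<in> gch p q"
    and f: "\<And>X x. X \<in> B \<Longrightarrow> x \<in> X \<Longrightarrow> gm \<theta> \<psi> (e x) = f x \<and> gm \<theta>' \<psi>' (e x) = f' x"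
  shows "dg Y (img f A) (img f B) = dg Z (img f' A) (img f' B)"
proof -
  have i: "img e A \<in> gchains p q" "img e B \<in> gchains p q"
    using AB e by (auto intro!: img_link[OF AB(1)] img_link[OF AB(2)])
  have "img (gm \<theta> \<psi>) (img e S) = img f S \<and> img (gm \<theta>' \<psi>') (img e S) = img f' S" if "S \<subseteq> B" for S
    using f that unfolding image_image by (intro conjI image_cong refl) auto
  then have im: "img (gm \<theta> \<psi>) (img e A) = img f A" "img (gm \<theta>' \<psi>') (img e A) = img f' A"
    "img (gm \<theta> \<psi>) (img e B) = img f B" "img (gm \<theta>' \<psi>') (img e B) = img f' B" using AB(3) by auto
  have "dg (N_xi_act \<theta> \<psi> p q Y) (img e A) (img e B) = dg Y (img f A) (img f B)"
    unfolding act_to_N[OF Y] using dg_to_N[OF i image_mono[OF AB(3)]] im by simp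
  moreover have "dg (N_xi_act \<theta>' \<psi>' p q Z) (img e A) (img e B) = dg Z (img f' A) (img f' B)"
    unfolding act_to_N[OF Z] using dg_to_N[OF i image_mono[OF AB(3)]] im by simp
  ultimately show ?thesis using eq by simp
qed

end

section \<open>The matching on grid chains\<close>

text \<open>The simplices outside \<open>\<partial>\<Delta>[m] \<times> \<Delta>[n] \<union>
  \<Delta>[m] \<times> \<Lambda>\<^sup>k[n]\<close>: they meet every row and every column except
  possibly column k. \<open>gbd\<close> is that subcomplex.\<close>

definition gopen :: "nat \<Rightarrow> nat \<Rightarrow> nat \<Rightarrow> (nat \<times> nat) set set" where
  "gopen m n k = {X \<in> gch m n. {0..m} \<subseteq> fst ` X \<and> {0..n} - {k} \<subseteq> snd ` X}"

definition gbd :: "nat \<Rightarrow> nat \<Rightarrow> nat \<Rightarrow> (nat \<times> nat) set set" where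
  "gbd m n k = gch m n - gopen m n k"

text \<open>A chain \<open>c\<close> is matched by toggling the vertex \<open>(piv k c, k)\<close>. It is comparable to all of \<open>c\<close>, because
  \<open>(piv k c, kk k)\<close> is the last vertex of \<open>c\<close> before column \<open>k\<close> (for \<open>k = 0\<close>, the first one after it).\<close>

definition kk :: "nat \<Rightarrow> nat" where
  "kk k = (if k = 0 then 1 else k - 1)"

definition slots :: "nat \<Rightarrow> (nat \<times> nat) set \<Rightarrow> nat set" where
  "slots k c = {a. (a, kk k) \<in> c}"

definition piv :: "nat \<Rightarrow> (nat \<times> nat) set \<Rightarrow> nat" where
  "piv k c = (if k = 0 then Min (slots k c) else Max (slots k c))"

text \<open>A monotone left inverse of \<open>coface i\<close>, namely the codegeneracy identifying
  i with i - 1 (with 1 if i is 0). On vertices other than i it is also a right inverse.\<close>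

definition codeg :: "nat \<Rightarrow> nat \<Rightarrow> nat" where
  "codeg i a = (if a < i then a else a - 1)"

lemma kk_neq [simp]: "kk k \<noteq> k"
  by (auto simp: kk_def)

lemma finite_gch: "finite (gch m n)"
  by (rule finite_subset[of _ "Pow (grid m n)"]) (auto simp: gch_def grid_def)

lemma gch_subset:
  assumes "X \<in> gch m n" "Y \<subseteq> X" "Y \<noteq> {}"
  shows "Y \<in> gch m n"
proof -
  have X: "finite X" "X \<subseteq> grid m n" "\<And>x y. x \<in> X \<Longrightarrow> y \<in> X \<Longrightarrow> grid_le x y \<or> grid_le y x"
    using assms by (simp_all add: gch_def)
  have "finite Y" "Y \<subseteq> grid m n" "\<forall>x\<in>Y. \<forall>y\<in>Y. grid_le x y \<or> grid_le y x"
    using finite_subset[OF assms(2) X(1)] order_trans[OF assms(2) X(2)] X(3) subsetD[OF assms(2)] by simp_all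
  then show ?thesis using assms(3) by (simp add: gch_def)
qed

lemma down_closed_gch: "down_closed (gch m n)"
  unfolding down_closed_def by (intro conjI ballI allI impI) (simp add: gch_def, rule gch_subset)

lemma down_closed_gbd: "down_closed (gbd m n k)"
proof -
  have "X \<in> gopen m n k" if "Y \<in> gopen m n k" "X \<in> gch m n" "Y \<subseteq> X" for X Y
    using that order_trans[OF _ image_mono[OF that(3), of fst]] order_trans[OF _ image_mono[OF that(3), of snd]]
    by (simp add: gopen_def)
  moreover have "{} \<notin> gch m n" by (simp add: gch_def)
  ultimately show ?thesis
    unfolding down_closed_def gbd_def using gch_subset[of _ m n] by blast
qed

lemma slots_insert [simp]: "slots k (insert (a, k) c) = slots k c"
  by (simp add: slots_def)

lemma slots_remove [simp]: "slots k (c - {(a, k)}) = slots k c"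
  by (simp add: slots_def)

lemma piv_insert [simp]: "piv k (insert (a, k) c) = piv k c"
  by (simp add: piv_def)

lemma piv_remove [simp]: "piv k (c - {(a, k)}) = piv k c"
  by (simp add: piv_def)

lemma slots_gopen:
  assumes "c \<in> gopen m n k" "1 \<le> n" "k \<le> n"
  shows "finite (slots k c)" "slots k c \<noteq> {}" "slots k c \<subseteq> {0..m}"
proof -
  have c: "c \<subseteq> grid m n" "{0..n} - {k} \<subseteq> snd ` c" using assms by (auto simp: gopen_def gch_def)
  show s: "slots k c \<subseteq> {0..m}" using c by (auto simp: slots_def grid_def)
  then show "finite (slots k c)" by (rule finite_subset) simp
  have "kk k \<in> {0..n} - {k}" using assms by (auto simp: kk_def)
  then have "kk k \<in> snd ` c" using c by blast
  then show "slots k c \<noteq> {}" by (auto simp: slots_def)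
qed

lemma piv_gopen:
  assumes "c \<in> gopen m n k" "1 \<le> n" "k \<le> n"
  shows "(piv k c, kk k) \<in> c" "piv k c \<le> m"
    and "\<And>a. (a, kk k) \<in> c \<Longrightarrow> if k = 0 then piv k c \<le> a else a \<le> piv k c"
proof -
  note s = slots_gopen[OF assms]
  have p: "piv k c \<in> slots k c" 
    using s Min_in[OF s(1,2)] Max_in[OF s(1,2)] by (cases "k = 0") (simp_all add: piv_def)
  then show "(piv k c, kk k) \<in> c" "piv k c \<le> m" using s by (auto simp: slots_def)
  fix a assume "(a, kk k) \<in> c"
  then have "a \<in> slots k c" by (simp add: slots_def)
  then show "if k = 0 then piv k c \<le> a else a \<le> piv k c" 
    using s(1) by (cases "k = 0") (simp_all add: piv_def)
qed

lemma gopen_insert_piv: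
  assumes c: "c \<in> gopen m n k" and n: "1 \<le> n" "k \<le> n"
  shows "insert (piv k c, k) c \<in> gopen m n k"
proof -
  let ?i = "piv k c"
  note p = piv_gopen[OF c n]
  have cg: "c \<in> gch m n" using c by (simp add: gopen_def)
  have comp: "grid_le x (?i, k) \<or> grid_le (?i, k) x" if x: "x \<in> c" for x
  proof -
    obtain a b where ab: "x = (a, b)" by (cases x)
    have "grid_le x (?i, kk k) \<or> grid_le (?i, kk k) x" using cg p(1) x by (auto simp: gch_def)
    moreover have "b = kk k \<Longrightarrow> if k = 0 then ?i \<le> a else a \<le> ?i" using p(3)[of a] x ab by simp
    ultimately show ?thesis
      unfolding ab grid_le_def kk_def by (cases "k = 0"; cases "b = kk k") (auto simp: kk_def)
  qed
  have refl: "grid_le x x" for x by (simp add: grid_le_def)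
  have "grid_le x y \<or> grid_le y x" if "x \<in> c" "y \<in> c" for x y using cg that by (simp add: gch_def)
  then have "\<forall>x\<in>insert (?i, k) c. \<forall>y\<in>insert (?i, k) c. grid_le x y \<or> grid_le y x"
    using comp refl by blast
  then have "insert (?i, k) c \<in> gch m n"
    using cg p(2) n unfolding gch_def grid_def by simp
  then show ?thesis using c by (auto simp: gopen_def)
qed

text \<open>The vertex \<open>(piv k c, kk k)\<close> stays behind and still covers the row of the
  deleted vertex, while column k is exempt from the covering condition.\<close>

lemma gopen_remove_piv:
  assumes c: "c \<in> gopen m n k" and n: "1 \<le> n" "k \<le> n"
  shows "c - {(piv k c, k)} \<in> gopen m n k"
proof -
  let ?c = "c - {(piv k c, k)}"
  have w: "(piv k c, kk k) \<in> ?c" using piv_gopen(1)[OF c n] by simp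
  have "?c \<in> gch m n" by (rule gch_subset[of c]) (use c w in \<open>auto simp: gopen_def\<close>)
  moreover have "fst ` ?c = fst ` c"
  proof -
    have "fst x \<in> fst ` ?c" if "x \<in> c" for x
      using that w by (cases "x = (piv k c, k)") (auto intro: rev_image_eqI)
    then show ?thesis by blast
  qed
  moreover have "snd ` c - {k} \<subseteq> snd ` ?c" by force
  then have "{0..n} - {k} \<subseteq> snd ` ?c" using c unfolding gopen_def by blast
  ultimately show ?thesis using c by (simp add: gopen_def)
qed

section \<open>Cofaces and their monotone left inverses\<close>

lemma mono_codeg: "mono (codeg i)"
  by (auto simp: mono_def codeg_def)

lemma strict_mono_coface: "strict_mono (coface i)"
  by (auto simp: strict_mono_def coface_def)

lemma strict_mono_ident: "strict_mono (\<lambda>j :: nat. j)"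
  by (simp add: strict_mono_def)

lemma codeg_coface [simp]: "codeg i (coface i a) = a"
  by (simp add: codeg_def coface_def)

lemma coface_neq [simp]: "coface i a \<noteq> i"
  by (simp add: coface_def)

lemma coface_codeg: "a \<noteq> i \<Longrightarrow> coface i (codeg i a) = a"
  by (auto simp: codeg_def coface_def)

lemma coface_coface: "i < j \<Longrightarrow> coface j \<circ> coface i = coface i \<circ> coface (j - 1)"
  by (auto simp: coface_def fun_eq_iff)

lemma codeg_le: "a \<le> m \<Longrightarrow> a \<noteq> i \<Longrightarrow> i \<le> m \<Longrightarrow> codeg i a \<le> m - 1"
  by (auto simp: codeg_def)

lemma codeg_codeg:
  assumes "i < i'" "a \<noteq> i" "a \<noteq> i'"
  shows "coface i (codeg i (codeg i' a)) = codeg i' a" "coface (i' - 1) (codeg i (codeg i' a)) = codeg i a"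
  using assms by (auto simp: codeg_def coface_def)

lemma codeg_codeg_le: "i < i' \<Longrightarrow> i' \<le> m \<Longrightarrow> a \<le> m \<Longrightarrow> a \<noteq> i \<Longrightarrow> a \<noteq> i' \<Longrightarrow> codeg i (codeg i' a) \<le> m - 1 - 1"
  by (auto simp: codeg_def)

lemma gemb_row: "1 \<le> m \<Longrightarrow> gemb (coface i) (\<lambda>j. j) (m - 1) n m n"
  by (auto simp: gemb_def strict_mono_coface strict_mono_ident coface_def)

lemma gemb_col: "1 \<le> n \<Longrightarrow> gemb (\<lambda>j. j) (coface i) m (n - 1) m n"
  by (auto simp: gemb_def strict_mono_coface strict_mono_ident coface_def)

lemma link_downward: "B \<in> link {} V \<Longrightarrow> A \<in> link {} K \<Longrightarrow> A \<subseteq> B \<Longrightarrow> A \<in> link {} V"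
  by (auto simp: link_def)

context fibration_cat begin

lemma rel_diagram_extend_grid:
  assumes n: "1 \<le> n" "k \<le> n" and rel: "rel_diagram fst D (link {} (gbd m n k))"
  shows "\<exists>E. rel_diagram fst E (gchains m n) \<and>
    (\<forall>A\<in>link {} (gbd m n k). \<forall>B\<in>link {} (gbd m n k). A \<subseteq> B \<longrightarrow> E A B = D A B)"
proof -
  define \<rho> where "\<rho> c = (if k = 0 then m - piv k c else piv k c)" for c
  \<comment> \<open>The size of the upper simplex of the pair, weighted, plus the position of the
    pivot measured so that shrinking c moves it towards 0. When a vertex other than the toggled one
    is deleted, neither summand grows: the size drops if the pivot stays, and \<rho> drops if it
    moves.\<close>
  define r where "r c = card (insert (piv k c, k) c) * (m + 1) + \<rho> c" for c
  have open_eq: "gch m n - gbd m n k = gopen m n k" by (auto simp: gbd_def gopen_def)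
  have fin: "finite c" if "c \<in> gopen m n k" for c using that by (simp add: gopen_def gch_def)
  have \<rho>_le: "\<rho> c \<le> m" if "c \<in> gopen m n k" for c using piv_gopen(2)[OF that n] by (simp add: \<rho>_def)
  have rank: "r (c - {y}) < r c"
    if c: "c \<in> gopen m n k" "(piv k c, k) \<in> c" "y \<in> c" "y \<noteq> (piv k c, k)" "c - {y} \<in> gopen m n k" for c y
  proof -
    have r: "r c = card c * (m + 1) + \<rho> c" using c(2) by (simp add: r_def insert_absorb)
    show ?thesis
    proof (cases "piv k (c - {y}) = piv k c")
      case True
      have "insert (piv k c, k) (c - {y}) = c - {y}" using c by blast
      moreover have "\<rho> (c - {y}) = \<rho> c" by (simp only: \<rho>_def True)
      ultimately have "r (c - {y}) = (card c - 1) * (m + 1) + \<rho> c"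
        using True c(3) by (simp add: r_def)
      moreover have "0 < card c" using c(3) fin[OF c(1)] by (auto simp: card_gt_0_iff)
      ultimately show ?thesis using r by (cases "card c") auto
    next
      case False
      \<comment> \<open>The new pivot was already a competitor in c, so the extremality of the old
        one fixes the direction in which the pivot moves.\<close>
      have "(piv k (c - {y}), kk k) \<in> c" using piv_gopen(1)[OF c(5) n] by blast
      then have "\<rho> (c - {y}) < \<rho> c"
        using piv_gopen(3)[OF c(1) n] False piv_gopen(2)[OF c(1) n] piv_gopen(2)[OF c(5) n]
        by (fastforce simp: \<rho>_def)
      moreover have "card (insert (piv k (c - {y}), k) (c - {y})) \<le> card c"
        using card_insert_le_m1[of "card c" "c - {y}"] c(3) fin[OF c(1)] by (auto simp: card_gt_0_iff)
      then have "card (insert (piv k (c - {y}), k) (c - {y})) * (m + 1) \<le> card c * (m + 1)"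
        by (rule mult_le_mono1)
      ultimately show ?thesis using r unfolding r_def[of "c - {y}"] by linarith
    qed
  qed
  have sub: "gbd m n k \<subseteq> gch m n" by (auto simp: gbd_def)
  have fin': "finite X" if "X \<in> gch m n" for X using that by (simp add: gch_def)
  have closed: "insert (piv k c, k) c \<in> gopen m n k \<and> c - {(piv k c, k)} \<in> gopen m n k"
    if "c \<in> gopen m n k" for c
    using gopen_insert_piv[OF that n] gopen_remove_piv[OF that n] by simp
  have v: "(piv k (insert (piv k c, k) c), k) = (piv k c, k) \<and> (piv k (c - {(piv k c, k)}), k) = (piv k c, k)" for c
    by simp
  have rr: "r (insert (piv k c, k) c) = r c" for c by (simp add: r_def \<rho>_def)
  have w: "(piv k c, kk k) \<in> c \<and> (piv k c, kk k) \<noteq> (piv k c, k) \<and> fst (piv k c, kk k) = fst (piv k c, k)"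
    if "c \<in> gopen m n k" for c
    using piv_gopen(1)[OF that n] by simp
  show ?thesis
    by (rule rel_diagram_extend_matching[where v = "\<lambda>c. (piv k c, k)" and w = "\<lambda>c. (piv k c, kk k)" and r = r,
        OF down_closed_gch finite_gch fin' down_closed_gbd sub, unfolded open_eq, OF _ closed v rr w rank rel])
qed

text \<open>A piece that contains the chain B contains all its subchains, so the target of an arrow,
  or of a composite, already decides in which piece to compute.\<close>

lemma rel_diagram_glue:
  assumes rel: "\<And>\<iota>. \<iota> \<in> I \<Longrightarrow> rel_diagram l (\<Phi> \<iota>) (link {} (V \<iota>))"
    and agree: "\<And>\<iota> \<kappa> A B. \<iota> \<in> I \<Longrightarrow> \<kappa> \<in> I \<Longrightarrow> A \<in> link {} (V \<iota>) \<Longrightarrow> B \<in> link {} (V \<iota>) \<Longrightarrow>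
      A \<in> link {} (V \<kappa>) \<Longrightarrow> B \<in> link {} (V \<kappa>) \<Longrightarrow> A \<subseteq> B \<Longrightarrow> \<Phi> \<iota> A B = \<Phi> \<kappa> A B"
    and cover: "\<And>A. A \<in> link {} K \<Longrightarrow> \<exists>\<iota>\<in>I. A \<in> link {} (V \<iota>)"
  shows "\<exists>D. rel_diagram l D (link {} K) \<and>
    (\<forall>\<iota>\<in>I. \<forall>A\<in>link {} (V \<iota>). \<forall>B\<in>link {} (V \<iota>). A \<subseteq> B \<longrightarrow> D A B = \<Phi> \<iota> A B)"
proof -
  define D where "D A B = \<Phi> (SOME \<iota>. \<iota> \<in> I \<and> B \<in> link {} (V \<iota>)) A B" for A B
  have D: "D A B = \<Phi> \<iota> A B" if "\<iota> \<in> I" "A \<in> link {} (V \<iota>)" "B \<in> link {} (V \<iota>)" "A \<subseteq> B" for \<iota> A B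
  proof -
    let ?\<kappa> = "SOME \<iota>. \<iota> \<in> I \<and> B \<in> link {} (V \<iota>)"
    have k: "?\<kappa> \<in> I \<and> B \<in> link {} (V ?\<kappa>)" using someI[of "\<lambda>\<iota>. \<iota> \<in> I \<and> B \<in> link {} (V \<iota>)" \<iota>] that by blast
    then have "A \<in> link {} (V ?\<kappa>)" using link_downward that by blast
    then show ?thesis using agree[of ?\<kappa> \<iota> A B] k that by (simp add: D_def)
  qed
  have ob: "ob D A = ob (\<Phi> \<iota>) A" if "\<iota> \<in> I" "A \<in> link {} (V \<iota>)" for \<iota> A
    using D[OF that that(2) order_refl] by (simp add: ob_def)
  have dia: "diagram (\<Phi> \<iota>) (link {} (V \<iota>))" if "\<iota> \<in> I" for \<iota> using rel[OF that] by (simp add: rel_diagram_def)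
  have "diagram D (link {} K)"
    unfolding diagram_def
  proof (intro conjI ballI impI)
    fix A assume "A \<in> link {} K"
    then obtain \<iota> where i: "\<iota> \<in> I" "A \<in> link {} (V \<iota>)" using cover by blast
    show "D A A = c_id C (ob D A)"
      using D[OF i i(2) order_refl] ob[OF i] diagram_id[OF dia[OF i(1)] i(2)] by simp
  next
    fix A B assume A: "A \<in> link {} K" and "B \<in> link {} K" and AB: "A \<subseteq> B"
    then obtain \<iota> where i: "\<iota> \<in> I" "B \<in> link {} (V \<iota>)" using cover by blast
    have j: "A \<in> link {} (V \<iota>)" by (rule link_downward[OF i(2) A AB])
    show "D A B \<in> hom C (ob D A) (ob D B)"
      using D[OF i(1) j i(2) AB] ob[OF i] ob[OF i(1) j] diagram_hom[OF dia[OF i(1)] j i(2) AB] by simp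
  next
    fix A B B' assume A: "A \<in> link {} K" and B: "B \<in> link {} K" and "B' \<in> link {} K" and AB: "A \<subseteq> B \<and> B \<subseteq> B'"
    then obtain \<iota> where i: "\<iota> \<in> I" "B' \<in> link {} (V \<iota>)" using cover by blast
    have j: "A \<in> link {} (V \<iota>)" "B \<in> link {} (V \<iota>)" and AB': "A \<subseteq> B'"
      using link_downward[OF i(2) A] link_downward[OF i(2) B] AB by auto
    show "D B B' \<cdot> D A B = D A B'"
      using D[OF i(1) j] D[OF i(1) j(2) i(2)] D[OF i(1) j(1) i(2) AB'] AB diagram_comp[OF dia[OF i(1)] j i(2)] by simp
  qed
  moreover have "D A B \<in> W"
    if A: "A \<in> link {} K" "B \<in> link {} K" "A \<subseteq> B" "clab l A = clab l B" for A B
  proof -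
    obtain \<iota> where i: "\<iota> \<in> I" "B \<in> link {} (V \<iota>)" using cover A by blast
    have j: "A \<in> link {} (V \<iota>)" by (rule link_downward[OF i(2) A(1,3)])
    show ?thesis using D[OF i(1) j i(2) A(3)] rel[OF i(1)] i(2) j A by (simp add: rel_diagram_def)
  qed
  ultimately show ?thesis using D by (intro exI[of _ D]) (simp add: rel_diagram_def)
qed

end

section \<open>Horn filling\<close>

lemma mono_codeg_codeg: "mono (\<lambda>a. codeg i (codeg i' a))"
  by (intro monoI monoD[OF mono_codeg])

context fibration_cat begin

lemma rel_diagram_transport:
  assumes Y: "Y \<in> N_xi C W p q" and mono: "mono \<theta>" "mono \<psi>"
    and le: "\<And>X x. X \<in> K \<Longrightarrow> x \<in> X \<Longrightarrow> \<theta> (fst x) \<le> p \<and> \<psi> (snd x) \<le> q" and K: "K \<subseteq> gch m n"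
  shows "rel_diagram fst (\<lambda>A B. dg Y (img (gm \<theta> \<psi>) A) (img (gm \<theta> \<psi>) B)) (link {} K)"
proof (rule rel_diagram_img[OF rel_diagram_dg(1)[OF Y]])
  show "gm \<theta> \<psi> ` X \<in> gch p q" if "X \<in> K" for X
    by (rule gm_gch[OF subsetD[OF K that] mono]) (rule le[OF that])
  fix A assume "A \<in> link {} K"
  then have A: "fchain A" "A \<noteq> {}" "A \<subseteq> gch m n" using K by (auto simp: link_def)
  have "finite X \<and> X \<noteq> {}" if "X \<in> A" for X using A(3) that by (auto simp: gch_def)
  then show "clab fst (img (gm \<theta> \<psi>) A) = \<theta> (clab fst A)"
    using A by (intro clab_gm[OF mono(1)]) (auto simp: fchain_def)
qed

lemma restrict_to_N:
  assumes E: "rel_diagram fst E (gchains m n)" and Y: "Y \<in> N_xi C W p q" and g: "gemb \<theta> \<psi> p q m n"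
    and eq: "\<And>A B. A \<in> gchains p q \<Longrightarrow> B \<in> gchains p q \<Longrightarrow> A \<subseteq> B \<Longrightarrow>
      E (img (gm \<theta> \<psi>) A) (img (gm \<theta> \<psi>) B) = dg Y A B"
  shows "N_xi_act \<theta> \<psi> p q (to_N m n E) = Y"
proof -
  have i: "img (gm \<theta> \<psi>) A \<in> gchains m n" if "A \<in> gchains p q" for A
    using gemb_gch[OF g] that by (intro img_link[OF that]) (auto simp: link_def)
  have "N_xi_act \<theta> \<psi> p q (to_N m n E) = to_N p q (dg Y)"
    unfolding act_to_N[OF to_N_N_xi[OF E] g]
  proof (rule to_N_cong)
    fix A B assume AB: "A \<in> gchains p q" "B \<in> gchains p q" "A \<subseteq> B"
    show "dg (to_N m n E) (img (gm \<theta> \<psi>) A) (img (gm \<theta> \<psi>) B) = dg Y A B"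
      using dg_to_N[OF i[OF AB(1)] i[OF AB(2)] image_mono[OF AB(3)]] eq[OF AB] by simp
  qed
  then show ?thesis using to_N_dg[OF Y] by simp
qed

lemma matching_map_matching_obj:
  assumes x: "x \<in> N_xi C W m n"
  shows "matching_map N_xi_act m n x \<in> matching_obj (N_xi C W) N_xi_act m n"
proof -
  have row: "gemb (coface i) (\<lambda>j. j) (m - 1) n m n" if "1 \<le> m" for i using gemb_row[OF that] .
  have "matching_map N_xi_act m n x i \<in> N_xi C W (m - 1) n" if "i \<in> bdry_idx m" for i
  proof -
    have "1 \<le> m" using that by (auto simp: bdry_idx_def split: if_splits)
    then show ?thesis using act_N_xi[OF x row] that by (simp add: matching_map_def dh_def)
  qed
  moreover have "dh N_xi_act (m - 1) n i (matching_map N_xi_act m n x j) =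
      dh N_xi_act (m - 1) n (j - 1) (matching_map N_xi_act m n x i)"
    if ij: "2 \<le> m \<and> i < j \<and> j \<le> m" for i j
  proof -
    have m: "1 \<le> m" "1 \<le> m - 1" "i \<in> bdry_idx m" "j \<in> bdry_idx m" using ij by (auto simp: bdry_idx_def)
    show ?thesis
      using act_act[OF x row[OF m(1), of j] gemb_row[OF m(2), of i n]]
        act_act[OF x row[OF m(1), of i] gemb_row[OF m(2), of "j - 1" n]] coface_coface[of i j] ij m(3,4)
      by (simp add: matching_map_def dh_def)
  qed
  ultimately show ?thesis by (simp add: matching_obj_def matching_map_def[of _ _ _ _])
qed

text \<open>The components of y and z are spread by codegeneracies over the chains that avoid one
  row or one column. The matching equations for y, the horn equations for z and the equation between
  y and z are precisely the agreement on the three kinds of overlap. Restricting the extension back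
  recovers y and z, as \<open>codeg\<close> undoes \<open>coface\<close>.\<close>

lemma horn_filler:
  assumes n: "1 \<le> n" "k \<le> n" and y: "y \<in> matching_obj (N_xi C W) N_xi_act m n"
    and z: "\<And>j. j \<le> n \<Longrightarrow> j \<noteq> k \<Longrightarrow> z j \<in> N_xi C W m (n - 1)"
    and zz: "\<And>i j. i < j \<Longrightarrow> j \<le> n \<Longrightarrow> i \<noteq> k \<Longrightarrow> j \<noteq> k \<Longrightarrow>
      dv N_xi_act m (n - 1) i (z j) = dv N_xi_act m (n - 1) (j - 1) (z i)"
    and yz: "\<And>j. j \<le> n \<Longrightarrow> j \<noteq> k \<Longrightarrow> matching_map N_xi_act m (n - 1) (z j) = matching_face N_xi_act m n j y"
  shows "\<exists>x\<in>N_xi C W m n. matching_map N_xi_act m n x = y \<and> (\<forall>j\<le>n. j \<noteq> k \<longrightarrow> dv N_xi_act m n j x = z j)"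
proof -
  let ?e = "\<lambda>j :: nat. j"
  have mono_e: "mono ?e" by (simp add: mono_def)
  have yN: "y i \<in> N_xi C W (m - 1) n" if "1 \<le> m" "i \<le> m" for i
    using y that by (simp add: matching_obj_def bdry_idx_def)
  have yy: "dh N_xi_act (m - 1) n i (y j) = dh N_xi_act (m - 1) n (j - 1) (y i)"
    if "2 \<le> m" "i < j" "j \<le> m" for i j
    using y that by (simp add: matching_obj_def)
  \<comment> \<open>\<open>Inl i\<close> is the piece avoiding row i, which carries
    \<open>y i\<close>; \<open>Inr j\<close> is the piece avoiding column j, which carries
    \<open>z j\<close>.\<close>
  define V where "V \<iota> = {X \<in> gch m n. case \<iota> of Inl i \<Rightarrow> i \<notin> fst ` X | Inr j \<Rightarrow> j \<notin> snd ` X}" for \<iota> :: "nat + nat"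
  define \<Phi> where "\<Phi> \<iota> A B = (case \<iota> of
      Inl i \<Rightarrow> dg (y i) (img (gm (codeg i) ?e) A) (img (gm (codeg i) ?e) B)
    | Inr j \<Rightarrow> dg (z j) (img (gm ?e (codeg j)) A) (img (gm ?e (codeg j)) B))" for \<iota> :: "nat + nat" and A B
  define I where "I = Inl ` {i. 1 \<le> m \<and> i \<le> m} \<union> Inr ` {j. j \<le> n \<and> j \<noteq> k}"
  have bnd: "fst x \<le> m \<and> snd x \<le> n" if "X \<in> gch m n" "x \<in> X" for X x
    using that by (auto simp: gch_def grid_def)
  have VL: "X \<in> gch m n" "x \<in> X \<Longrightarrow> fst x \<le> m \<and> snd x \<le> n \<and> fst x \<noteq> i" if "X \<in> V (Inl i)" for X x i
    using that bnd[of X x] by (auto simp: V_def)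
  have VR: "X \<in> gch m n" "x \<in> X \<Longrightarrow> fst x \<le> m \<and> snd x \<le> n \<and> snd x \<noteq> j" if "X \<in> V (Inr j)" for X x j
    using that bnd[of X x] by (auto simp: V_def)
  have mem: "X \<in> V \<iota>" if "A \<in> link {} (V \<iota>)" "X \<in> A" for X A \<iota> using that by (auto simp: link_def)
  have witness: "\<exists>X\<in>A. \<exists>x\<in>X. X \<in> gch m n" if "A \<in> link {} (V \<iota>)" for A \<iota>
    using that by (fastforce simp: link_def V_def gch_def)
  have rel: "rel_diagram fst (\<Phi> \<iota>) (link {} (V \<iota>))" if "\<iota> \<in> I" for \<iota>
  proof (cases \<iota>)
    case (Inl i)
    then have i: "1 \<le> m" "i \<le> m" using that by (auto simp: I_def)
    have "rel_diagram fst (\<lambda>A B. dg (y i) (img (gm (codeg i) ?e) A) (img (gm (codeg i) ?e) B)) (link {} (V \<iota>))"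
    proof (rule rel_diagram_transport[OF yN[OF i] mono_codeg mono_e])
      show "codeg i (fst x) \<le> m - 1 \<and> snd x \<le> n" if "X \<in> V \<iota>" "x \<in> X" for X x
        using VL(2)[of X i x] that i codeg_le[of "fst x" m i] by (simp add: Inl)
      show "V \<iota> \<subseteq> gch m n" by (auto simp: V_def)
    qed
    then show ?thesis by (simp add: \<Phi>_def[abs_def] Inl)
  next
    case (Inr j)
    then have j: "j \<le> n" "j \<noteq> k" using that by (auto simp: I_def)
    have "rel_diagram fst (\<lambda>A B. dg (z j) (img (gm ?e (codeg j)) A) (img (gm ?e (codeg j)) B)) (link {} (V \<iota>))"
    proof (rule rel_diagram_transport[OF z[OF j] mono_e mono_codeg])
      show "fst x \<le> m \<and> codeg j (snd x) \<le> n - 1" if "X \<in> V \<iota>" "x \<in> X" for X x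
        using VR(2)[of X j x] that j codeg_le[of "snd x" n j] by (simp add: Inr)
      show "V \<iota> \<subseteq> gch m n" by (auto simp: V_def)
    qed
    then show ?thesis by (simp add: \<Phi>_def[abs_def] Inr)
  qed
  have LL: "\<Phi> (Inl i') A B = \<Phi> (Inl i) A B"
    if i: "1 \<le> m" "i < i'" "i' \<le> m" and AB: "A \<in> link {} (V (Inl i))" "B \<in> link {} (V (Inl i))"
      "B \<in> link {} (V (Inl i'))" "A \<subseteq> B" for i i' A B
  proof -
    have X: "X \<in> gch m n" "x \<in> X \<Longrightarrow> fst x \<le> m \<and> snd x \<le> n \<and> fst x \<noteq> i \<and> fst x \<noteq> i'" if "X \<in> B" for X x
      using VL[OF mem[OF AB(2) that]] VL[OF mem[OF AB(3) that]] by auto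
    obtain X0 x0 where "X0 \<in> B" "x0 \<in> X0" using witness[OF AB(2)] by blast
    \<comment> \<open>The matching equations are given only from m = 2 on. A vertex of the overlap
      avoids two rows, so there is a third one; for m = 1 such an overlap is empty.\<close>
    then have m: "2 \<le> m" using X(2)[of X0 x0] i by auto
    then have m1: "1 \<le> m - 1" by simp
    have eq: "N_xi_act (coface i) ?e (m - 1 - 1) n (y i') = N_xi_act (coface (i' - 1)) ?e (m - 1 - 1) n (y i)"
      using yy[OF m i(2,3)] by (simp add: dh_def)
    show ?thesis
      unfolding \<Phi>_def sum.case
    proof (rule dg_agree[OF yN[OF i(1,3)] gemb_row[OF m1] yN[OF i(1)] gemb_row[OF m1] eq AB(1,2,4),
          where e = "gm (\<lambda>a. codeg i (codeg i' a)) ?e"])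
      show "i \<le> m" using i by simp
      fix S assume S: "S \<in> B"
      show "gm (\<lambda>a. codeg i (codeg i' a)) ?e ` S \<in> gch (m - 1 - 1) n"
      proof (rule gm_gch[OF X(1)[OF S] mono_codeg_codeg mono_e])
        fix x assume "x \<in> S"
        then show "codeg i (codeg i' (fst x)) \<le> m - 1 - 1 \<and> snd x \<le> n"
          using X(2)[OF S, of x] codeg_codeg_le[OF i(2,3), of "fst x"] by simp
      qed
      fix x assume "x \<in> S"
      then show "gm (coface i) ?e (gm (\<lambda>a. codeg i (codeg i' a)) ?e x) = gm (codeg i') ?e x \<and>
          gm (coface (i' - 1)) ?e (gm (\<lambda>a. codeg i (codeg i' a)) ?e x) = gm (codeg i) ?e x"
        using X(2)[OF S, of x] codeg_codeg[OF i(2), of "fst x"] by (simp add: split_beta)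
    qed
  qed
  have RR: "\<Phi> (Inr j') A B = \<Phi> (Inr j) A B"
    if j: "j < j'" "j' \<le> n" "j \<noteq> k" "j' \<noteq> k" and AB: "A \<in> link {} (V (Inr j))" "B \<in> link {} (V (Inr j))"
      "B \<in> link {} (V (Inr j'))" "A \<subseteq> B" for j j' A B
  proof -
    have X: "X \<in> gch m n" "x \<in> X \<Longrightarrow> fst x \<le> m \<and> snd x \<le> n \<and> snd x \<noteq> j \<and> snd x \<noteq> j'" if "X \<in> B" for X x
      using VR[OF mem[OF AB(2) that]] VR[OF mem[OF AB(3) that]] by auto
    obtain X0 x0 where "X0 \<in> B" "x0 \<in> X0" using witness[OF AB(2)] by blast
    then have n1: "1 \<le> n - 1" using X(2)[of X0 x0] j by auto
    have jn: "j \<le> n" using j by simp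
    have eq: "N_xi_act ?e (coface j) m (n - 1 - 1) (z j') = N_xi_act ?e (coface (j' - 1)) m (n - 1 - 1) (z j)"
      using zz[OF j] by (simp add: dv_def)
    show ?thesis
      unfolding \<Phi>_def sum.case
    proof (rule dg_agree[OF z[OF j(2,4)] gemb_col[OF n1] z[OF jn j(3)] gemb_col[OF n1] eq AB(1,2,4),
          where e = "gm ?e (\<lambda>a. codeg j (codeg j' a))"])
      fix S assume S: "S \<in> B"
      show "gm ?e (\<lambda>a. codeg j (codeg j' a)) ` S \<in> gch m (n - 1 - 1)"
      proof (rule gm_gch[OF X(1)[OF S] mono_e mono_codeg_codeg])
        fix x assume "x \<in> S"
        then show "fst x \<le> m \<and> codeg j (codeg j' (snd x)) \<le> n - 1 - 1"
          using X(2)[OF S, of x] codeg_codeg_le[OF j(1,2), of "snd x"] by simp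
      qed
      fix x assume "x \<in> S"
      then show "gm ?e (coface j) (gm ?e (\<lambda>a. codeg j (codeg j' a)) x) = gm ?e (codeg j') x \<and>
          gm ?e (coface (j' - 1)) (gm ?e (\<lambda>a. codeg j (codeg j' a)) x) = gm ?e (codeg j) x"
        using X(2)[OF S, of x] codeg_codeg[OF j(1), of "snd x"] by (simp add: split_beta)
    qed
  qed
  have LR: "\<Phi> (Inl i) A B = \<Phi> (Inr j) A B"
    if i: "1 \<le> m" "i \<le> m" and j: "j \<le> n" "j \<noteq> k" and AB: "A \<in> link {} (V (Inl i))" "B \<in> link {} (V (Inl i))"
      "B \<in> link {} (V (Inr j))" "A \<subseteq> B" for i j A B
  proof -
    have X: "X \<in> gch m n" "x \<in> X \<Longrightarrow> fst x \<le> m \<and> snd x \<le> n \<and> fst x \<noteq> i \<and> snd x \<noteq> j" if "X \<in> B" for X x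
      using VL[OF mem[OF AB(2) that]] VR[OF mem[OF AB(3) that]] by auto
    have "i \<in> bdry_idx m" using i by (auto simp: bdry_idx_def)
    then have eq: "N_xi_act ?e (coface j) (m - 1) (n - 1) (y i) = N_xi_act (coface i) ?e (m - 1) (n - 1) (z j)"
      using fun_cong[OF yz[OF j], of i] by (simp add: matching_map_def matching_face_def dh_def dv_def)
    show ?thesis
      unfolding \<Phi>_def sum.case
    proof (rule dg_agree[OF yN[OF i] gemb_col[OF n(1)] z[OF j] gemb_row[OF i(1)] eq AB(1,2,4),
          where e = "gm (codeg i) (codeg j)"])
      fix S assume S: "S \<in> B"
      show "gm (codeg i) (codeg j) ` S \<in> gch (m - 1) (n - 1)"
      proof (rule gm_gch[OF X(1)[OF S] mono_codeg mono_codeg])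
        fix x assume "x \<in> S"
        then show "codeg i (fst x) \<le> m - 1 \<and> codeg j (snd x) \<le> n - 1"
          using X(2)[OF S, of x] codeg_le[of "fst x" m i] codeg_le[of "snd x" n j] i j by simp
      qed
      fix x assume "x \<in> S"
      then show "gm ?e (coface j) (gm (codeg i) (codeg j) x) = gm (codeg i) ?e x \<and>
          gm (coface i) ?e (gm (codeg i) (codeg j) x) = gm ?e (codeg j) x"
        using X(2)[OF S, of x] coface_codeg[of "fst x" i] coface_codeg[of "snd x" j] by (simp add: split_beta)
    qed
  qed
  have agree: "\<Phi> \<iota> A B = \<Phi> \<kappa> A B"
    if "\<iota> \<in> I" "\<kappa> \<in> I" "A \<in> link {} (V \<iota>)" "B \<in> link {} (V \<iota>)"
      "A \<in> link {} (V \<kappa>)" "B \<in> link {} (V \<kappa>)" "A \<subseteq> B" for \<iota> \<kappa> A B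
  proof (cases \<iota>)
    case i: (Inl i)
    show ?thesis
    proof (cases \<kappa>)
      case (Inl i')
      then show ?thesis using i that LL[of i i' A B] LL[of i' i A B] by (cases i i' rule: linorder_cases) (auto simp: I_def)
    next
      case (Inr j)
      then show ?thesis using i that LR[of i j A B] by (auto simp: I_def)
    qed
  next
    case j: (Inr j)
    show ?thesis
    proof (cases \<kappa>)
      case (Inl i)
      then show ?thesis using j that LR[of i j A B] by (auto simp: I_def)
    next
      case (Inr j')
      then show ?thesis using j that RR[of j j' A B] RR[of j' j A B] by (cases j j' rule: linorder_cases) (auto simp: I_def)
    qed
  qed
  have cover: "\<exists>\<iota>\<in>I. A \<in> link {} (V \<iota>)" if A: "A \<in> link {} (gbd m n k)" for A
  proof -
    have ch: "fchain A" "A \<noteq> {}" "A \<subseteq> gbd m n k" using A by (auto simp: link_def)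
    \<comment> \<open>The largest simplex decides: whatever row or column it avoids is avoided by
      all its faces, so the entire chain lies in one piece.\<close>
    obtain M where M: "M \<in> A" "\<And>X. X \<in> A \<Longrightarrow> X \<subseteq> M" using fchain_greatest[OF ch(1,2)] by blast
    have Mg: "M \<in> gch m n" "M \<notin> gopen m n k" using M(1) ch(3) by (auto simp: gbd_def)
    have "\<exists>\<iota>\<in>I. M \<in> V \<iota>"
    proof (cases "{0..m} \<subseteq> fst ` M")
      case True
      then have "\<not> {0..n} - {k} \<subseteq> snd ` M" using Mg by (simp add: gopen_def)
      then obtain j where "j \<in> {0..n} - {k}" "j \<notin> snd ` M" by blast
      then show ?thesis using Mg(1) by (intro bexI[of _ "Inr j"]) (auto simp: V_def I_def)
    next
      case False
      then obtain i where "i \<in> {0..m}" and iM: "i \<notin> fst ` M" by blast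
      then have i: "i \<le> m" "i \<notin> fst ` M" by simp_all
      obtain x where x: "x \<in> M" using Mg(1) by (auto simp: gch_def)
      have "fst x \<noteq> i" using i(2) x by blast
      \<comment> \<open>For m = 0 there are no pieces \<open>Inl i\<close>. The case cannot arise
        then, since a vertex outside row i needs a second row.\<close>
      then have "1 \<le> m" using i(1) bnd[OF Mg(1) x] by simp
      then show ?thesis using Mg(1) i by (intro bexI[of _ "Inl i"]) (auto simp: V_def I_def)
    qed
    then obtain \<iota> where \<iota>: "\<iota> \<in> I" "M \<in> V \<iota>" by blast
    have "X \<in> V \<iota>" if X: "X \<in> A" for X
    proof -
      have "X \<in> gch m n" using X ch(3) by (auto simp: gbd_def)
      moreover note sub = subsetD[OF image_mono[OF M(2)[OF X], of fst]] subsetD[OF image_mono[OF M(2)[OF X], of snd]]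
      have "case \<iota> of Inl i \<Rightarrow> i \<notin> fst ` X | Inr j \<Rightarrow> j \<notin> snd ` X"
        using \<iota>(2) sub by (cases \<iota>) (auto simp only: V_def mem_Collect_eq sum.case)
      ultimately show ?thesis by (simp add: V_def)
    qed
    then have "A \<in> link {} (V \<iota>)" using ch by (auto simp: link_def)
    then show ?thesis using \<iota>(1) by blast
  qed
  have "\<exists>D. rel_diagram fst D (link {} (gbd m n k)) \<and>
      (\<forall>\<iota>\<in>I. \<forall>A\<in>link {} (V \<iota>). \<forall>B\<in>link {} (V \<iota>). A \<subseteq> B \<longrightarrow> D A B = \<Phi> \<iota> A B)"
    by (rule rel_diagram_glue[OF rel agree cover])
  then obtain D where D0: "rel_diagram fst D (link {} (gbd m n k)) \<and>
      (\<forall>\<iota>\<in>I. \<forall>A\<in>link {} (V \<iota>). \<forall>B\<in>link {} (V \<iota>). A \<subseteq> B \<longrightarrow> D A B = \<Phi> \<iota> A B)"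
    by (elim exE) (rule that)
  then have D: "rel_diagram fst D (link {} (gbd m n k))"
    "\<And>\<iota> A B. \<iota> \<in> I \<Longrightarrow> A \<in> link {} (V \<iota>) \<Longrightarrow> B \<in> link {} (V \<iota>) \<Longrightarrow> A \<subseteq> B \<Longrightarrow> D A B = \<Phi> \<iota> A B"
    by simp_all
  obtain E where E0: "rel_diagram fst E (gchains m n) \<and>
      (\<forall>A\<in>link {} (gbd m n k). \<forall>B\<in>link {} (gbd m n k). A \<subseteq> B \<longrightarrow> E A B = D A B)"
    using rel_diagram_extend_grid[OF n D(1)] by (elim exE) (rule that)
  then have E: "rel_diagram fst E (gchains m n)"
    "\<And>A B. A \<in> link {} (gbd m n k) \<Longrightarrow> B \<in> link {} (gbd m n k) \<Longrightarrow> A \<subseteq> B \<Longrightarrow> E A B = D A B"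
    by simp_all
  have Vbd: "V \<iota> \<subseteq> gbd m n k" if "\<iota> \<in> I" for \<iota>
  proof
    fix X assume "X \<in> V \<iota>"
    then show "X \<in> gbd m n k"
      using that by (cases \<iota>) (auto simp: I_def V_def gbd_def gopen_def subset_iff)
  qed
  have EV: "E A B = \<Phi> \<iota> A B" if "\<iota> \<in> I" "A \<in> link {} (V \<iota>)" "B \<in> link {} (V \<iota>)" "A \<subseteq> B" for \<iota> A B
    using E(2)[OF _ _ that(4)] D(2)[OF that] subsetD[OF link_mono[OF Vbd[OF that(1)]] that(2)]
      subsetD[OF link_mono[OF Vbd[OF that(1)]] that(3)] by simp
  have img_img: "img f (img g A) = A" if "\<And>x. f (g x) = x" for f g and A :: "(nat \<times> nat) set set"
    using that by (simp add: image_image)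
  let ?x = "to_N m n E"
  have rows: "dh N_xi_act m n i ?x = y i" if i: "1 \<le> m" "i \<le> m" for i
    unfolding dh_def
  proof (rule restrict_to_N[OF E(1) yN[OF i] gemb_row[OF i(1)]])
    fix A B assume AB: "A \<in> gchains (m - 1) n" "B \<in> gchains (m - 1) n" "A \<subseteq> B"
    have "img (gm (coface i) ?e) S \<in> link {} (V (Inl i))" if "S \<in> gchains (m - 1) n" for S
    proof (rule img_link[OF that])
      fix X assume "X \<in> S"
      then have "X \<in> gch (m - 1) n" using that by (auto simp: link_def)
      then show "gm (coface i) ?e ` X \<in> V (Inl i)"
        using gemb_gch[OF gemb_row[OF i(1)]] by (auto simp: V_def coface_neq[THEN not_sym])
    qed
    then have "E (img (gm (coface i) ?e) A) (img (gm (coface i) ?e) B) =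
        \<Phi> (Inl i) (img (gm (coface i) ?e) A) (img (gm (coface i) ?e) B)"
      using i AB by (intro EV) (auto simp: I_def image_mono)
    also have "\<dots> = dg (y i) A B"
      unfolding \<Phi>_def sum.case by (subst (1 2) img_img) (auto split: prod.split)
    finally show "E (img (gm (coface i) ?e) A) (img (gm (coface i) ?e) B) = dg (y i) A B" .
  qed
  have cols: "dv N_xi_act m n j ?x = z j" if j: "j \<le> n" "j \<noteq> k" for j
    unfolding dv_def
  proof (rule restrict_to_N[OF E(1) z[OF j] gemb_col[OF n(1)]])
    fix A B assume AB: "A \<in> gchains m (n - 1)" "B \<in> gchains m (n - 1)" "A \<subseteq> B"
    have "img (gm ?e (coface j)) S \<in> link {} (V (Inr j))" if "S \<in> gchains m (n - 1)" for S
    proof (rule img_link[OF that])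
      fix X assume "X \<in> S"
      then have "X \<in> gch m (n - 1)" using that by (auto simp: link_def)
      then show "gm ?e (coface j) ` X \<in> V (Inr j)"
        using gemb_gch[OF gemb_col[OF n(1)]] by (auto simp: V_def coface_neq[THEN not_sym])
    qed
    then have "E (img (gm ?e (coface j)) A) (img (gm ?e (coface j)) B) =
        \<Phi> (Inr j) (img (gm ?e (coface j)) A) (img (gm ?e (coface j)) B)"
      using j AB by (intro EV) (auto simp: I_def image_mono)
    also have "\<dots> = dg (z j) A B"
      unfolding \<Phi>_def sum.case by (subst (1 2) img_img) (auto split: prod.split)
    finally show "E (img (gm ?e (coface j)) A) (img (gm ?e (coface j)) B) = dg (z j) A B" .
  qed
  have "matching_map N_xi_act m n ?x = y"
  proof
    fix l
    show "matching_map N_xi_act m n ?x l = y l"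
    proof (cases "l \<in> bdry_idx m")
      case True
      then have "1 \<le> m" "l \<le> m" by (auto simp: bdry_idx_def split: if_splits)
      then show ?thesis using rows True by (simp add: matching_map_def)
    next
      case False
      then show ?thesis using y by (simp add: matching_map_def matching_obj_def)
    qed
  qed
  then show ?thesis using to_N_N_xi[OF E(1)] cols by blast
qed

lemma N_xi_reedy_fibrant: "reedy_fibrant (N_xi C W) N_xi_act"
  unfolding reedy_fibrant_def kan_fibration_def
proof (intro allI conjI impI)
  fix m n x assume "x \<in> N_xi C W m n"
  then show "matching_map N_xi_act m n x \<in> matching_obj (N_xi C W) N_xi_act m n"
    by (rule matching_map_matching_obj)
next
  fix m n k y z
  assume *: "1 \<le> n \<and> k \<le> n \<and> y \<in> matching_obj (N_xi C W) N_xi_act m n \<and>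
        (\<forall>j\<le>n. j \<noteq> k \<longrightarrow> z j \<in> N_xi C W m (n - 1)) \<and>
        (\<forall>i j. i < j \<and> j \<le> n \<and> i \<noteq> k \<and> j \<noteq> k \<longrightarrow>
          dv N_xi_act m (n - 1) i (z j) = dv N_xi_act m (n - 1) (j - 1) (z i)) \<and>
        (\<forall>j\<le>n. j \<noteq> k \<longrightarrow> matching_map N_xi_act m (n - 1) (z j) = matching_face N_xi_act m n j y)"
  show "\<exists>x\<in>N_xi C W m n. matching_map N_xi_act m n x = y \<and> (\<forall>j\<le>n. j \<noteq> k \<longrightarrow> dv N_xi_act m n j x = z j)"
    by (rule horn_filler) (use * in blast)+
qed

end

lemma fibration_category_locale:
  assumes "fibration_category C W F"
  shows "\<exists>t. fibration_cat C W F t"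
proof -
  note a = assms[unfolded fibration_category_def]
  note RF = conjunct1[OF a] conjunct1[OF conjunct2[OF a]]
  obtain t where t: "terminal C t" "fibrant C F t t" "\<forall>f. iso C f \<longrightarrow> f \<in> W"
      "\<forall>f. iso C f \<and> fibrant C F t (c_cod C f) \<longrightarrow> f \<in> F"
    and six: "\<forall>f \<in> c_arr C. \<forall>g \<in> c_arr C. \<forall>h \<in> c_arr C.
          c_cod C f = c_dom C g \<and> c_cod C g = c_dom C h \<and>
          c_comp C g f \<in> W \<and> c_comp C h g \<in> W \<longrightarrow> f \<in> W \<and> g \<in> W \<and> h \<in> W"
    and pb: "\<forall>f \<in> c_arr C. \<forall>p \<in> F.
          fibrant C F t (c_dom C f) \<and> fibrant C F t (c_cod C f) \<and> c_cod C p = c_cod C f \<longrightarrow>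
          (\<exists>P a b. is_pullback C f p P a b) \<and>
          (\<forall>P a b. is_pullback C f p P a b \<longrightarrow> a \<in> F \<and> (p \<in> W \<longrightarrow> a \<in> W))"
    and fac: "\<forall>f \<in> c_arr C. fibrant C F t (c_cod C f) \<longrightarrow>
          (\<exists>s p. s \<in> W \<and> p \<in> F \<and> s \<in> c_arr C \<and> p \<in> c_arr C \<and>
                 c_cod C s = c_dom C p \<and> c_comp C p s = f)"
    using conjunct2[OF conjunct2[OF a]] by (elim conjE exE) (rule that)
  have "fibration_cat C W F t"
  proof
    fix f p assume fp: "f \<in> c_arr C" "p \<in> F" "fibrant C F t (c_dom C f)" "fibrant C F t (c_cod C f)" "c_cod C p = c_cod C f"
    then have *: "(\<exists>P a b. is_pullback C f p P a b) \<and>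
          (\<forall>P a b. is_pullback C f p P a b \<longrightarrow> a \<in> F \<and> (p \<in> W \<longrightarrow> a \<in> W))" using pb by simp
    show "\<exists>P a b. is_pullback C f p P a b" using * by (rule conjunct1)
    show "a \<in> F \<and> (p \<in> W \<longrightarrow> a \<in> W)" if "is_pullback C f p P a b" for P a b
      using conjunct2[OF *] that by (elim allE impE)
  qed (use RF t six fac in \<open>simp_all add: relative_category_def\<close>)
  then show ?thesis ..
qed

theorem theorem4p10:
  fixes C :: "('o, 'm) cat" and W F :: "'m set"
  assumes "fibration_category C W F"
  shows "reedy_fibrant (N_xi C W) N_xi_act"
  using fibration_category_locale[OF assms] by (elim exE) (rule fibration_cat.N_xi_reedy_fibrant)

end
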